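(* Let $\ell>2$ be an odd prime, let $\gamma$ be a primitive root modulo $\ell$, and let $t_\gamma$ be the Frobenius trace of the smooth projective model over $\mathbb F_\ell$ of $Y^2=(X^2-1)(X^2-\gamma)$. Then $$|U_{\gamma,\gamma^2}(N;\ell)|\le\frac{3\ell}{4}+1\quad\text{for every }N\in\mathbb F_\ell^*$$ if and only if $$-3+2\chi(\gamma-1)\le t_\gamma\le 3+2\chi(1-\gamma).$$
   Context: $\chi$ denotes the Legendre symbol modulo $\ell$ on $\mathbb F_\ell$, with $\chi(0)=0$. A primitive root modulo $\ell$ is a generator of $\mathbb F_\ell^*$. For $a,b,N\in\mathbb F_\ell^*$, $H_a(N;\ell)=\{ax+Nx^{-1}:x\in\mathbb F_\ell^*\}\subseteq\mathbb F_\ell$ and $U_{a,b}(N;\ell)=H_a(N;\ell)\cup H_b(N;\ell)$. The smooth projective model of an affine curve over $\mathbb F_\ell$ is the nonsingular projective curve over $\mathbb F_\ell$ birational to it. The Frobenius trace of a smooth projective genus-one curve $E/\mathbb F_\ell$ is $t_E=\ell+1-\#E(\mathbb F_\ell)$. *)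

theory Defs
  imports
    "Berlekamp_Zassenhaus.Finite_Field"
    "HOL-Number_Theory.Number_Theory"
    "HOL-Algebra.Algebraic_Closure_Type"
    "HOL-Library.Poly_Mapping"
    "HOL-Library.Function_Algebras"
    Complex_Main
begin

section \<open>Arithmetic in the prime field\<close>

definition chi :: "'p::prime_card mod_ring \<Rightarrow> int" where
  "chi x = Legendre (to_int_mod_ring x) (int CARD('p))"

definition primitive_root :: "'a::field \<Rightarrow> bool" where
  "primitive_root g \<longleftrightarrow> range (\<lambda>k::int. g powi k) = - {0}"

definition H_set :: "'a::field \<Rightarrow> 'a \<Rightarrow> 'a set" where
  "H_set a N = {a * x + N * inverse x | x. x \<noteq> 0}"

definition U_set :: "'a::field \<Rightarrow> 'a \<Rightarrow> 'a \<Rightarrow> 'a set" where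
  "U_set a b N = H_set a N \<union> H_set b N"

section \<open>Polynomials in finitely many of the variables \<open>0, 1, 2, \<dots>\<close>\<close>

type_synonym 'a mpoly = "(nat \<Rightarrow>\<^sub>0 nat) \<Rightarrow>\<^sub>0 'a"

definition mvar :: "nat \<Rightarrow> 'a::comm_ring_1 mpoly" where
  "mvar i = Poly_Mapping.single (Poly_Mapping.single i 1) 1"

definition mconst :: "'a::comm_ring_1 \<Rightarrow> 'a mpoly" where
  "mconst c = Poly_Mapping.single 0 c"

text \<open>
  The value of \<open>p\<close> at \<open>v\<close>, where \<open>h\<close> embeds the coefficient field into the field in
  which the coordinates of \<open>v\<close> live.
\<close>
definition mp_eval :: "('a::comm_ring_1 \<Rightarrow> 'b::comm_ring_1) \<Rightarrow> 'a mpoly \<Rightarrow> (nat \<Rightarrow> 'b) \<Rightarrow> 'b" where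
  "mp_eval h p v =
     (\<Sum>m\<in>Poly_Mapping.keys p. h (Poly_Mapping.lookup p m) *
        (\<Prod>i\<in>Poly_Mapping.keys m. v i ^ Poly_Mapping.lookup m i))"

definition mp_deriv :: "nat \<Rightarrow> 'a::comm_ring_1 mpoly \<Rightarrow> 'a mpoly" where
  "mp_deriv j p =
     (\<Sum>m\<in>Poly_Mapping.keys p.
        Poly_Mapping.single (m - Poly_Mapping.single j 1)
          (of_nat (Poly_Mapping.lookup m j) * Poly_Mapping.lookup p m))"

text \<open>Only the variables \<open>0, \<dots>, n - 1\<close> occur in \<open>p\<close>.\<close>
definition mp_vars :: "nat \<Rightarrow> 'a::comm_ring_1 mpoly \<Rightarrow> bool" where
  "mp_vars n p \<longleftrightarrow> (\<forall>m\<in>Poly_Mapping.keys p. Poly_Mapping.keys m \<subseteq> {..<n})"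

definition mp_homogeneous :: "nat \<Rightarrow> 'a::comm_ring_1 mpoly \<Rightarrow> bool" where
  "mp_homogeneous d p \<longleftrightarrow>
     (\<forall>m\<in>Poly_Mapping.keys p. (\<Sum>i\<in>Poly_Mapping.keys m. Poly_Mapping.lookup m i) = d)"

text \<open>The homogeneous polynomials in the homogeneous coordinates \<open>0, \<dots>, n\<close> of \<open>n\<close>-space.\<close>
definition forms :: "nat \<Rightarrow> 'a::comm_ring_1 mpoly set" where
  "forms n = {F. mp_vars (Suc n) F \<and> (\<exists>d. mp_homogeneous d F)}"

section \<open>Affine and projective zero sets\<close>

text \<open>
  Vectors of length \<open>n\<close> are functions on \<open>nat\<close> that vanish outside \<open>{..<n}\<close>; a projective
  point is the set of all its vectors of homogeneous coordinates.
\<close>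
definition vecs :: "nat \<Rightarrow> (nat \<Rightarrow> 'b::zero) set" where
  "vecs n = {v. \<forall>i\<ge>n. v i = 0}"

definition proj_point :: "(nat \<Rightarrow> 'b::field) \<Rightarrow> (nat \<Rightarrow> 'b) set" where
  "proj_point v = {(\<lambda>i. c * v i) | c. c \<noteq> 0}"

definition proj_space :: "nat \<Rightarrow> (nat \<Rightarrow> 'b::field) set set" where
  "proj_space n = proj_point ` (vecs (Suc n) - {\<lambda>i. 0})"

definition affine_zeros ::
    "('a::field \<Rightarrow> 'b::field) \<Rightarrow> nat \<Rightarrow> 'a mpoly set \<Rightarrow> (nat \<Rightarrow> 'b) set" where
  "affine_zeros h m T = {x \<in> vecs m. \<forall>f\<in>T. mp_eval h f x = 0}"

definition proj_zeros ::
    "('a::field \<Rightarrow> 'b::field) \<Rightarrow> nat \<Rightarrow> 'a mpoly set \<Rightarrow> (nat \<Rightarrow> 'b) set set" where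
  "proj_zeros h n S = {P \<in> proj_space n. \<forall>F\<in>S. \<forall>v\<in>P. mp_eval h F v = 0}"

text \<open>
  A projective variety over \<open>k\<close> is given by a set \<open>S\<close> of forms over \<open>k\<close>. Its geometric points
  have coordinates in the algebraic closure of \<open>k\<close>, its rational points have coordinates in
  \<open>k\<close>. Closed sets are those of the Zariski topology of projective space over \<open>k\<close>.
\<close>
abbreviation geom_points :: "nat \<Rightarrow> 'a::field mpoly set \<Rightarrow> (nat \<Rightarrow> 'a alg_closure) set set" where
  "geom_points n S \<equiv> proj_zeros to_ac n S"

abbreviation rational_points :: "nat \<Rightarrow> 'a::field mpoly set \<Rightarrow> (nat \<Rightarrow> 'a) set set" where
  "rational_points n S \<equiv> proj_zeros (\<lambda>c. c) n S"

definition zariski_closed :: "nat \<Rightarrow> (nat \<Rightarrow> 'a::field alg_closure) set set \<Rightarrow> bool" where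
  "zariski_closed n Z \<longleftrightarrow> (\<exists>S::'a mpoly set. S \<subseteq> forms n \<and> Z = geom_points n S)"

definition irreducible_closed :: "nat \<Rightarrow> (nat \<Rightarrow> 'a::field alg_closure) set set \<Rightarrow> bool" where
  "irreducible_closed n Z \<longleftrightarrow> zariski_closed n Z \<and> Z \<noteq> {} \<and>
     (\<forall>Z1 Z2. zariski_closed n Z1 \<and> zariski_closed n Z2 \<and> Z = Z1 \<union> Z2 \<longrightarrow> Z = Z1 \<or> Z = Z2)"

text \<open>Dimension one: the longest chains of irreducible closed subsets have the form \<open>Z \<subset> E\<close>.\<close>
definition projective_curve :: "nat \<Rightarrow> 'a::field mpoly set \<Rightarrow> bool" where
  "projective_curve n S \<longleftrightarrow> S \<subseteq> forms n \<and> irreducible_closed n (geom_points n S) \<and>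
     (\<exists>Z. irreducible_closed n Z \<and> Z \<subset> geom_points n S) \<and>
     \<not> (\<exists>Z Z'. irreducible_closed n Z \<and> irreducible_closed n Z' \<and>
            Z \<subset> Z' \<and> Z' \<subset> geom_points n S)"

definition vanishing_forms :: "nat \<Rightarrow> 'a::field mpoly set \<Rightarrow> 'a mpoly set" where
  "vanishing_forms n S = {F \<in> forms n. \<forall>P\<in>geom_points n S. \<forall>v\<in>P. mp_eval to_ac F v = 0}"

definition gradient :: "'a::field mpoly \<Rightarrow> (nat \<Rightarrow> 'a alg_closure) \<Rightarrow> nat \<Rightarrow> 'a alg_closure" where
  "gradient F v = (\<lambda>j. mp_eval to_ac (mp_deriv j F) v)"

definition vscale :: "'b::field \<Rightarrow> (nat \<Rightarrow> 'b) \<Rightarrow> nat \<Rightarrow> 'b" where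
  "vscale c w = (\<lambda>i. c * w i)"

lemma vector_space_vscale: "vector_space vscale"
  by unfold_locales (auto simp: vscale_def algebra_simps fun_eq_iff)

text \<open>
  The Jacobian criterion at every geometric point: the gradients of the forms over \<open>k\<close> that
  vanish on the curve span a space of dimension \<open>n - 1\<close>, its codimension. It suffices to take
  forms over \<open>k\<close> when \<open>k\<close> is perfect, since these then generate the homogeneous ideal
  over the algebraic closure.
\<close>
definition nonsingular_projective_curve :: "nat \<Rightarrow> 'a::field mpoly set \<Rightarrow> bool" where
  "nonsingular_projective_curve n S \<longleftrightarrow> projective_curve n S \<and>
     (\<forall>P\<in>geom_points n S. \<forall>v\<in>P.
        vector_space.dim vscale ((\<lambda>F. gradient F v) ` vanishing_forms n S) = n - 1)"

section \<open>Smooth projective models\<close>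

text \<open>
  \<open>rat_to_proj F\<close> and \<open>rat_to_affine G H\<close> are the rational maps \<open>x \<mapsto> [F 0 : \<dots> : F n](x)\<close>
  and \<open>P \<mapsto> (G 0 / H, \<dots>, G (m - 1) / H)(P)\<close>.
\<close>
definition rat_to_proj ::
    "nat \<Rightarrow> (nat \<Rightarrow> 'a::field mpoly) \<Rightarrow> (nat \<Rightarrow> 'a alg_closure) \<Rightarrow> nat \<Rightarrow> 'a alg_closure" where
  "rat_to_proj n F x = (\<lambda>i. if i \<le> n then mp_eval to_ac (F i) x else 0)"

definition rat_to_affine ::
    "nat \<Rightarrow> (nat \<Rightarrow> 'a::field mpoly) \<Rightarrow> 'a mpoly \<Rightarrow> (nat \<Rightarrow> 'a alg_closure) \<Rightarrow> nat \<Rightarrow> 'a alg_closure"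
  where
  "rat_to_affine m G H w =
     (\<lambda>j. if j < m then mp_eval to_ac (G j) w / mp_eval to_ac H w else 0)"

text \<open>
  The variety \<open>T\<close> in affine \<open>m\<close>-space is birational over \<open>k\<close> to the variety \<open>S\<close> in projective
  \<open>n\<close>-space: two rational maps over \<open>k\<close> restrict to mutually inverse bijections between the
  nonempty open subsets \<open>U\<close> and \<open>V\<close> on which the maps and their composites are defined.
\<close>
definition birational :: "nat \<Rightarrow> 'a::field mpoly set \<Rightarrow> nat \<Rightarrow> 'a mpoly set \<Rightarrow> bool" where
  "birational m T n S \<longleftrightarrow>
     (\<exists>F G H d.
        (\<forall>i\<le>n. mp_vars m (F i)) \<and>
        (\<forall>j<m. mp_vars (Suc n) (G j) \<and> mp_homogeneous d (G j)) \<and>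
        mp_vars (Suc n) H \<and> mp_homogeneous d H \<and>
        (let \<phi> = rat_to_proj n F;
             \<psi> = rat_to_affine m G H;
             U = {x \<in> affine_zeros to_ac m T.
                    \<phi> x \<noteq> (\<lambda>i. 0) \<and> mp_eval to_ac H (\<phi> x) \<noteq> 0};
             V = {P \<in> geom_points n S.
                    \<forall>w\<in>P. mp_eval to_ac H w \<noteq> 0 \<and> \<phi> (\<psi> w) \<noteq> (\<lambda>i. 0)}
         in U \<noteq> {} \<and> V \<noteq> {} \<and>
            (\<forall>x\<in>U. proj_point (\<phi> x) \<in> geom_points n S \<and> \<psi> (\<phi> x) = x) \<and>
            (\<forall>P\<in>V. \<forall>w\<in>P. \<psi> w \<in> affine_zeros to_ac m T \<and> proj_point (\<phi> (\<psi> w)) = P)))"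

definition smooth_projective_model ::
    "nat \<Rightarrow> 'a::field mpoly set \<Rightarrow> nat \<Rightarrow> 'a mpoly set \<Rightarrow> bool" where
  "smooth_projective_model m T n S \<longleftrightarrow>
     nonsingular_projective_curve n S \<and> birational m T n S"

definition frobenius_trace :: "nat \<Rightarrow> 'a::{field,finite} mpoly set \<Rightarrow> int" where
  "frobenius_trace n S = int CARD('a) + 1 - int (card (rational_points n S))"

text \<open>\<open>Y\<^sup>2 - (X\<^sup>2 - 1) (X\<^sup>2 - g)\<close>, with \<open>X\<close> the variable \<open>0\<close> and \<open>Y\<close> the variable \<open>1\<close>.\<close>
definition quartic :: "'a::field \<Rightarrow> 'a mpoly" where
  "quartic g = mvar 1 ^ 2 - (mvar 0 ^ 2 - 1) * (mvar 0 ^ 2 - mconst g)"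

end

theory Submission
  imports Defs "HOL-Computational_Algebra.Normalized_Fraction"
begin

hide_const (open) Polynomials.degree

text \<open>
  Let \<open>\<ell>\<close> be the prime, \<open>k\<close> the field with \<open>\<ell>\<close> elements, and
  \<open>S = (\<Sum>x. \<chi> ((x\<^sup>2 - 1) (x\<^sup>2 - \<gamma>)))\<close>. Both sides of the equivalence are conditions
  on \<open>S\<close>.

  The union. Since \<open>a x + N / x = y\<close> is a quadratic equation in \<open>x\<close> of discriminant
  \<open>y\<^sup>2 - 4 a N\<close>, the complement of the union consists of the \<open>y\<close> for which
  \<open>p = y\<^sup>2 - 4 \<gamma> N\<close> and \<open>q = y\<^sup>2 - 4 \<gamma>\<^sup>2 N\<close> are both nonsquares, and summing
  \<open>(1 - \<chi> p) (1 - \<chi> q)\<close> counts it up to the contribution of the zeros of \<open>p\<close> and \<open>q\<close>.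
  Exactly one of \<open>\<gamma> N\<close> and \<open>\<gamma>\<^sup>2 N\<close> is a square; scaling \<open>y\<close> by twice its root turns
  \<open>p q\<close>, up to a constant, into the quartic or into its reciprocal polynomial.
  So each of the two square classes of \<open>N\<close> contributes one of the two inequalities
  (\<open>U_bound_iff_char_sum\<close>).

  The trace. The claim \<open>t = - 1 - S\<close> says that \<open>E\<close> has two rational points more than the
  affine quartic, whatever smooth projective model \<open>E\<close> is. The reason is that the rational
  points of a nonsingular projective curve correspond to the rational places of its
  function field, which depend only on the birational class
  (\<open>card_rational_points\<close>). Here a place is a partial ring homomorphism \<open>e\<close> from the function
  field to \<open>k\<close> such that \<open>e (1 / z) = 0\<close> whenever \<open>e z\<close> is undefined.

  From points to places: the quotients of forms of equal degree whose denominator does not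
  vanish at the point \<open>P\<close> form a local ring, with evaluation at \<open>P\<close> as local map. The
  Jacobian criterion, the Taylor expansion and Nakayama's lemma show that its maximal ideal
  is generated by one element \<open>u\<close>. Any element \<open>a \<noteq> 0\<close> of the local ring is algebraically
  dependent on \<open>u\<close> and therefore divides a power of \<open>u\<close>; hence every nonzero element of
  the function field is a unit times a power of \<open>u\<close>, and evaluation at \<open>P\<close> is a place
  (\<open>place_if_kernel_principal\<close>). From places to points: dividing the homogeneous
  coordinates by the one of smallest value gives the center of a place. A place cannot be
  extended to a larger local map, so the two constructions are inverse to each other.

  The function field of \<open>E\<close> is identified with \<open>k(x, y)\<close>, \<open>y\<^sup>2 = (x\<^sup>2 - 1) (x\<^sup>2 - \<gamma>)\<close>,
  inside an algebraic closure of \<open>k(x)\<close>. There \<open>(x, y)\<close> is a generic point of the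
  affine curve: a polynomial vanishes at it iff it vanishes on the curve. The birational map sends it to
  a generic point of \<open>E\<close> (\<open>ex_homogeneous_generic_point\<close>); this uses that \<open>E\<close> is irreducible.

  Finally the places of \<open>k(x, y)\<close> are counted by the same criterion (\<open>card_places\<close>). Those with
  \<open>x\<close> finite are the points of the affine quartic. The others are the points with
  \<open>w = 0\<close> of the curve \<open>v\<^sup>2 = (1 - w\<^sup>2) (1 - \<gamma> w\<^sup>2)\<close> in the coordinates \<open>w = 1 / x\<close>,
  \<open>v = y / x\<^sup>2\<close>, that is, \<open>v = \<plusminus> 1\<close>.
\<close>

section \<open>Evaluation of multivariate polynomials\<close>

definition mono_eval :: "(nat \<Rightarrow> 'b::comm_ring_1) \<Rightarrow> (nat \<Rightarrow>\<^sub>0 nat) \<Rightarrow> 'b" where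
  "mono_eval v m = (\<Prod>i\<in>Poly_Mapping.keys m. v i ^ Poly_Mapping.lookup m i)"

lemma mono_eval_superset:
  assumes "finite I" "Poly_Mapping.keys m \<subseteq> I"
  shows "mono_eval v m = (\<Prod>i\<in>I. v i ^ Poly_Mapping.lookup m i)"
  unfolding mono_eval_def
  by (rule prod.mono_neutral_left) (use assms in \<open>auto simp: in_keys_iff\<close>)

lemma mono_eval_add: "mono_eval v (m + m') = mono_eval v m * mono_eval v m'"
proof -
  let ?I = "Poly_Mapping.keys m \<union> Poly_Mapping.keys m'"
  have "Poly_Mapping.keys (m + m') \<subseteq> ?I" by (rule Poly_Mapping.keys_add)
  then show ?thesis
    by (simp add: mono_eval_superset[of ?I] lookup_add power_add prod.distrib)
qed

lemma mono_eval_0 [simp]: "mono_eval v 0 = 1"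
  by (simp add: mono_eval_def)

lemma mono_eval_single [simp]: "mono_eval v (Poly_Mapping.single i k) = v i ^ k"
  by (simp add: mono_eval_def)

lemma mpoly_sum_induct [case_names single add]:
  assumes single: "\<And>m c. P (Poly_Mapping.single m c)"
    and add: "\<And>p q. P p \<Longrightarrow> P q \<Longrightarrow> P (p + q)"
  shows "P (p :: 'a::comm_ring_1 mpoly)"
proof (induction p rule: Poly_Mapping.update_induct)
  case const
  then show ?case using single[of 0 0] by simp
next
  case (update p m c)
  have "Poly_Mapping.update m c p = p + Poly_Mapping.single m c"
    using update(1) by (intro poly_mapping_eqI)
      (auto simp: lookup_update lookup_add lookup_single in_keys_iff when_def)
  then show ?case using add[OF update(3) single] by simp
qed

context comm_ring_hom
begin

lemma mp_eval_superset:
  assumes "finite S" "Poly_Mapping.keys p \<subseteq> S"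
  shows "mp_eval hom p v = (\<Sum>m\<in>S. hom (Poly_Mapping.lookup p m) * mono_eval v m)"
  unfolding mp_eval_def mono_eval_def
  by (rule sum.mono_neutral_left) (use assms in \<open>auto simp: in_keys_iff\<close>)

lemma mp_eval_add: "mp_eval hom (p + q) v = mp_eval hom p v + mp_eval hom q v"
proof -
  let ?S = "Poly_Mapping.keys p \<union> Poly_Mapping.keys q"
  have "Poly_Mapping.keys (p + q) \<subseteq> ?S" by (rule Poly_Mapping.keys_add)
  then show ?thesis
    by (simp add: mp_eval_superset[of ?S] lookup_add hom_add distrib_right sum.distrib)
qed

lemma mp_eval_single [simp]: "mp_eval hom (Poly_Mapping.single m c) v = hom c * mono_eval v m"
  by (subst mp_eval_superset[of "{m}"]) auto

lemma mp_eval_0 [simp]: "mp_eval hom 0 v = 0"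
  by (simp add: mp_eval_def)

lemma mp_eval_mconst [simp]: "mp_eval hom (mconst c) v = hom c"
  by (simp add: mconst_def)

lemma mp_eval_mvar [simp]: "mp_eval hom (mvar i) v = v i"
  by (simp add: mvar_def)

lemma mp_eval_1 [simp]: "mp_eval hom 1 v = 1"
  using mp_eval_single[of 0 1 v] by simp

lemma mp_eval_mult: "mp_eval hom (p * q) v = mp_eval hom p v * mp_eval hom q v"
proof (induction p rule: mpoly_sum_induct)
  case (single m c)
  show ?case
  proof (induction q rule: mpoly_sum_induct)
    case (single m' c')
    then show ?case by (simp add: mult_single mono_eval_add hom_mult ac_simps)
  next
    case (add p q)
    then show ?case by (simp add: distrib_left mp_eval_add)
  qed
next
  case (add p q)
  then show ?case by (simp add: distrib_right mp_eval_add)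
qed

lemma comm_ring_hom_mp_eval: "comm_ring_hom (\<lambda>p. mp_eval hom p v)"
  by unfold_locales (simp_all add: mp_eval_add mp_eval_mult)

lemma mp_eval_diff: "mp_eval hom (p - q) v = mp_eval hom p v - mp_eval hom q v"
  and mp_eval_power: "mp_eval hom (p ^ k) v = mp_eval hom p v ^ k"
proof -
  interpret ev: comm_ring_hom "\<lambda>p. mp_eval hom p v" by (rule comm_ring_hom_mp_eval)
  show "mp_eval hom (p - q) v = mp_eval hom p v - mp_eval hom q v"
    "mp_eval hom (p ^ k) v = mp_eval hom p v ^ k"
    by (simp_all add: ev.hom_minus ev.hom_power)
qed

lemma hom_mono_eval: "hom (mono_eval v m) = mono_eval (\<lambda>i. hom (v i)) m"
  by (simp add: mono_eval_def hom_prod hom_power)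

lemma hom_mp_eval:
  assumes "comm_ring_hom h"
  shows "hom (mp_eval h p v) = mp_eval (\<lambda>c. hom (h c)) p (\<lambda>i. hom (v i))"
proof -
  interpret h: comm_ring_hom h by fact
  have "comm_ring_hom (\<lambda>c. hom (h c))"
    by unfold_locales (simp_all add: h.hom_add h.hom_mult hom_add hom_mult)
  then interpret hh: comm_ring_hom "\<lambda>c. hom (h c)" .
  show ?thesis
    by (induction p rule: mpoly_sum_induct)
      (simp_all add: h.mp_eval_add hh.mp_eval_add hom_add hom_mult hom_mono_eval)
qed

end

lemma comm_ring_hom_id: "comm_ring_hom (\<lambda>c. c)"
  by unfold_locales auto

lemma comm_ring_hom_mconst: "comm_ring_hom (mconst :: 'a::comm_ring_1 \<Rightarrow> 'a mpoly)"
  by unfold_locales (simp_all add: mconst_def single_add mult_single)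

interpretation mconst: comm_ring_hom "mconst :: 'a::comm_ring_1 \<Rightarrow> 'a mpoly"
  by (rule comm_ring_hom_mconst)

text \<open>
  Evaluating a polynomial at polynomials, with coefficients embedded by \<open>mconst\<close>, is
  substitution. Composites of rational maps are formed in this way.
\<close>

lemma (in comm_ring_hom) mp_eval_subst:
  "mp_eval hom (mp_eval mconst G F) v = mp_eval hom G (\<lambda>i. mp_eval hom (F i) v)"
proof -
  interpret ev: comm_ring_hom "\<lambda>p. mp_eval hom p v" by (rule comm_ring_hom_mp_eval)
  show ?thesis
    by (subst ev.hom_mp_eval[OF comm_ring_hom_mconst]) simp
qed

lemma single_eq_mono_eval:
  "Poly_Mapping.single m c = mconst c * mono_eval mvar (m :: nat \<Rightarrow>\<^sub>0 nat)"
proof -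
  have "mono_eval mvar m = (Poly_Mapping.single m 1 :: 'a mpoly)"
  proof (induction m rule: Poly_Mapping.update_induct)
    case (update m i k)
    have eq: "Poly_Mapping.update i k m = m + Poly_Mapping.single i k"
      using update(1) by (intro poly_mapping_eqI)
        (auto simp: lookup_update lookup_add lookup_single in_keys_iff when_def)
    have pow: "mvar i ^ k = (Poly_Mapping.single (Poly_Mapping.single i k) 1 :: 'a mpoly)" for k
    proof (induction k)
      case (Suc k)
      have "Poly_Mapping.single i 1 + Poly_Mapping.single i k = Poly_Mapping.single i (Suc k)"
        by (simp flip: single_add)
      then show ?case unfolding power_Suc Suc unfolding mvar_def by (simp add: mult_single)
    qed simp
    show ?case
      by (simp add: eq mono_eval_add update(3) pow mult_single)
  qed simp
  then show ?thesis by (simp add: mconst_def mult_single)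
qed

text \<open>
  Statements about polynomial functions only have to be checked on constants, variables,
  sums and products. Most facts below about values at a generic point are proved this way.
\<close>

lemma mp_vars_induct [consumes 1, case_names const var add mult]:
  assumes vars: "mp_vars n p"
    and const: "\<And>c. P (mconst c)"
    and var: "\<And>i. i < n \<Longrightarrow> P (mvar i)"
    and add: "\<And>p q. P p \<Longrightarrow> P q \<Longrightarrow> P (p + q)"
    and mult: "\<And>p q. P p \<Longrightarrow> P q \<Longrightarrow> P (p * q)"
  shows "P (p :: 'a::comm_ring_1 mpoly)"
proof -
  have pow: "P (mvar i ^ k)" if "i < n" for i k
    using const[of 1] by (induction k) (auto intro: mult var that)
  have mono: "P (mono_eval mvar m)" if "Poly_Mapping.keys m \<subseteq> {..<n}" for m
  proof -
    have "P (\<Prod>i\<in>I. mvar i ^ Poly_Mapping.lookup m i)" if "finite I" "I \<subseteq> {..<n}" for I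
      using that by (induction I rule: finite_induct) (use const[of 1] in \<open>auto intro: mult pow\<close>)
    from this[of "Poly_Mapping.keys m"] that show ?thesis by (simp add: mono_eval_def)
  qed
  have "P (\<Sum>m\<in>S. Poly_Mapping.single m (Poly_Mapping.lookup p m))"
    if "finite S" "S \<subseteq> Poly_Mapping.keys p" for S
    using that
  proof (induction S rule: finite_induct)
    case (insert m S)
    then show ?case
      using vars by (auto intro!: add mult const mono simp: single_eq_mono_eval mp_vars_def)
  qed (use const[of 0] in auto)
  moreover have "p = (\<Sum>m\<in>Poly_Mapping.keys p. Poly_Mapping.single m (Poly_Mapping.lookup p m))"
    by (intro poly_mapping_eqI)
      (auto simp: lookup_sum lookup_single when_def in_keys_iff)
  ultimately show ?thesis by (metis finite_keys order_refl)
qed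

lemma mp_vars_mconst [simp]: "mp_vars n (mconst c)"
  by (auto simp: mp_vars_def mconst_def split: if_splits)

lemma mp_vars_mvar [simp]: "i < n \<Longrightarrow> mp_vars n (mvar i)"
  by (auto simp: mp_vars_def mvar_def)

lemma mp_vars_0 [simp]: "mp_vars n 0"
  by (simp add: mp_vars_def)

lemma mp_vars_add: "mp_vars n p \<Longrightarrow> mp_vars n q \<Longrightarrow> mp_vars n (p + q)"
  using Poly_Mapping.keys_add[of p q] by (auto simp: mp_vars_def)

lemma mp_vars_mult:
  assumes "mp_vars n p" "mp_vars n q"
  shows "mp_vars n (p * q)"
  unfolding mp_vars_def
proof
  fix m assume "m \<in> Poly_Mapping.keys (p * q)"
  then obtain a b where "m = a + b" "a \<in> Poly_Mapping.keys p" "b \<in> Poly_Mapping.keys q"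
    using keys_mult[of p q] by blast
  then show "Poly_Mapping.keys m \<subseteq> {..<n}"
    using assms Poly_Mapping.keys_add[of a b] by (fastforce simp: mp_vars_def)
qed

section \<open>Forms\<close>

definition mono_degree :: "(nat \<Rightarrow>\<^sub>0 nat) \<Rightarrow> nat" where
  "mono_degree m = (\<Sum>i\<in>Poly_Mapping.keys m. Poly_Mapping.lookup m i)"

lemma mono_degree_add: "mono_degree (m + m') = mono_degree m + mono_degree m'"
proof -
  have sup: "mono_degree m = (\<Sum>i\<in>I. Poly_Mapping.lookup m i)"
    if "finite I" "Poly_Mapping.keys m \<subseteq> I" for m I
    unfolding mono_degree_def
    by (rule sum.mono_neutral_left) (use that in \<open>auto simp: in_keys_iff\<close>)
  let ?I = "Poly_Mapping.keys m \<union> Poly_Mapping.keys m'"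
  have "Poly_Mapping.keys (m + m') \<subseteq> ?I" by (rule Poly_Mapping.keys_add)
  then show ?thesis
    by (simp add: sup[of ?I] lookup_add sum.distrib)
qed

lemma mp_homogeneous_iff: "mp_homogeneous d p \<longleftrightarrow> (\<forall>m\<in>Poly_Mapping.keys p. mono_degree m = d)"
  by (simp add: mp_homogeneous_def mono_degree_def)

text \<open>
  The degree is made explicit, since quotients of forms are functions only if the two
  degrees agree.
\<close>

definition form :: "nat \<Rightarrow> nat \<Rightarrow> 'a::comm_ring_1 mpoly \<Rightarrow> bool" where
  "form n d p \<longleftrightarrow> mp_vars (Suc n) p \<and> mp_homogeneous d p"

lemma forms_eq: "forms n = {p. \<exists>d. form n d p}"
  by (auto simp: forms_def form_def)

lemma form_vars: "form n d p \<Longrightarrow> mp_vars (Suc n) p"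
  by (simp add: form_def)

lemma form_0 [simp]: "form n d 0"
  by (simp add: form_def mp_homogeneous_def)

lemma form_mconst [simp]: "form n 0 (mconst c)"
  unfolding form_def by (rule conjI) (simp, auto simp: mp_homogeneous_def mconst_def split: if_splits)

lemma form_1 [simp]: "form n 0 1"
  using form_mconst[of n 1] by simp

lemma form_mvar [simp]: "i \<le> n \<Longrightarrow> form n (Suc 0) (mvar i)"
  by (auto simp: form_def mp_homogeneous_def mp_vars_def mvar_def)

lemma form_add: "form n d p \<Longrightarrow> form n d q \<Longrightarrow> form n d (p + q)"
  using Poly_Mapping.keys_add[of p q] by (auto simp: form_def mp_vars_add mp_homogeneous_iff)

lemma form_mult:
  assumes "form n d p" "form n e q"
  shows "form n (d + e) (p * q)"
proof -
  have "mp_homogeneous (d + e) (p * q)"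
    unfolding mp_homogeneous_iff
  proof
    fix m assume "m \<in> Poly_Mapping.keys (p * q)"
    then obtain a b where "m = a + b" "a \<in> Poly_Mapping.keys p" "b \<in> Poly_Mapping.keys q"
      using keys_mult[of p q] by blast
    then show "mono_degree m = d + e"
      using assms by (auto simp: form_def mp_homogeneous_iff mono_degree_add)
  qed
  then show ?thesis using assms by (simp add: form_def mp_vars_mult)
qed

lemma form_power: "form n d p \<Longrightarrow> form n (k * d) (p ^ k)"
  by (induction k) (auto simp: form_mult)

lemma mono_eval_scale: "mono_eval (\<lambda>i. c * v i) m = c ^ mono_degree m * mono_eval v m"
  by (simp add: mono_eval_def mono_degree_def power_mult_distrib prod.distrib power_sum)

lemma form_eval_scale:
  assumes "form n d p"
  shows "mp_eval h p (\<lambda>i. c * v i) = c ^ d * mp_eval h p v"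
proof -
  have "mp_eval h p (\<lambda>i. c * v i) =
      (\<Sum>m\<in>Poly_Mapping.keys p. h (Poly_Mapping.lookup p m) * mono_eval (\<lambda>i. c * v i) m)"
    by (simp add: mp_eval_def mono_eval_def)
  also have "\<dots> = (\<Sum>m\<in>Poly_Mapping.keys p. c ^ d * (h (Poly_Mapping.lookup p m) * mono_eval v m))"
    using assms by (intro sum.cong refl) (auto simp: form_def mp_homogeneous_iff mono_eval_scale)
  finally show ?thesis
    by (simp add: mp_eval_def mono_eval_def sum_distrib_left)
qed

lemma form_eval_divide:
  fixes v :: "nat \<Rightarrow> 'b::field"
  assumes "form n d p"
  shows "mp_eval h p (\<lambda>i. v i / c) = mp_eval h p v / c ^ d"
  using form_eval_scale[OF assms, of h "1 / c" v] by (simp add: power_divide)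

section \<open>Local subrings and places of a field\<close>

text \<open>
  The domain of \<open>e\<close> is a local ring with residue field \<open>'k\<close>, and \<open>e\<close> is the residue map.
  Partial functions keep the ring and its residue map in one object, so that domination of
  local rings becomes the order \<open>\<subseteq>\<^sub>m\<close> on maps.
\<close>

locale local_map = field_hom \<iota> for \<iota> :: "'k::field \<Rightarrow> 'K::field" +
  fixes e :: "'K \<Rightarrow> 'k option"
  assumes e_const [simp]: "e (\<iota> c) = Some c"
    and e_add: "e z = Some a \<Longrightarrow> e w = Some b \<Longrightarrow> e (z + w) = Some (a + b)"
    and e_mult: "e z = Some a \<Longrightarrow> e w = Some b \<Longrightarrow> e (z * w) = Some (a * b)"
    and e_inverse: "e z = Some a \<Longrightarrow> a \<noteq> 0 \<Longrightarrow> e (inverse z) = Some (inverse a)"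
begin

lemma e_0 [simp]: "e 0 = Some 0"
  using e_const[of 0] by simp

lemma e_1 [simp]: "e 1 = Some 1"
  using e_const[of 1] by simp

lemma e_uminus:
  assumes "e z = Some a"
  shows "e (- z) = Some (- a)"
proof -
  have "e (- 1) = Some (- 1)" using e_const[of "- 1"] by (simp add: hom_uminus)
  from e_mult[OF this assms] show ?thesis by simp
qed

lemma e_diff: "e z = Some a \<Longrightarrow> e w = Some b \<Longrightarrow> e (z - w) = Some (a - b)"
  using e_add[of z a "- w" "- b"] e_uminus[of w b] by simp

lemma e_divide: "e z = Some a \<Longrightarrow> e w = Some b \<Longrightarrow> b \<noteq> 0 \<Longrightarrow> e (z / w) = Some (a / b)"
  using e_mult[of z a "inverse w" "inverse b"] e_inverse[of w b] by (simp add: divide_inverse)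

lemma e_power: "e z = Some a \<Longrightarrow> e (z ^ n) = Some (a ^ n)"
  by (induction n) (simp_all add: e_mult)

lemma e_sum:
  assumes "\<And>i. i \<in> I \<Longrightarrow> e (f i) = Some (g i)"
  shows "e (\<Sum>i\<in>I. f i) = Some (\<Sum>i\<in>I. g i)"
  using assms by (induction I rule: infinite_finite_induct) (auto intro: e_add)

lemma e_poly:
  assumes "e z = Some a"
  shows "e (poly (map_poly \<iota> p) z) = Some (poly p a)"
proof (induction p)
  case (pCons c p)
  then show ?case
    by (simp add: map_poly_pCons_hom e_add e_mult assms)
qed simp

lemma e_nonzero: "e z = Some a \<Longrightarrow> a \<noteq> 0 \<Longrightarrow> z \<noteq> 0"
  by auto

end

text \<open>
  For \<open>hom\<close> itself this is evaluation of univariate polynomials; for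
  \<open>\<lambda>q. poly (map_poly hom q) b\<close> in place of \<open>hom\<close> it is evaluation in two variables.
\<close>

lemma (in comm_ring_hom) comm_ring_hom_poly_map: "comm_ring_hom (\<lambda>p. poly (map_poly hom p) z)"
proof -
  interpret m: map_poly_comm_ring_hom hom ..
  show ?thesis by unfold_locales (simp_all add: m.hom_add m.hom_mult)
qed

definition (in field_hom) eval2 :: "'a poly poly \<Rightarrow> 'b \<Rightarrow> 'b \<Rightarrow> 'b" where
  "eval2 P a b = poly (map_poly (\<lambda>q. poly (map_poly hom q) b) P) a"

context field_hom
begin

lemma eval2_0 [simp]: "eval2 0 a b = 0"
  by (simp add: eval2_def)

lemma eval2_pCons [simp]: "eval2 (pCons q P) a b = poly (map_poly hom q) b + a * eval2 P a b"
proof -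
  interpret ev: zero_hom "\<lambda>q. poly (map_poly hom q) b" by unfold_locales simp
  have "map_poly (\<lambda>q. poly (map_poly hom q) b) (pCons q P) =
      pCons (poly (map_poly hom q) b) (map_poly (\<lambda>q. poly (map_poly hom q) b) P)"
    by (cases "q = 0 \<and> P = 0") (auto simp: map_poly_pCons)
  then show ?thesis by (simp add: eval2_def)
qed

text \<open>
  A relation of \<open>a\<close> over the polynomials in \<open>b\<close> can be divided by \<open>a\<close> until its constant
  term is nonzero.
\<close>

lemma relation_with_constant_term:
  assumes "P \<noteq> 0" "eval2 P a b = 0" "a \<noteq> 0"
  shows "\<exists>Q R. Q \<noteq> 0 \<and> poly (map_poly hom Q) b + a * eval2 R a b = 0"
  using assms
proof (induction P)
  case (pCons q P)
  show ?case
  proof (cases "q = 0")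
    case True
    with pCons show ?thesis by auto
  next
    case False
    with pCons show ?thesis by auto
  qed
qed simp

end

definition algebraically_dependent :: "('k::field \<Rightarrow> 'K::field) \<Rightarrow> 'K \<Rightarrow> 'K \<Rightarrow> bool" where
  "algebraically_dependent \<iota> a b \<longleftrightarrow> (\<exists>P. P \<noteq> 0 \<and> field_hom.eval2 \<iota> P a b = 0)"

text \<open>
  The local rings of places are the valuation rings of \<open>K\<close> with residue field \<open>'k\<close>. The
  trivial one is included, with \<open>e\<close> total.
\<close>

definition place :: "('k::field \<Rightarrow> 'K::field) \<Rightarrow> 'K set \<Rightarrow> ('K \<Rightarrow> 'k option) \<Rightarrow> bool" where
  "place \<iota> K e \<longleftrightarrow> local_map \<iota> e \<and> dom e \<subseteq> K \<and>
     (\<forall>z\<in>K. e z = None \<longrightarrow> e (inverse z) = Some 0)"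

text \<open>
  If \<open>e'\<close> is defined at some \<open>z\<close> where \<open>e\<close> is not, then \<open>e' (1 / z) = e (1 / z) = 0\<close>, and
  \<open>z * (1 / z) = 1\<close> would have the value \<open>0\<close>.
\<close>

lemma place_maximal:
  assumes e: "place \<iota> K e" and e': "local_map \<iota> e'" "dom e' \<subseteq> K" and le: "e \<subseteq>\<^sub>m e'"
  shows "e' = e"
proof
  fix z
  interpret e: local_map \<iota> e using e by (simp add: place_def)
  interpret e': local_map \<iota> e' by fact
  show "e' z = e z"
  proof (cases "e z")
    case None
    have "e' z = None"
    proof (rule ccontr)
      assume "e' z \<noteq> None"
      then obtain a where a: "e' z = Some a" by auto
      then have "z \<in> K" using e'(2) by auto
      then have "e (inverse z) = Some 0" using e None by (simp add: place_def)
      then have "e' (inverse z) = Some 0" using le by (metis domI map_le_def)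
      from e'.e_mult[OF a this] have "e' (z * inverse z) = Some 0" by simp
      moreover have "z \<noteq> 0" using None by auto
      ultimately show False by simp
    qed
    with None show ?thesis by simp
  next
    case (Some a)
    then show ?thesis using le by (metis domI map_le_def)
  qed
qed

context local_map
begin

lemma e_eval2:
  assumes "e a \<noteq> None" "e b \<noteq> None"
  shows "e (eval2 P a b) \<noteq> None"
proof (induction P)
  case (pCons q P)
  obtain a' b' c where "e a = Some a'" "e b = Some b'" "e (eval2 P a b) = Some c"
    using assms pCons by auto
  then have "e (poly (map_poly \<iota> q) b + a * eval2 P a b) = Some (poly q b' + a' * c)"
    by (intro e_add e_mult e_poly)
  then show ?case by simp
qed simp

text \<open>
  Dividing a relation between \<open>a\<close> and \<open>u\<close> by powers of \<open>a\<close> leaves \<open>Q(u) + a R(a, u) = 0\<close> with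
  \<open>Q \<noteq> 0\<close>. Up to a unit of the local ring, \<open>Q(u)\<close> is a power of \<open>u\<close>.
  So only finitely many powers of \<open>u\<close> can divide \<open>a\<close>.
\<close>

lemma uniformizer_power_multiple:
  assumes u: "e u = Some 0" "u \<noteq> 0" and a: "e a \<noteq> None" "a \<noteq> 0"
    and dep: "algebraically_dependent \<iota> a u"
  shows "\<exists>s w. e w \<noteq> None \<and> u ^ s = a * w"
proof -
  obtain P where "P \<noteq> 0" "eval2 P a u = 0"
    using dep by (auto simp: algebraically_dependent_def)
  then obtain Q R where Q: "Q \<noteq> 0" "poly (map_poly \<iota> Q) u + a * eval2 R a u = 0"
    using relation_with_constant_term a(2) by blast
  obtain q where q: "Q = [:0, 1:] ^ order 0 Q * q" "\<not> [:0, 1:] dvd q"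
    using order_decomp[OF Q(1), of 0] by auto
  then have q0: "poly q 0 \<noteq> 0" by (simp add: poly_eq_0_iff_dvd)
  \<comment> \<open>the factor \<open>q\<close> of \<open>Q\<close> has nonzero constant term, so \<open>q(u)\<close> is a unit\<close>
  define s where "s = order 0 Q"
  have eq: "e (poly (map_poly \<iota> q) u) = Some (poly q 0)" by (rule e_poly) (rule u)
  have nz: "poly (map_poly \<iota> q) u \<noteq> 0" using e_nonzero[OF eq q0] .
  interpret ev: comm_ring_hom "\<lambda>p. poly (map_poly \<iota> p) u" by (rule comm_ring_hom_poly_map)
  have "poly (map_poly \<iota> [:0, 1:]) u = u" by (simp add: map_poly_pCons_hom)
  then have "poly (map_poly \<iota> Q) u = u ^ s * poly (map_poly \<iota> q) u"
    by (subst q(1)) (simp only: ev.hom_mult ev.hom_power s_def)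
  with Q(2) have eq2: "u ^ s * poly (map_poly \<iota> q) u = - a * eval2 R a u"
    by (simp add: add_eq_0_iff2)
  obtain r where r: "e (eval2 R a u) = Some r"
    using e_eval2[of a u R] a(1) u(1) by auto
  have "u ^ s = a * (- eval2 R a u / poly (map_poly \<iota> q) u)"
    using eq2 nz by (simp add: field_simps)
  moreover have "e (- eval2 R a u / poly (map_poly \<iota> q) u) = Some (- r / poly q 0)"
    by (intro e_divide e_uminus r eq q0)
  ultimately show ?thesis by blast
qed

text \<open>
  Take the largest \<open>r\<close> such that \<open>u ^ r\<close> divides \<open>a\<close>. It exists because \<open>a\<close> divides some
  \<open>u ^ s\<close>: otherwise \<open>u ^ s\<close> would be a multiple of \<open>u ^ (s + 1)\<close>.
\<close>

lemma unit_times_uniformizer_power: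
  assumes u: "e u = Some 0" and a: "e a \<noteq> None" "a \<noteq> 0"
    and dep: "algebraically_dependent \<iota> a u"
    and ker: "\<And>z. e z = Some 0 \<Longrightarrow> \<exists>w. e w \<noteq> None \<and> z = u * w"
  shows "\<exists>r b \<beta>. a = u ^ r * b \<and> e b = Some \<beta> \<and> \<beta> \<noteq> 0"
proof (cases "u = 0")
  case True
  then have "e a \<noteq> Some 0" using ker[of a] a by auto
  then have "a = u ^ 0 * a \<and> e a = Some (the (e a)) \<and> the (e a) \<noteq> 0" using a by auto
  then show ?thesis by blast
next
  case False
  obtain s w where w: "e w \<noteq> None" "u ^ s = a * w"
    using uniformizer_power_multiple[OF u False a dep] by blast
  define S where "S = {r. \<exists>b. e b \<noteq> None \<and> a = u ^ r * b}"
  have bound: "r \<le> s" if r: "r \<in> S" for r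
  proof (rule ccontr)
    assume "\<not> r \<le> s"
    then obtain k where k: "r = s + Suc k"
      by (metis add_Suc_right less_iff_Suc_add not_le)
    obtain b where b: "e b \<noteq> None" "a = u ^ r * b" using r by (auto simp: S_def)
    obtain \<beta> \<omega> where \<beta>: "e b = Some \<beta>" "e w = Some \<omega>" using b w by auto
    have "u ^ s * 1 = u ^ s * (u ^ Suc k * b * w)"
      using w(2) b(2) by (simp add: k power_add mult.assoc)
    then have "1 = u ^ Suc k * b * w" using False by simp
    moreover have "e (u ^ Suc k * b * w) = Some (0 ^ Suc k * \<beta> * \<omega>)"
      by (intro e_mult e_power u \<beta>)
    ultimately show False by (metis e_1 mult_zero_left option.inject power_0_Suc zero_neq_one)
  qed
  have fin: "finite S" using bound by (meson finite_nat_set_iff_bounded_le)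
  have "0 \<in> S" using a by (auto simp: S_def)
  then have "Max S \<in> S" using fin Max_in by blast
  then obtain b where b: "e b \<noteq> None" "a = u ^ Max S * b" by (auto simp: S_def)
  then obtain \<beta> where \<beta>: "e b = Some \<beta>" by auto
  have "\<beta> \<noteq> 0"
  proof
    assume "\<beta> = 0"
    then obtain b' where b': "e b' \<noteq> None" "b = u * b'" using ker \<beta> by blast
    then have "a = u ^ Suc (Max S) * b'" using b(2) by simp
    then have "Suc (Max S) \<in> S" using b'(1) unfolding S_def by blast
    then show False using Max_ge[OF fin] by fastforce
  qed
  then show ?thesis using b \<beta> by blast
qed

text \<open>
  The criterion by which all places are constructed: a local ring of \<open>K\<close> with principal
  maximal ideal and quotient field \<open>K\<close> is a valuation ring, provided that \<open>K\<close> has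
  transcendence degree at most one. If \<open>u = 0\<close>, the local ring is the field \<open>K\<close> itself and
  the place is trivial.
\<close>

theorem place_if_kernel_principal:
  assumes K: "dom e \<subseteq> K"
    and frac: "\<And>z. z \<in> K \<Longrightarrow> \<exists>a b. e a \<noteq> None \<and> e b \<noteq> None \<and> z = a / b"
    and dep: "\<And>a b. a \<in> K \<Longrightarrow> b \<in> K \<Longrightarrow> algebraically_dependent \<iota> a b"
    and u: "e u = Some 0"
    and ker: "\<And>z. e z = Some 0 \<Longrightarrow> \<exists>w. e w \<noteq> None \<and> z = u * w"
  shows "place \<iota> K e"
proof -
  have "e (inverse z) = Some 0" if z: "z \<in> K" "e z = None" for z
  proof -
    obtain a b where ab: "e a \<noteq> None" "e b \<noteq> None" "z = a / b" using frac z by blast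
    have nz: "a \<noteq> 0" "b \<noteq> 0" using z(2) ab(3) by auto
    have fac: "\<exists>r b \<beta>. c = u ^ r * b \<and> e b = Some \<beta> \<and> \<beta> \<noteq> 0" if "e c \<noteq> None" "c \<noteq> 0" for c
      using that K u by (intro unit_times_uniformizer_power dep ker) auto
    obtain r a' \<alpha> where a': "a = u ^ r * a'" "e a' = Some \<alpha>" "\<alpha> \<noteq> 0" using fac ab nz by metis
    obtain s b' \<beta> where b': "b = u ^ s * b'" "e b' = Some \<beta>" "\<beta> \<noteq> 0" using fac ab nz by metis
    show ?thesis
    proof (cases "s \<le> r")
      case True
      have "u ^ r = u ^ s * u ^ (r - s)" using True by (simp flip: power_add)
      moreover have "u ^ s \<noteq> 0" using nz(2) b'(1) by auto
      ultimately have "z = u ^ (r - s) * (a' / b')" 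
        unfolding ab(3) a'(1) b'(1) \<open>u ^ r = _\<close> mult.assoc by (subst mult_divide_mult_cancel_left) auto
      moreover have "e (u ^ (r - s) * (a' / b')) = Some (0 ^ (r - s) * (\<alpha> / \<beta>))"
        by (intro e_mult e_power e_divide u a' b')
      ultimately show ?thesis using z(2) by simp
    next
      case False
      then obtain k where k: "s = r + Suc k" using less_iff_Suc_add not_le by (metis add_Suc_right)
      have "u ^ r \<noteq> 0" using nz(1) a'(1) by auto
      then have "inverse z = u ^ Suc k * (b' / a')"
        by (simp add: ab(3) a'(1) b'(1) k power_add field_simps)
      moreover have "e (u ^ Suc k * (b' / a')) = Some (0 ^ Suc k * (\<beta> / \<alpha>))"
        by (intro e_mult e_power e_divide u a' b')
      ultimately show ?thesis by simp
    qed
  qed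
  then show ?thesis using K local_map_axioms by (auto simp: place_def)
qed

text \<open>
  If the \<open>t j\<close> generate the maximal ideal \<open>M\<close>, the assumption is \<open>M = (u) + M\<^sup>2\<close> and the
  conclusion \<open>M = (u)\<close>. The generators are eliminated one at a time: the relation for \<open>t k\<close>
  can be solved for \<open>t k\<close> because \<open>1 - \<mu> k k\<close> is a unit, and substituting the result into the other
  relations keeps their coefficients in \<open>M\<close>.
\<close>

lemma nakayama:
  assumes "finite J"
    and "\<And>i. i \<in> J \<Longrightarrow> \<exists>w \<mu>. e w \<noteq> None \<and> (\<forall>j\<in>J. e (\<mu> j) = Some 0) \<and>
        t i = u * w + (\<Sum>j\<in>J. \<mu> j * t j)"
    and "i \<in> J"
  shows "\<exists>w. e w \<noteq> None \<and> t i = u * w"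
  using assms
proof (induction J arbitrary: i rule: finite_induct)
  case (insert k J)
  have "\<forall>i\<in>insert k J. \<exists>w \<mu>. e w \<noteq> None \<and> (\<forall>j\<in>insert k J. e (\<mu> j) = Some 0) \<and>
        t i = u * w + (\<Sum>j\<in>insert k J. \<mu> j * t j)"
    using insert.prems(1) by blast
  then obtain w \<mu> where w: "\<And>i. i \<in> insert k J \<Longrightarrow> e (w i) \<noteq> None"
    and \<mu>: "\<And>i j. i \<in> insert k J \<Longrightarrow> j \<in> insert k J \<Longrightarrow> e (\<mu> i j) = Some 0"
    and t: "\<And>i. i \<in> insert k J \<Longrightarrow> t i = u * w i + (\<Sum>j\<in>insert k J. \<mu> i j * t j)"
    by metis
  have t': "t i = u * w i + \<mu> i k * t k + (\<Sum>j\<in>J. \<mu> i j * t j)" if "i \<in> insert k J" for i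
    using t[OF that] insert.hyps by simp
  define c where "c = inverse (1 - \<mu> k k)"
  have e1: "e (1 - \<mu> k k) = Some (1 - 0)" by (intro e_diff \<mu>) auto
  have c: "e c = Some 1" unfolding c_def using e_inverse[OF e1] by simp
  have "1 - \<mu> k k \<noteq> 0" using e_nonzero[OF e1] by simp
  moreover have "(1 - \<mu> k k) * t k = u * w k + (\<Sum>j\<in>J. \<mu> k j * t j)"
  proof -
    have "a = b + c + d \<Longrightarrow> a - c = b + d" for a b c d :: 'K by simp
    from this[OF t'[of k]] show ?thesis by (simp only: left_diff_distrib mult_1 insertI1)
  qed
  ultimately have "t k = c * (u * w k + (\<Sum>j\<in>J. \<mu> k j * t j))"
    unfolding c_def by (simp add: field_simps)
  then have tk: "t k = u * (c * w k) + (\<Sum>j\<in>J. c * \<mu> k j * t j)"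
    by (simp add: algebra_simps sum_distrib_left)
  have mem: "\<exists>w. e w \<noteq> None \<and> t i = u * w" if "i \<in> J" for i
  proof (rule insert.IH[OF _ that])
    fix i assume i: "i \<in> J"
    obtain wi wk where wi: "e (w i) = Some wi" "e (w k) = Some wk" using w i by blast
    have "t i = u * (w i + \<mu> i k * (c * w k)) + (\<Sum>j\<in>J. (\<mu> i j + \<mu> i k * (c * \<mu> k j)) * t j)"
    proof -
      have "t i = u * w i + \<mu> i k * (u * (c * w k) + (\<Sum>j\<in>J. c * \<mu> k j * t j)) + (\<Sum>j\<in>J. \<mu> i j * t j)"
        by (subst tk[symmetric]) (use t' i in blast)
      then show ?thesis by (simp add: algebra_simps sum.distrib sum_distrib_left)
    qed
    moreover have "e (w i + \<mu> i k * (c * w k)) = Some (wi + 0 * (1 * wk))"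
      by (intro e_add e_mult wi c \<mu>) (use i in auto)
    moreover have "e (\<mu> i j + \<mu> i k * (c * \<mu> k j)) = Some (0 + 0 * (1 * 0))" if "j \<in> J" for j
      by (intro e_add e_mult c \<mu>) (use i that in auto)
    ultimately show "\<exists>w \<mu>. e w \<noteq> None \<and> (\<forall>j\<in>J. e (\<mu> j) = Some 0) \<and>
        t i = u * w + (\<Sum>j\<in>J. \<mu> j * t j)"
      by (intro exI[of _ "w i + \<mu> i k * (c * w k)"] exI[of _ "\<lambda>j. \<mu> i j + \<mu> i k * (c * \<mu> k j)"]) simp
  qed
  then obtain v where v: "\<And>i. i \<in> J \<Longrightarrow> e (v i) \<noteq> None" "\<And>i. i \<in> J \<Longrightarrow> t i = u * v i" by metis
  have "t k = u * (c * w k + (\<Sum>j\<in>J. c * \<mu> k j * v j))"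
    by (subst tk) (simp add: v(2) algebra_simps sum_distrib_left)
  moreover obtain wk where wk: "e (w k) = Some wk" using w by blast
  have "e (c * w k + (\<Sum>j\<in>J. c * \<mu> k j * v j)) = Some (1 * wk + (\<Sum>j\<in>J. 1 * 0 * the (e (v j))))"
    by (intro e_add e_mult e_sum c \<mu> wk) (use v(1) in auto)
  ultimately have "\<exists>w. e w \<noteq> None \<and> t k = u * w" by blast
  then show ?case using mem insert.prems(2) by blast
qed simp

end

text \<open>
  A pair \<open>(p, r)\<close> in \<open>T d\<close> is a function of degree \<open>d\<close> together with its value at a fixed point.
  For a point of a projective curve, \<open>T d\<close> comes from the forms of degree \<open>d\<close>; for a point of
  an affine curve, all \<open>T d\<close> are the same ring of functions. The quotients of degree zero
  make up the local ring of the point.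
\<close>

locale graded_values = field_hom \<iota> for \<iota> :: "'k::field \<Rightarrow> 'K::field" +
  fixes T :: "nat \<Rightarrow> ('K \<times> 'k) set"
  assumes T_const: "(\<iota> c, c) \<in> T 0"
    and T_add: "(p, r) \<in> T d \<Longrightarrow> (q, s) \<in> T d \<Longrightarrow> (p + q, r + s) \<in> T d"
    and T_mult: "(p, r) \<in> T d \<Longrightarrow> (q, s) \<in> T d' \<Longrightarrow> (p * q, r * s) \<in> T (d + d')"
    and T_zero: "(0, r) \<in> T d \<Longrightarrow> r = 0"
begin

definition ratio :: "'K \<Rightarrow> 'k \<Rightarrow> bool" where
  "ratio z c \<longleftrightarrow> (\<exists>d p q r s. (p, r) \<in> T d \<and> (q, s) \<in> T d \<and> s \<noteq> 0 \<and> z = p / q \<and> c = r / s)"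

definition ratio_map :: "'K \<Rightarrow> 'k option" where
  "ratio_map z = (if \<exists>c. ratio z c then Some (THE c. ratio z c) else None)"

lemma T_uminus: "(p, r) \<in> T d \<Longrightarrow> (- p, - r) \<in> T d"
  using T_mult[OF T_const[of "- 1"], of p r d] by (simp add: hom_uminus)

lemma T_nonzero: "(q, s) \<in> T d \<Longrightarrow> s \<noteq> 0 \<Longrightarrow> q \<noteq> 0"
  using T_zero by blast

lemma ratio_unique:
  assumes "ratio z c" "ratio z c'"
  shows "c = c'"
proof -
  obtain d p q r s where 1: "(p, r) \<in> T d" "(q, s) \<in> T d" "s \<noteq> 0" "z = p / q" "c = r / s"
    using assms(1) by (auto simp: ratio_def)
  obtain d' p' q' r' s' where 2: "(p', r') \<in> T d'" "(q', s') \<in> T d'" "s' \<noteq> 0" "z = p' / q'" "c' = r' / s'"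
    using assms(2) by (auto simp: ratio_def)
  have "q \<noteq> 0" "q' \<noteq> 0" using 1 2 T_nonzero by blast+
  then have "p * q' + - (q * p') = 0" using 1(4) 2(4) by (simp add: field_simps)
  moreover have "(p * q' + - (q * p'), r * s' + - (s * r')) \<in> T (d + d')"
    by (intro T_add T_uminus T_mult 1 2)
  ultimately have "r * s' + - (s * r') = 0" using T_zero by metis
  then have "r / s = r' / s'" using 1(3) 2(3) by (subst frac_eq_eq) (simp_all add: mult.commute)
  then show ?thesis using 1 2 by simp
qed

lemma ratio_map_iff: "ratio_map z = Some c \<longleftrightarrow> ratio z c"
  unfolding ratio_map_def using ratio_unique by (auto intro: the_equality theI2)

lemma ratio_map_divide:
  "(p, r) \<in> T d \<Longrightarrow> (q, s) \<in> T d \<Longrightarrow> s \<noteq> 0 \<Longrightarrow> ratio_map (p / q) = Some (r / s)"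
  unfolding ratio_map_iff ratio_def by blast

lemma ratio_mapE:
  assumes "ratio_map z = Some c"
  obtains d p q r s where "(p, r) \<in> T d" "(q, s) \<in> T d" "s \<noteq> 0" "q \<noteq> 0" "z = p / q" "c = r / s"
  using assms T_nonzero unfolding ratio_map_iff ratio_def by blast

lemma local_map_ratio_map: "local_map \<iota> ratio_map"
proof
  fix c show "ratio_map (\<iota> c) = Some c"
    using ratio_map_divide[OF T_const[of c] T_const[of 1]] by simp
next
  fix z w a b assume "ratio_map z = Some a" "ratio_map w = Some b"
  then obtain d p q r s d' p' q' r' s' where
    1: "(p, r) \<in> T d" "(q, s) \<in> T d" "s \<noteq> 0" "q \<noteq> 0" "z = p / q" "a = r / s" and
    2: "(p', r') \<in> T d'" "(q', s') \<in> T d'" "s' \<noteq> 0" "q' \<noteq> 0" "w = p' / q'" "b = r' / s'"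
    by (elim ratio_mapE) metis
  have "ratio_map ((p * q' + q * p') / (q * q')) = Some ((r * s' + s * r') / (s * s'))"
    by (rule ratio_map_divide[where d = "d + d'"]) (use 1 2 in \<open>auto intro!: T_add T_mult\<close>)
  then show "ratio_map (z + w) = Some (a + b)" using 1 2 by (simp add: add_frac_eq mult.commute)
  have "ratio_map ((p * p') / (q * q')) = Some ((r * r') / (s * s'))"
    by (rule ratio_map_divide[where d = "d + d'"]) (use 1 2 in \<open>auto intro!: T_mult\<close>)
  then show "ratio_map (z * w) = Some (a * b)" using 1 2 by simp
next
  fix z a assume "ratio_map z = Some a" and a: "a \<noteq> 0"
  then obtain d p q r s where
    1: "(p, r) \<in> T d" "(q, s) \<in> T d" "s \<noteq> 0" "q \<noteq> 0" "z = p / q" "a = r / s"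
    by (elim ratio_mapE) metis
  then have "ratio_map (q / p) = Some (s / r)" using a by (intro ratio_map_divide) auto
  then show "ratio_map (inverse z) = Some (inverse a)" using 1 by simp
qed

end

section \<open>The function field of \<open>b\<^sup>2 = Q(a)\<close> and its places\<close>

lemma (in field_hom) comm_ring_hom_eval2: "comm_ring_hom (\<lambda>P. eval2 P a b)"
proof -
  interpret ev: comm_ring_hom "\<lambda>p. poly (map_poly hom p) b" by (rule comm_ring_hom_poly_map)
  show ?thesis unfolding eval2_def by (rule ev.comm_ring_hom_poly_map)
qed

lemma (in field_hom) eval2_monom: "eval2 (monom q i) a b = poly (map_poly hom q) b * a ^ i"
proof -
  interpret ev: comm_ring_hom "\<lambda>p. poly (map_poly hom p) b" by (rule comm_ring_hom_poly_map)
  show ?thesis unfolding eval2_def by (simp add: poly_monom)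
qed

lemma (in field_hom) poly_map_reflect:
  assumes "z \<noteq> 0"
  shows "poly (map_poly hom (reflect_poly p)) z = z ^ degree p * poly (map_poly hom p) (inverse z)"
proof -
  have "map_poly hom (reflect_poly p) = reflect_poly (map_poly hom p)"
    by (rule poly_eqI) (simp add: coeff_reflect_poly)
  then show ?thesis using assms by (simp add: poly_reflect_poly_nz)
qed

lemma card_bounded_degree_le:
  "finite {p :: 'k::{field,finite} poly. degree p \<le> k}"
  "card {p :: 'k poly. degree p \<le> k} \<le> CARD('k) ^ (k + 1)"
proof -
  let ?S = "{p :: 'k poly. degree p \<le> k}"
  let ?f = "\<lambda>p :: 'k poly. restrict (coeff p) {..k}"
  have inj: "inj_on ?f ?S"
  proof (rule inj_onI)
    fix p q :: "'k poly" assume pq: "p \<in> ?S" "q \<in> ?S" and eq: "?f p = ?f q"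
    show "p = q"
    proof (rule poly_eqI)
      fix n show "coeff p n = coeff q n"
        using fun_cong[OF eq, of n] pq by (cases "n \<le> k") (auto simp: coeff_eq_0)
    qed
  qed
  have sub: "?f ` ?S \<subseteq> ({..k} \<rightarrow>\<^sub>E UNIV)" by (intro image_subsetI) simp
  have fin: "finite ({..k} \<rightarrow>\<^sub>E (UNIV :: 'k set))" by (intro finite_PiE) auto
  show "finite ?S" using inj_on_finite[OF inj sub fin] .
  show "card ?S \<le> CARD('k) ^ (k + 1)"
    using card_inj_on_le[OF inj sub fin] by (simp add: card_funcsetE)
qed

text \<open>
  The condition \<open>indep\<close> says that \<open>a\<close> is transcendental over \<open>'k\<close> and that \<open>b\<close> is not a rational
  function of \<open>a\<close>.
\<close>

locale quadratic_function_field = field_hom \<iota> for \<iota> :: "'k::{field,finite} \<Rightarrow> 'K::field" +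
  fixes a b :: 'K and Q :: "'k poly"
  assumes sq: "b ^ 2 = poly (map_poly \<iota> Q) a"
    and indep: "poly (map_poly \<iota> A) a + poly (map_poly \<iota> B) a * b = 0 \<Longrightarrow> A = 0 \<and> B = 0"
    and two: "(2 :: 'k) \<noteq> 0"
begin

abbreviation ev :: "'k poly \<Rightarrow> 'K" where "ev p \<equiv> poly (map_poly \<iota> p) a"

definition el :: "'k poly \<Rightarrow> 'k poly \<Rightarrow> 'K" where "el A B = ev A + ev B * b"

definition fld :: "'K set" where
  "fld = {el A B / el C D | A B C D. el C D \<noteq> 0}"

sublocale ev: comm_ring_hom ev by (rule comm_ring_hom_poly_map)

lemma ev_const [simp]: "ev [:c:] = \<iota> c" by (simp add: map_poly_pCons_hom)

lemma ev_X [simp]: "ev [:0, 1:] = a" by (simp add: map_poly_pCons_hom)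

lemma el_add: "el A B + el C D = el (A + C) (B + D)"
  by (simp add: el_def ev.hom_add algebra_simps)

lemma el_mult: "el A B * el C D = el (A * C + B * D * Q) (A * D + B * C)"
proof -
  have "el A B * el C D = ev A * ev C + ev B * ev D * b ^ 2 + (ev A * ev D + ev B * ev C) * b"
    by (simp add: el_def power2_eq_square algebra_simps)
  then show ?thesis by (simp add: el_def sq ev.hom_add ev.hom_mult)
qed

lemma el_const: "\<iota> c = el [:c:] 0"
  by (simp add: el_def)

lemma el_1: "1 = el 1 0"
  by (simp add: el_def)

lemma el_a: "a = el [:0, 1:] 0"
  by (simp add: el_def map_poly_pCons_hom)

lemma el_b: "b = el 0 1"
  by (simp add: el_def)

lemma el_eq_0_iff: "el A B = 0 \<longleftrightarrow> A = 0 \<and> B = 0"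
  using indep[of A B] by (auto simp: el_def)

lemma a_nonzero: "a \<noteq> 0"
  using el_eq_0_iff[of "[:0, 1:]" 0] el_a by auto

lemma el_fld: "el A B \<in> fld"
proof -
  have "el A B = el A B / el 1 0" using el_1 by simp
  moreover have "el 1 0 \<noteq> 0" using el_1 by simp
  ultimately show ?thesis unfolding fld_def by blast
qed

lemma fldI: "el A B / el C D \<in> fld"
  using el_fld[of 0 0] by (cases "el C D = 0") (auto simp: fld_def el_def)

lemma fldE:
  assumes "z \<in> fld"
  obtains A B C D where "z = el A B / el C D" "el C D \<noteq> 0"
  using assms by (auto simp: fld_def)

lemma fld_add:
  assumes "z \<in> fld" "w \<in> fld"
  shows "z + w \<in> fld"
proof -
  obtain A B C D where z: "z = el A B / el C D" "el C D \<noteq> 0" using assms(1) by (rule fldE)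
  obtain A' B' C' D' where w: "w = el A' B' / el C' D'" "el C' D' \<noteq> 0" using assms(2) by (rule fldE)
  show ?thesis
    unfolding z(1) w(1) add_frac_eq[OF z(2) w(2)] el_mult el_add by (rule fldI)
qed

lemma fld_mult:
  assumes "z \<in> fld" "w \<in> fld"
  shows "z * w \<in> fld"
proof -
  obtain A B C D where z: "z = el A B / el C D" using assms(1) by (rule fldE)
  obtain A' B' C' D' where w: "w = el A' B' / el C' D'" using assms(2) by (rule fldE)
  show ?thesis unfolding z w times_divide_times_eq el_mult by (rule fldI)
qed

lemma fld_inverse: "z \<in> fld \<Longrightarrow> inverse z \<in> fld"
  using fldI unfolding fld_def by (auto simp: inverse_eq_divide)

lemma fld_const: "\<iota> c \<in> fld"
  by (subst el_const) (rule el_fld)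

lemma fld_a: "a \<in> fld" and fld_b: "b \<in> fld"
  using el_fld[of "[:0, 1:]" 0] el_fld[of 0 1] by (auto simp flip: el_a el_b)

lemma fld_power: "z \<in> fld \<Longrightarrow> z ^ n \<in> fld"
  using fld_const[of 1] by (induction n) (auto intro: fld_mult)

lemma fld_divide: "z \<in> fld \<Longrightarrow> w \<in> fld \<Longrightarrow> z / w \<in> fld"
  by (simp add: divide_inverse fld_mult fld_inverse)

lemma fld_least:
  assumes c: "\<And>c. \<iota> c \<in> F" and ab: "a \<in> F" "b \<in> F"
    and add: "\<And>z w. z \<in> F \<Longrightarrow> w \<in> F \<Longrightarrow> z + w \<in> F"
    and mult: "\<And>z w. z \<in> F \<Longrightarrow> w \<in> F \<Longrightarrow> z * w \<in> F"
    and inverse: "\<And>z. z \<in> F \<Longrightarrow> inverse z \<in> F"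
  shows "fld \<subseteq> F"
proof -
  have "ev p \<in> F" for p
    using c[of 0] by (induction p) (auto simp: map_poly_pCons_hom intro: add mult c ab)
  then have "el A B \<in> F" for A B by (auto simp: el_def intro: add mult ab)
  then show ?thesis by (auto simp: fld_def divide_inverse intro: mult inverse)
qed

subsection \<open>Algebraic dependence\<close>

text \<open>
  The functions of degree at most \<open>k\<close>, where \<open>b\<close> has degree \<open>degree Q\<close>. This weight is large
  enough for degrees to add up in \<open>b\<^sup>2 = Q(a)\<close>.
\<close>

definition filt :: "nat \<Rightarrow> 'K set" where
  "filt k = {el A B | A B. degree A \<le> k \<and> (B = 0 \<or> degree B + degree Q \<le> k)}"

lemma filt_card: "finite (filt k)" "card (filt k) \<le> CARD('k) ^ (2 * (k + 1))"
proof -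
  let ?P = "{p :: 'k poly. degree p \<le> k}"
  have sub: "filt k \<subseteq> (\<lambda>(A, B). el A B) ` (?P \<times> ?P)" by (auto simp: filt_def)
  have fin: "finite (?P \<times> ?P)" using card_bounded_degree_le by auto
  show "finite (filt k)" using sub fin by (meson finite_imageI finite_subset)
  have "card (filt k) \<le> card (?P \<times> ?P)"
    using sub fin by (meson card_image_le card_mono finite_imageI le_trans)
  also have "\<dots> \<le> CARD('k) ^ (k + 1) * CARD('k) ^ (k + 1)"
    using card_bounded_degree_le(2)[where 'k='k, of k]
    unfolding card_cartesian_product by (intro mult_le_mono)
  finally show "card (filt k) \<le> CARD('k) ^ (2 * (k + 1))"
    unfolding mult_2 power_add .
qed

lemma filt_add: "z \<in> filt k \<Longrightarrow> w \<in> filt k \<Longrightarrow> z + w \<in> filt k"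
proof -
  assume "z \<in> filt k" "w \<in> filt k"
  then obtain A B C D where
    z: "z = el A B" "degree A \<le> k" "B = 0 \<or> degree B + degree Q \<le> k" and
    w: "w = el C D" "degree C \<le> k" "D = 0 \<or> degree D + degree Q \<le> k"
    by (auto simp: filt_def)
  have "degree (A + C) \<le> k" using z w by (simp add: degree_add_le)
  moreover have "B + D = 0 \<or> degree (B + D) + degree Q \<le> k"
    using z(3) w(3) degree_add_le_max[of B D] by auto
  ultimately show ?thesis unfolding z w el_add filt_def by blast
qed

lemma filt_mult: "z \<in> filt j \<Longrightarrow> w \<in> filt k \<Longrightarrow> z * w \<in> filt (j + k)"
proof -
  assume "z \<in> filt j" "w \<in> filt k"
  then obtain A B C D where
    z: "z = el A B" "degree A \<le> j" "B = 0 \<or> degree B + degree Q \<le> j" and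
    w: "w = el C D" "degree C \<le> k" "D = 0 \<or> degree D + degree Q \<le> k"
    by (auto simp: filt_def)
  have "degree (A * C) \<le> j + k" using z w degree_mult_le[of A C] by linarith
  moreover have "degree (B * D * Q) \<le> j + k"
  proof (cases "B = 0 \<or> D = 0")
    case False
    then have "degree B + degree Q \<le> j" "degree D + degree Q \<le> k" using z w by auto
    then show ?thesis using degree_mult_le[of "B * D" Q] degree_mult_le[of B D] by linarith
  qed auto
  ultimately have 1: "degree (A * C + B * D * Q) \<le> j + k" by (rule degree_add_le)
  have AD: "A * D = 0 \<or> degree (A * D) + degree Q \<le> j + k"
    using z w degree_mult_le[of A D] by (cases "D = 0") auto
  have BC: "B * C = 0 \<or> degree (B * C) + degree Q \<le> j + k"
    using z w degree_mult_le[of B C] by (cases "B = 0") auto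
  have 2: "A * D + B * C = 0 \<or> degree (A * D + B * C) + degree Q \<le> j + k"
    using AD BC degree_add_le_max[of "A * D" "B * C"] by auto
  show ?thesis unfolding z w el_mult filt_def using 1 2 by blast
qed

lemma filt_const: "\<iota> c \<in> filt 0"
proof -
  have "degree [:c:] \<le> 0 \<and> ((0 :: 'k poly) = 0 \<or> degree (0 :: 'k poly) + degree Q \<le> 0)" by simp
  then have "el [:c:] 0 \<in> filt 0" unfolding filt_def by blast
  then show ?thesis by (simp flip: el_const)
qed

lemma filt_power: "z \<in> filt k \<Longrightarrow> z ^ n \<in> filt (n * k)"
  using filt_const[of 1] by (induction n) (auto intro: filt_mult)

lemma filt_mono: "j \<le> k \<Longrightarrow> filt j \<subseteq> filt k"
  by (fastforce simp: filt_def)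

lemma filt_sum:
  assumes "\<And>i. i \<in> I \<Longrightarrow> f i \<in> filt k"
  shows "(\<Sum>i\<in>I. f i) \<in> filt k"
  using assms filt_const[of 0] filt_mono[of 0 k]
  by (induction I rule: infinite_finite_induct) (auto intro: filt_add)

lemma el_filt: "\<exists>k. el A B \<in> filt k"
proof -
  have "degree A \<le> max (degree A) (degree B + degree Q) \<and>
      (B = 0 \<or> degree B + degree Q \<le> max (degree A) (degree B + degree Q))" by simp
  then show ?thesis unfolding filt_def by blast
qed

text \<open>
  After multiplication by a common denominator, the combinations of the monomials
  \<open>z ^ i * w ^ j\<close> with \<open>i, j \<le> D\<close> have degree at most \<open>2 D d\<close>. There are \<open>card k ^ (D + 1)\<^sup>2\<close>
  choices of coefficients but at most \<open>card k ^ (2 (2 D d + 1))\<close> values, so for large \<open>D\<close> two choices have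
  the same value, and their difference is a relation.
\<close>

lemma fld_algebraically_dependent:
  assumes "z \<in> fld" "w \<in> fld"
  shows "algebraically_dependent \<iota> z w"
proof -
  obtain p q where pq: "z = p / q" "q \<noteq> 0" "\<exists>k. p \<in> filt k" "\<exists>k. q \<in> filt k"
    using assms(1) el_filt by (auto simp: fld_def)
  obtain p' q' where pq': "w = p' / q'" "q' \<noteq> 0" "\<exists>k. p' \<in> filt k" "\<exists>k. q' \<in> filt k"
    using assms(2) el_filt by (auto simp: fld_def)
  obtain k1 k2 k3 k4 where "p \<in> filt k1" "q \<in> filt k2" "p' \<in> filt k3" "q' \<in> filt k4"
    using pq pq' by blast
  then have d: "p \<in> filt (k1 + k2 + k3 + k4)" "q \<in> filt (k1 + k2 + k3 + k4)"
      "p' \<in> filt (k1 + k2 + k3 + k4)" "q' \<in> filt (k1 + k2 + k3 + k4)"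
    using filt_mono[of _ "k1 + k2 + k3 + k4"] by (meson le_add1 le_add2 le_trans subsetD)+
  define d where "d = k1 + k2 + k3 + k4"
  \<comment> \<open>chosen so that \<open>2 (2 D d + 1) < (D + 1)\<^sup>2\<close>\<close>
  define D where "D = 4 * d + 1"
  define I where "I = {..D} \<times> {..D}"
  define m where "m = (\<lambda>(i, j). p ^ i * q ^ (D - i) * (p' ^ j * q' ^ (D - j)))"
  define f where "f = (\<lambda>c :: nat \<times> nat \<Rightarrow> 'k. \<Sum>x\<in>I. \<iota> (c x) * m x)"
  have m: "m x \<in> filt (2 * D * d)" if xI: "x \<in> I" for x
  proof -
    obtain i j where x: "x = (i, j)" "i \<le> D" "j \<le> D" using xI by (auto simp: I_def)
    have "m x \<in> filt ((i * d + (D - i) * d) + (j * d + (D - j) * d))"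
      unfolding m_def x(1) by (simp, intro filt_mult filt_power) (use d in \<open>simp_all add: d_def\<close>)
    also have "(i * d + (D - i) * d) + (j * d + (D - j) * d) = 2 * D * d"
      using x by (simp flip: add_mult_distrib)
    finally show ?thesis .
  qed
  have "f c \<in> filt (2 * D * d)" for c
    unfolding f_def by (intro filt_sum) (use filt_mult[OF filt_const m] in auto)
  then have img: "f ` (I \<rightarrow>\<^sub>E UNIV) \<subseteq> filt (2 * D * d)" by blast
  have card1: "1 < CARD('k)"
    using card_mono[of UNIV "{0, 1 :: 'k}"] by simp
  have "2 * (2 * D * d + 1) < (D + 1) * (D + 1)"
    by (simp add: D_def algebra_simps)
  then have "CARD('k) ^ (2 * (2 * D * d + 1)) < CARD('k) ^ ((D + 1) * (D + 1))"
    using card1 by (rule power_strict_increasing)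
  moreover have "card (I \<rightarrow>\<^sub>E (UNIV :: 'k set)) = CARD('k) ^ ((D + 1) * (D + 1))"
    by (simp add: card_funcsetE I_def card_cartesian_product)
  moreover have "card (f ` (I \<rightarrow>\<^sub>E UNIV)) \<le> CARD('k) ^ (2 * (2 * D * d + 1))"
    using card_mono[OF filt_card(1) img] filt_card(2)[of "2 * D * d"] by linarith
  ultimately have "card (f ` (I \<rightarrow>\<^sub>E UNIV)) < card (I \<rightarrow>\<^sub>E (UNIV :: 'k set))"
    by linarith
  then have "\<not> inj_on f (I \<rightarrow>\<^sub>E UNIV)" by (rule pigeonhole)
  then obtain c c' where c: "c \<in> I \<rightarrow>\<^sub>E UNIV" "c' \<in> I \<rightarrow>\<^sub>E UNIV" "c \<noteq> c'" "f c = f c'"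
    by (auto simp: inj_on_def)
  define g where "g x = c x - c' x" for x
  obtain x where x: "x \<in> I" "g x \<noteq> 0"
    using c(1-3) by (metis PiE_ext eq_iff_diff_eq_0 g_def)
  have "(\<Sum>x\<in>I. \<iota> (g x) * m x) = 0"
    using c(4) by (simp add: f_def g_def hom_minus left_diff_distrib sum_subtractf)
  also have "(\<Sum>x\<in>I. \<iota> (g x) * m x) = (\<Sum>(i, j)\<in>I. q ^ D * q' ^ D * (\<iota> (g (i, j)) * z ^ i * w ^ j))"
  proof (intro sum.cong refl)
    fix x assume "x \<in> I"
    then obtain i j where x: "x = (i, j)" "i \<le> D" "j \<le> D" by (auto simp: I_def)
    have "q ^ D = q ^ i * q ^ (D - i)" "q' ^ D = q' ^ j * q' ^ (D - j)"
      using x by (simp_all flip: power_add)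
    then have "m x = q ^ D * q' ^ D * (z ^ i * w ^ j)"
      using pq(2) pq'(2) by (simp add: m_def x pq(1) pq'(1) power_divide)
    then show "\<iota> (g x) * m x = (case x of (i, j) \<Rightarrow> q ^ D * q' ^ D * (\<iota> (g (i, j)) * z ^ i * w ^ j))"
      by (simp add: x)
  qed
  also have "\<dots> = q ^ D * q' ^ D * (\<Sum>(i, j)\<in>I. \<iota> (g (i, j)) * z ^ i * w ^ j)"
    by (simp add: sum_distrib_left case_prod_unfold)
  finally have rel: "(\<Sum>(i, j)\<in>I. \<iota> (g (i, j)) * z ^ i * w ^ j) = 0"
    using pq(2) pq'(2) by simp
  define P where "P = (\<Sum>i\<le>D. monom (\<Sum>j\<le>D. monom (g (i, j)) j) i)"
  have coeff_P: "coeff (coeff P i) j = g (i, j)" if "i \<le> D" "j \<le> D" for i j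
    using that by (simp add: P_def coeff_sum if_distrib[of "\<lambda>p. coeff p _"] sum.delta cong: if_cong)
  have "P \<noteq> 0"
  proof
    assume "P = 0"
    then show False using x coeff_P[of "fst x" "snd x"] by (auto simp: I_def)
  qed
  moreover have "eval2 P z w = 0"
  proof -
    interpret e2: comm_ring_hom "\<lambda>P. eval2 P z w" by (rule comm_ring_hom_eval2)
    interpret ew: comm_ring_hom "\<lambda>p. poly (map_poly \<iota> p) w" by (rule comm_ring_hom_poly_map)
    have "eval2 P z w = (\<Sum>i\<le>D. \<Sum>j\<le>D. \<iota> (g (i, j)) * z ^ i * w ^ j)"
      by (simp add: P_def e2.hom_sum eval2_monom ew.hom_sum poly_monom sum_distrib_left sum_distrib_right ac_simps)
    also have "\<dots> = (\<Sum>(i, j)\<in>I. \<iota> (g (i, j)) * z ^ i * w ^ j)"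
      unfolding I_def by (rule sum.cartesian_product)
    finally show ?thesis using rel by simp
  qed
  ultimately show ?thesis unfolding algebraically_dependent_def by blast
qed

subsection \<open>Places over points\<close>

text \<open>
  The maximal ideal of the point is generated by \<open>a - \<alpha>\<close> and \<open>b - \<beta>\<close>. One of them is
  redundant: if \<open>\<beta> \<noteq> 0\<close>, then \<open>(b - \<beta>) (b + \<beta>) = Q(a) - Q(\<alpha>)\<close> is divisible by \<open>a - \<alpha>\<close> and \<open>b + \<beta>\<close> is
  a unit; if \<open>\<beta> = 0\<close>, then \<open>\<alpha>\<close> is a simple zero of \<open>Q\<close> and \<open>b\<^sup>2 = Q(a)\<close> is \<open>a - \<alpha>\<close> times a unit.
\<close>

lemma place_at_point:
  assumes pt: "\<beta> ^ 2 = poly Q \<alpha>" and smooth: "\<beta> \<noteq> 0 \<or> poly (pderiv Q) \<alpha> \<noteq> 0"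
  shows "\<exists>!e. place \<iota> fld e \<and> e a = Some \<alpha> \<and> e b = Some \<beta>"
proof -
  define T where "T = (\<lambda>d :: nat. {(el A B, poly A \<alpha> + poly B \<alpha> * \<beta>) | A B. True})"
  have TI: "(el A B, poly A \<alpha> + poly B \<alpha> * \<beta>) \<in> T d" for A B d by (auto simp: T_def)
  have TI': "(z, r) \<in> T d" if "z = el A B" "r = poly A \<alpha> + poly B \<alpha> * \<beta>" for z r A B d
    using that TI by simp
  interpret graded_values \<iota> T
  proof
    show "(\<iota> c, c) \<in> T 0" for c by (rule TI'[of _ "[:c:]" 0]) (simp_all add: el_const)
  next
    fix p r d q s assume "(p, r) \<in> T d" "(q, s) \<in> T d"
    then obtain A B C D where "p = el A B" "r = poly A \<alpha> + poly B \<alpha> * \<beta>"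
      "q = el C D" "s = poly C \<alpha> + poly D \<alpha> * \<beta>" by (auto simp: T_def)
    then show "(p + q, r + s) \<in> T d"
      by (intro TI'[of _ "A + C" "B + D"]) (simp_all add: el_add algebra_simps)
  next
    fix p r d q s d' assume "(p, r) \<in> T d" "(q, s) \<in> T d'"
    then obtain A B C D where *: "p = el A B" "r = poly A \<alpha> + poly B \<alpha> * \<beta>"
      "q = el C D" "s = poly C \<alpha> + poly D \<alpha> * \<beta>" by (auto simp: T_def)
    have "r * s = poly A \<alpha> * poly C \<alpha> + poly B \<alpha> * poly D \<alpha> * \<beta> ^ 2
        + (poly A \<alpha> * poly D \<alpha> + poly B \<alpha> * poly C \<alpha>) * \<beta>"
      by (simp add: * power2_eq_square algebra_simps)
    then show "(p * q, r * s) \<in> T (d + d')"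
      by (intro TI'[of _ "A * C + B * D * Q" "A * D + B * C"]) (simp_all add: * el_mult pt)
  next
    fix r d assume "(0, r) \<in> T d"
    then show "r = 0" by (auto simp: T_def el_eq_0_iff dest: sym)
  qed
  interpret e: local_map \<iota> ratio_map by (rule local_map_ratio_map)
  have e_el: "ratio_map (el A B) = Some (poly A \<alpha> + poly B \<alpha> * \<beta>)" for A B
    using ratio_map_divide[OF TI[of A B 0] TI[of 1 0 0]] by (simp flip: el_1)
  have ea: "ratio_map a = Some \<alpha>" using e_el[of "[:0, 1:]" 0] by (simp flip: el_a)
  have eb: "ratio_map b = Some \<beta>" using e_el[of 0 1] by (simp flip: el_b)
  have dom: "dom ratio_map \<subseteq> fld"
  proof
    fix z assume "z \<in> dom ratio_map"
    then obtain c where "ratio_map z = Some c" by auto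
    then show "z \<in> fld" by (elim ratio_mapE) (auto simp: T_def intro: fldI)
  qed
  have dvd: "\<exists>A'. A = [:poly A \<alpha>:] + [:- \<alpha>, 1:] * A'" for A
  proof -
    have "poly (A - [:poly A \<alpha>:]) \<alpha> = 0" by simp
    then obtain A' where "A - [:poly A \<alpha>:] = [:- \<alpha>, 1:] * A'" unfolding poly_eq_0_iff_dvd by (auto elim: dvdE)
    then show ?thesis by (metis add.commute diff_add_cancel)
  qed
  have evX: "ev [:- \<alpha>, 1:] = a - \<iota> \<alpha>" by (simp add: map_poly_pCons_hom hom_uminus)
  have ev_dvd: "\<exists>A'. ev A = \<iota> (poly A \<alpha>) + (a - \<iota> \<alpha>) * ev A'" for A
    using dvd[of A] evX ev_const by (metis ev.hom_add ev.hom_mult)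
  define mult_of where "mult_of u z \<longleftrightarrow> (\<exists>w. ratio_map w \<noteq> None \<and> z = u * w)" for u z
  have ev_some: "ratio_map (ev A) = Some (poly A \<alpha>)" for A by (rule e.e_poly[OF ea])
  obtain u where u: "ratio_map u = Some 0" "mult_of u (a - \<iota> \<alpha>)" "mult_of u (b - \<iota> \<beta>)"
  proof (cases "\<beta> = 0")
    case False
    obtain Q' where Q': "ev Q = \<iota> (poly Q \<alpha>) + (a - \<iota> \<alpha>) * ev Q'" using ev_dvd by blast
    have "(b - \<iota> \<beta>) * (b + \<iota> \<beta>) = b ^ 2 - \<iota> (\<beta> ^ 2)"
      by (simp add: hom_mult power2_eq_square algebra_simps)
    also have "\<dots> = (a - \<iota> \<alpha>) * ev Q'" by (simp add: sq pt Q')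
    finally have eq: "(b - \<iota> \<beta>) * (b + \<iota> \<beta>) = (a - \<iota> \<alpha>) * ev Q'" .
    have "\<beta> + \<beta> \<noteq> 0" using False two by (simp flip: mult_2)
    moreover have e_sum: "ratio_map (b + \<iota> \<beta>) = Some (\<beta> + \<beta>)" by (intro e.e_add eb e.e_const)
    ultimately have "b + \<iota> \<beta> \<noteq> 0" and "ratio_map (ev Q' / (b + \<iota> \<beta>)) = Some (poly Q' \<alpha> / (\<beta> + \<beta>))"
      by (auto intro: e.e_nonzero e.e_divide ev_some)
    moreover from this(1) have "b - \<iota> \<beta> = (a - \<iota> \<alpha>) * (ev Q' / (b + \<iota> \<beta>))"
      using eq by (simp add: nonzero_eq_divide_eq)
    ultimately have "mult_of (a - \<iota> \<alpha>) (b - \<iota> \<beta>)" unfolding mult_of_def by blast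
    moreover have "mult_of (a - \<iota> \<alpha>) (a - \<iota> \<alpha>)"
      unfolding mult_of_def by (rule exI[of _ 1]) simp
    moreover have "ratio_map (a - \<iota> \<alpha>) = Some (\<alpha> - \<alpha>)" by (intro e.e_diff ea e.e_const)
    ultimately show ?thesis using that by simp
  next
    case True
    then have Q0: "poly Q \<alpha> = 0" using pt by simp
    obtain Q' where Q': "Q = [:- \<alpha>, 1:] * Q'" using dvd[of Q] Q0 by auto
    have "poly (pderiv Q) \<alpha> = poly Q' \<alpha>" unfolding Q' pderiv_mult by (simp add: pderiv_pCons)
    then have nz: "poly Q' \<alpha> \<noteq> 0" using smooth True by simp
    have "b * b = (a - \<iota> \<alpha>) * ev Q'"
      using sq by (simp add: power2_eq_square Q' ev.hom_mult[of "[:- \<alpha>, 1:]" Q', unfolded evX] del: mult_pCons_left)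
    then have "a - \<iota> \<alpha> = b * (b / ev Q')"
      using e.e_nonzero[OF ev_some nz] by (simp add: nonzero_eq_divide_eq)
    moreover have "ratio_map (b / ev Q') = Some (\<beta> / poly Q' \<alpha>)" by (intro e.e_divide eb ev_some nz)
    ultimately have "mult_of b (a - \<iota> \<alpha>)" unfolding mult_of_def by blast
    moreover have "mult_of b (b - \<iota> \<beta>)"
      unfolding mult_of_def by (rule exI[of _ 1]) (simp add: True)
    ultimately show ?thesis using that eb True by simp
  qed
  have "place \<iota> fld ratio_map"
  proof (rule e.place_if_kernel_principal[OF dom _ fld_algebraically_dependent u(1)])
    fix z assume "z \<in> fld"
    then obtain A B C D where "z = el A B / el C D" by (rule fldE)
    then show "\<exists>a b. ratio_map a \<noteq> None \<and> ratio_map b \<noteq> None \<and> z = a / b"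
      using e_el by (metis option.distinct(1))
  next
    fix z assume "ratio_map z = Some 0"
    then obtain d p q r s where z: "(p, r) \<in> T d" "(q, s) \<in> T d" "s \<noteq> 0" "q \<noteq> 0" "z = p / q" "0 = r / s"
      by (rule ratio_mapE)
    then have "(p, 0) \<in> T d" by simp
    then obtain A B where p: "p = el A B" "poly A \<alpha> + poly B \<alpha> * \<beta> = 0" by (auto simp: T_def)
    obtain A' B' where A': "ev A = \<iota> (poly A \<alpha>) + (a - \<iota> \<alpha>) * ev A'"
      and B': "ev B = \<iota> (poly B \<alpha>) + (a - \<iota> \<alpha>) * ev B'" using ev_dvd by metis
    obtain w1 where w1: "ratio_map w1 \<noteq> None" "a - \<iota> \<alpha> = u * w1" using u(2) by (auto simp: mult_of_def)
    obtain w2 where w2: "ratio_map w2 \<noteq> None" "b - \<iota> \<beta> = u * w2" using u(3) by (auto simp: mult_of_def)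
    obtain r1 r2 where r: "ratio_map w1 = Some r1" "ratio_map w2 = Some r2" using w1 w2 by blast
    have q: "ratio_map q = Some s"
      using z(2) e_el by (auto simp: T_def)
    \<comment> \<open>the numerator of \<open>z\<close> lies in the ideal generated by \<open>a - \<alpha>\<close> and \<open>b - \<beta>\<close>\<close>
    have "p = \<iota> (poly A \<alpha> + poly B \<alpha> * \<beta>) + \<iota> (poly B \<alpha>) * (b - \<iota> \<beta>) + (a - \<iota> \<alpha>) * (ev A' + ev B' * b)"
      unfolding p(1) el_def A' B' by (simp add: hom_add hom_mult algebra_simps)
    then have "p = u * (\<iota> (poly B \<alpha>) * w2 + w1 * (ev A' + ev B' * b))"
      unfolding w1(2) w2(2) p(2) by (simp add: algebra_simps)
    then have "z = u * ((\<iota> (poly B \<alpha>) * w2 + w1 * (ev A' + ev B' * b)) / q)" by (simp add: z(5))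
    moreover have "ratio_map ((\<iota> (poly B \<alpha>) * w2 + w1 * (ev A' + ev B' * b)) / q) =
        Some ((poly B \<alpha> * r2 + r1 * (poly A' \<alpha> + poly B' \<alpha> * \<beta>)) / s)"
      by (intro e.e_divide e.e_add e.e_mult e.e_const ev_some r eb q z(3))
    ultimately show "\<exists>w. ratio_map w \<noteq> None \<and> z = u * w" by blast
  qed
  moreover have "e' = ratio_map" if e': "place \<iota> fld e' \<and> e' a = Some \<alpha> \<and> e' b = Some \<beta>" for e'
  proof -
    interpret e': local_map \<iota> e' using e' by (simp add: place_def)
    have "e' (ev A) = Some (poly A \<alpha>)" for A by (rule e'.e_poly) (use e' in simp)
    then have e'_el: "e' (el A B) = Some (poly A \<alpha> + poly B \<alpha> * \<beta>)" for A B
      unfolding el_def using e' by (intro e'.e_add e'.e_mult) auto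
    have "ratio_map \<subseteq>\<^sub>m e'"
      unfolding map_le_def
    proof
      fix z assume "z \<in> dom ratio_map"
      then obtain c where c: "ratio_map z = Some c" by auto
      then obtain d p q r s where z: "(p, r) \<in> T d" "(q, s) \<in> T d" "s \<noteq> 0" "q \<noteq> 0" "z = p / q" "c = r / s"
        by (rule ratio_mapE)
      have "e' p = Some r" "e' q = Some s" using z(1,2) e'_el by (auto simp: T_def)
      then have "e' z = Some c" unfolding z(5,6) using z(3) by (rule e'.e_divide)
      with c show "ratio_map z = e' z" by simp
    qed
    then show ?thesis
      using place_maximal[OF calculation, of e'] e' by (simp add: place_def)
  qed
  ultimately show ?thesis using ea eb by blast
qed

text \<open>
  If \<open>e a\<close> is defined, so is \<open>e b\<close>, because \<open>b\<close> is integral over the polynomials in \<open>a\<close>.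
\<close>

lemma finite_places:
  assumes smooth: "\<And>\<alpha>. poly Q \<alpha> = 0 \<Longrightarrow> poly (pderiv Q) \<alpha> \<noteq> 0"
  shows "bij_betw (\<lambda>e. (the (e a), the (e b))) {e. place \<iota> fld e \<and> e a \<noteq> None}
           {(\<alpha>, \<beta>). \<beta> ^ 2 = poly Q \<alpha>}"
proof -
  have vals: "\<exists>\<alpha> \<beta>. e a = Some \<alpha> \<and> e b = Some \<beta> \<and> \<beta> ^ 2 = poly Q \<alpha>"
    if e: "place \<iota> fld e" "e a \<noteq> None" for e
  proof -
    interpret e: local_map \<iota> e using e by (simp add: place_def)
    obtain \<alpha> where \<alpha>: "e a = Some \<alpha>" using e(2) by auto
    have evQ: "e (ev Q) = Some (poly Q \<alpha>)" by (rule e.e_poly[OF \<alpha>])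
    have "e b \<noteq> None"
    proof
      assume b: "e b = None"
      then have "e (inverse b) = Some 0" using e(1) fld_b by (simp add: place_def)
      then have "e (ev Q * (inverse b * inverse b)) = Some (poly Q \<alpha> * (0 * 0))"
        by (intro e.e_mult evQ)
      moreover have "b \<noteq> 0" using b by auto
      then have "ev Q * (inverse b * inverse b) = 1"
        by (simp add: power2_eq_square field_simps flip: sq)
      ultimately show False by simp
    qed
    then obtain \<beta> where \<beta>: "e b = Some \<beta>" by auto
    have "e (b ^ 2) = Some (\<beta> ^ 2)" by (rule e.e_power[OF \<beta>])
    then have "\<beta> ^ 2 = poly Q \<alpha>" using evQ by (simp add: sq)
    then show ?thesis using \<alpha> \<beta> by blast
  qed
  have ex1: "\<exists>!e. place \<iota> fld e \<and> e a = Some \<alpha> \<and> e b = Some \<beta>" if "\<beta> ^ 2 = poly Q \<alpha>" for \<alpha> \<beta>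
    using that smooth[of \<alpha>] by (intro place_at_point) auto
  show ?thesis
  proof (rule bij_betwI')
    fix e e' assume e: "e \<in> {e. place \<iota> fld e \<and> e a \<noteq> None}" "e' \<in> {e. place \<iota> fld e \<and> e a \<noteq> None}"
    obtain \<alpha> \<beta> where 1: "e a = Some \<alpha>" "e b = Some \<beta>" "\<beta> ^ 2 = poly Q \<alpha>" using vals e(1) by blast
    obtain \<alpha>' \<beta>' where 2: "e' a = Some \<alpha>'" "e' b = Some \<beta>'" using vals e(2) by blast
    show "((the (e a), the (e b)) = (the (e' a), the (e' b))) = (e = e')"
      using 1 2 e ex1[OF 1(3)] by auto
  next
    fix e assume "e \<in> {e. place \<iota> fld e \<and> e a \<noteq> None}"
    then show "(the (e a), the (e b)) \<in> {(\<alpha>, \<beta>). \<beta> ^ 2 = poly Q \<alpha>}" using vals by fastforce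
  next
    fix x assume "x \<in> {(\<alpha>, \<beta>). \<beta> ^ 2 = poly Q \<alpha>}"
    then obtain \<alpha> \<beta> where x: "x = (\<alpha>, \<beta>)" "\<beta> ^ 2 = poly Q \<alpha>" by auto
    then obtain e where "place \<iota> fld e" "e a = Some \<alpha>" "e b = Some \<beta>" using ex1 by blast
    then show "\<exists>e\<in>{e. place \<iota> fld e \<and> e a \<noteq> None}. x = (the (e a), the (e b))"
      using x by (intro bexI[of _ e]) auto
  qed
qed

end

locale quartic_function_field = quadratic_function_field +
  assumes degree: "degree Q = 4" and monic: "coeff Q 4 = 1"
begin

text \<open>
  The coordinates \<open>1 / a\<close> and \<open>b / a\<^sup>2\<close> describe the same field as a curve
  \<open>v\<^sup>2 = reflect_poly Q (w)\<close>, on which the poles of \<open>a\<close> are the points with \<open>w = 0\<close>.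
\<close>

lemma at_infinity: "quadratic_function_field \<iota> (inverse a) (b / a ^ 2) (reflect_poly Q)"
proof
  have "(b / a ^ 2) ^ 2 = ev Q / a ^ 4"
    by (simp add: power_divide sq flip: power_mult)
  also have "\<dots> = poly (map_poly \<iota> (reflect_poly Q)) (inverse a)"
    using poly_map_reflect[of "inverse a" Q] a_nonzero degree by (simp add: field_simps)
  finally show "(b / a ^ 2) ^ 2 = poly (map_poly \<iota> (reflect_poly Q)) (inverse a)" .
next
  fix A B :: "'a poly"
  assume eq: "poly (map_poly \<iota> A) (inverse a) + poly (map_poly \<iota> B) (inverse a) * (b / a ^ 2) = 0"
  define m n where "m = degree A" and "n = degree B"
  have refl: "poly (map_poly \<iota> C) (inverse a) * a ^ degree C = ev (reflect_poly C)" for C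
    using poly_map_reflect[OF a_nonzero, of C] by simp
  \<comment> \<open>multiplying the relation by \<open>a ^ (m + n + 2)\<close> makes it polynomial in \<open>a\<close>\<close>
  have "el ([:0, 1:] ^ (n + 2) * reflect_poly A) ([:0, 1:] ^ m * reflect_poly B) =
     (poly (map_poly \<iota> A) (inverse a) + poly (map_poly \<iota> B) (inverse a) * (b / a ^ 2)) * a ^ (m + n + 2)"
  proof -
    have X: "ev ([:0, 1:] ^ k * C) = a ^ k * ev C" for k C
      by (simp only: ev.hom_mult ev.hom_power ev_X)
    have cancel: "c * (b / a ^ 2) * a ^ (m + n + 2) = c * b * a ^ (m + n)" for c
      using a_nonzero by (simp add: power_add power2_eq_square)
    show ?thesis
      unfolding el_def X refl[symmetric] m_def[symmetric] n_def[symmetric] distrib_right cancel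
      by (simp add: power_add ac_simps)
  qed
  then have "el ([:0, 1:] ^ (n + 2) * reflect_poly A) ([:0, 1:] ^ m * reflect_poly B) = 0"
    using eq by simp
  then have "[:0, 1:] ^ (n + 2) * reflect_poly A = 0 \<and> [:0, 1:] ^ m * reflect_poly B = 0"
    by (simp only: el_eq_0_iff)
  then show "A = 0 \<and> B = 0" by simp
qed (rule two)

interpretation inf: quadratic_function_field \<iota> "inverse a" "b / a ^ 2" "reflect_poly Q"
  by (rule at_infinity)

lemma inf_fld: "inf.fld = fld"
proof
  show "inf.fld \<subseteq> fld"
    by (rule inf.fld_least) (intro fld_const fld_add fld_mult fld_inverse fld_divide fld_power fld_a fld_b; assumption)+
  have "inverse (inverse a) \<in> inf.fld" by (intro inf.fld_inverse inf.fld_a)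
  then have a: "a \<in> inf.fld" by simp
  have "b / a ^ 2 * a ^ 2 \<in> inf.fld" by (intro inf.fld_mult inf.fld_power inf.fld_b a)
  then have b: "b \<in> inf.fld" using a_nonzero by simp
  show "fld \<subseteq> inf.fld"
    by (rule fld_least) (intro inf.fld_const inf.fld_add inf.fld_mult inf.fld_inverse a b; assumption)+
qed

text \<open>
  At \<open>w = 0\<close> the reflected polynomial takes the value \<open>1\<close>, the leading coefficient of \<open>Q\<close>. It has the two
  square roots \<open>\<plusminus> 1\<close>, both nonzero, so \<open>place_at_point\<close> applies.
\<close>

lemma infinite_places: "card {e. place \<iota> fld e \<and> e a = None} = 2"
  "finite {e. place \<iota> fld e \<and> e a = None}"
proof -
  have r0: "poly (reflect_poly Q) 0 = 1"
    using degree monic by simp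
  have iff: "e a = None \<longleftrightarrow> e (inverse a) = Some 0" if e: "place \<iota> fld e" for e
  proof -
    interpret e: local_map \<iota> e using e by (simp add: place_def)
    have "e a = Some c \<Longrightarrow> e (inverse a) \<noteq> Some 0" for c
      using e.e_mult[of a c "inverse a" 0] a_nonzero by auto
    then show ?thesis using e fld_a unfolding place_def by (metis not_None_eq)
  qed
  have ex1: "\<exists>!e. place \<iota> fld e \<and> e (inverse a) = Some 0 \<and> e (b / a ^ 2) = Some \<beta>"
    if "\<beta> ^ 2 = 1" for \<beta>
  proof -
    have "\<beta> \<noteq> 0" using that by auto
    then show ?thesis using inf.place_at_point[of \<beta> 0, unfolded inf_fld r0] that by blast
  qed
  have val: "\<exists>\<beta>. e (b / a ^ 2) = Some \<beta> \<and> \<beta> ^ 2 = 1" if e: "place \<iota> fld e" "e (inverse a) = Some 0" for e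
  proof -
    interpret e: local_map \<iota> e using e by (simp add: place_def)
    let ?v = "b / a ^ 2"
    have evQ: "e (?v ^ 2) = Some 1"
      unfolding inf.sq using e.e_poly[OF e(2), of "reflect_poly Q"] r0 by simp
    have "e ?v \<noteq> None"
    proof
      assume v: "e ?v = None"
      moreover have "?v \<in> fld" by (intro fld_divide fld_power fld_a fld_b)
      ultimately have "e (inverse ?v) = Some 0" using e(1) unfolding place_def by blast
      then have "e (?v ^ 2 * (inverse ?v * inverse ?v)) = Some (1 * (0 * 0))"
        by (intro e.e_mult evQ)
      moreover have "?v \<noteq> 0" using v by (metis e.e_0 option.distinct(1))
      then have "?v ^ 2 * (inverse ?v * inverse ?v) = 1" by (simp add: power2_eq_square)
      ultimately show False by simp
    qed
    then obtain \<beta> where \<beta>: "e ?v = Some \<beta>" by auto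
    then show ?thesis using e.e_power[OF \<beta>, of 2] evQ by simp
  qed
  let ?S = "{\<beta> :: 'a. \<beta> ^ 2 = 1}"
  have bij: "bij_betw (\<lambda>e. the (e (b / a ^ 2))) {e. place \<iota> fld e \<and> e a = None} ?S"
  proof (rule bij_betwI')
    fix e e' assume e: "e \<in> {e. place \<iota> fld e \<and> e a = None}" "e' \<in> {e. place \<iota> fld e \<and> e a = None}"
    then have 0: "e (inverse a) = Some 0" "e' (inverse a) = Some 0" using iff by blast+
    obtain \<beta> where 1: "e (b / a ^ 2) = Some \<beta>" "\<beta> ^ 2 = 1" using val e(1) 0 by blast
    obtain \<beta>' where 2: "e' (b / a ^ 2) = Some \<beta>'" using val e(2) 0 by blast
    show "(the (e (b / a ^ 2)) = the (e' (b / a ^ 2))) = (e = e')"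
      using 0 1 2 e ex1[OF 1(2)] by auto
  next
    fix e assume "e \<in> {e. place \<iota> fld e \<and> e a = None}"
    then show "the (e (b / a ^ 2)) \<in> ?S" using val iff by fastforce
  next
    fix \<beta> assume "\<beta> \<in> ?S"
    then obtain e where "place \<iota> fld e" "e (inverse a) = Some 0" "e (b / a ^ 2) = Some \<beta>" using ex1 by blast
    then show "\<exists>e\<in>{e. place \<iota> fld e \<and> e a = None}. \<beta> = the (e (b / a ^ 2))"
      using iff by (intro bexI[of _ e]) auto
  qed
  have "(1 :: 'a) \<noteq> - 1" using two by (simp add: eq_neg_iff_add_eq_0)
  moreover have "?S = {1, - 1}" by (auto simp: power2_eq_1_iff)
  ultimately have card: "card ?S = 2" by simp
  show "card {e. place \<iota> fld e \<and> e a = None} = 2" using bij_betw_same_card[OF bij] card by simp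
  show "finite {e. place \<iota> fld e \<and> e a = None}" using bij_betw_finite[OF bij] by simp
qed

theorem card_places:
  assumes "\<And>\<alpha>. poly Q \<alpha> = 0 \<Longrightarrow> poly (pderiv Q) \<alpha> \<noteq> 0"
  shows "card {e. place \<iota> fld e} = card {(\<alpha>, \<beta>). \<beta> ^ 2 = poly Q \<alpha>} + 2"
proof -
  have split: "{e. place \<iota> fld e} = {e. place \<iota> fld e \<and> e a \<noteq> None} \<union> {e. place \<iota> fld e \<and> e a = None}"
    by auto
  note bij = finite_places[OF assms]
  have "finite {e. place \<iota> fld e \<and> e a \<noteq> None}" using bij_betw_finite[OF bij] by simp
  then have "card {e. place \<iota> fld e} =
      card {e. place \<iota> fld e \<and> e a \<noteq> None} + card {e. place \<iota> fld e \<and> e a = None}"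
    unfolding split using infinite_places(2) by (rule card_Un_disjoint) auto
  then show ?thesis using bij_betw_same_card[OF bij] infinite_places(1) by simp
qed

end

section \<open>Derivatives, Euler's identity and the Taylor expansion\<close>

definition mono_deriv :: "nat \<Rightarrow> (nat \<Rightarrow> 'b::comm_ring_1) \<Rightarrow> (nat \<Rightarrow>\<^sub>0 nat) \<Rightarrow> 'b" where
  "mono_deriv j v m = of_nat (Poly_Mapping.lookup m j) * mono_eval v (m - Poly_Mapping.single j 1)"

text \<open>
  Subtraction of exponents is truncated, which matters only for monomials not containing
  the variable \<open>j\<close>; their derivative has the coefficient zero.
\<close>

lemma diff_single_add:
  assumes "Poly_Mapping.lookup m j > 0"
  shows "m + m' - Poly_Mapping.single j 1 = (m - Poly_Mapping.single j (1 :: nat)) + m'"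
  using assms by (intro poly_mapping_eqI) (auto simp: lookup_add lookup_minus lookup_single when_def)

lemma mono_deriv_add:
  "mono_deriv j v (m + m') = mono_deriv j v m * mono_eval v m' + mono_eval v m * mono_deriv j v m'"
proof -
  have *: "of_nat (Poly_Mapping.lookup m j) * mono_eval v (m + m' - Poly_Mapping.single j 1) =
      mono_deriv j v m * mono_eval v m'" for m m'
  proof (cases "Poly_Mapping.lookup m j = 0")
    case False
    then show ?thesis
      by (subst diff_single_add) (simp_all add: mono_deriv_def mono_eval_add mult.assoc)
  qed (simp add: mono_deriv_def)
  show ?thesis
    using *[of m m'] *[of m' m]
    by (simp add: mono_deriv_def[of j v "m + m'"] lookup_add distrib_right ac_simps)
qed

lemma mono_deriv_single: "mono_deriv j v (Poly_Mapping.single i (Suc 0)) = (if i = j then 1 else 0)"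
  by (simp add: mono_deriv_def lookup_single when_def)

lemma mono_deriv_euler: "v j * mono_deriv j v m = of_nat (Poly_Mapping.lookup m j) * mono_eval v m"
proof (cases "Poly_Mapping.lookup m j = 0")
  case False
  then have "m = Poly_Mapping.single j 1 + (m - Poly_Mapping.single j 1)"
    by (intro poly_mapping_eqI) (auto simp: lookup_add lookup_minus lookup_single when_def)
  then have "mono_eval v m = v j * mono_eval v (m - Poly_Mapping.single j 1)"
    by (metis mono_eval_add mono_eval_single power_one_right)
  then show ?thesis by (simp add: mono_deriv_def)
qed (simp add: mono_deriv_def)

lemma mp_deriv_superset:
  assumes "finite S" "Poly_Mapping.keys p \<subseteq> S"
  shows "mp_deriv j p = (\<Sum>m\<in>S. Poly_Mapping.single (m - Poly_Mapping.single j 1)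
           (of_nat (Poly_Mapping.lookup m j) * Poly_Mapping.lookup p m))"
  unfolding mp_deriv_def
  by (rule sum.mono_neutral_left) (use assms in \<open>auto simp: in_keys_iff\<close>)

lemma mp_deriv_add: "mp_deriv j (p + q) = mp_deriv j p + mp_deriv j q"
proof -
  let ?S = "Poly_Mapping.keys p \<union> Poly_Mapping.keys q"
  have "Poly_Mapping.keys (p + q) \<subseteq> ?S" by (rule Poly_Mapping.keys_add)
  then show ?thesis
    by (simp add: mp_deriv_superset[of ?S] lookup_add distrib_left single_add sum.distrib)
qed

lemma mp_deriv_single:
  "mp_deriv j (Poly_Mapping.single m c) =
     Poly_Mapping.single (m - Poly_Mapping.single j 1) (of_nat (Poly_Mapping.lookup m j) * c)"
  by (subst mp_deriv_superset[of "{m}"]) auto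

context comm_ring_hom
begin

lemma mp_eval_deriv_single:
  "mp_eval hom (mp_deriv j (Poly_Mapping.single m c)) v = hom c * mono_deriv j v m"
  by (simp add: mp_deriv_single mono_deriv_def hom_mult hom_of_nat ac_simps)

lemma mp_eval_deriv_mult:
  "mp_eval hom (mp_deriv j (p * q)) v =
     mp_eval hom (mp_deriv j p) v * mp_eval hom q v + mp_eval hom p v * mp_eval hom (mp_deriv j q) v"
proof (induction p rule: mpoly_sum_induct)
  case (single m c)
  show ?case
  proof (induction q rule: mpoly_sum_induct)
    case (single m' c')
    then show ?case
      by (simp add: mult_single mp_eval_deriv_single mono_deriv_add hom_mult algebra_simps)
  next
    case (add p q)
    then show ?case by (simp add: distrib_left mp_eval_add mp_deriv_add algebra_simps)
  qed
next
  case (add p q)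
  then show ?case by (simp add: distrib_right mp_eval_add mp_deriv_add algebra_simps)
qed

lemma mp_eval_deriv_mconst: "mp_eval hom (mp_deriv j (mconst c)) v = 0"
  by (simp add: mconst_def mp_eval_deriv_single mono_deriv_def)

lemma mp_eval_deriv_mvar: "mp_eval hom (mp_deriv j (mvar i)) v = (if i = j then 1 else 0)"
  by (simp add: mvar_def mp_eval_deriv_single mono_deriv_single)

lemma mp_eval_deriv_eq:
  "mp_eval hom (mp_deriv j p) v =
     (\<Sum>m\<in>Poly_Mapping.keys p. hom (Poly_Mapping.lookup p m) * mono_deriv j v m)"
proof -
  interpret ev: comm_ring_hom "\<lambda>p. mp_eval hom p v" by (rule comm_ring_hom_mp_eval)
  show ?thesis
    unfolding mp_deriv_def
    by (simp add: ev.hom_sum mono_deriv_def hom_mult hom_of_nat ac_simps)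
qed

lemma euler_identity:
  assumes "form n d p"
  shows "(\<Sum>j\<le>n. v j * mp_eval hom (mp_deriv j p) v) = of_nat d * mp_eval hom p v"
proof -
  have "(\<Sum>j\<le>n. v j * mp_eval hom (mp_deriv j p) v) =
      (\<Sum>j\<le>n. \<Sum>m\<in>Poly_Mapping.keys p. hom (Poly_Mapping.lookup p m) * (v j * mono_deriv j v m))"
    by (simp add: mp_eval_deriv_eq sum_distrib_left ac_simps)
  also have "\<dots> = (\<Sum>m\<in>Poly_Mapping.keys p. \<Sum>j\<le>n.
      hom (Poly_Mapping.lookup p m) * mono_eval v m * of_nat (Poly_Mapping.lookup m j))"
    by (subst sum.swap) (simp add: mono_deriv_euler ac_simps)
  also have "\<dots> = (\<Sum>m\<in>Poly_Mapping.keys p. hom (Poly_Mapping.lookup p m) * mono_eval v m * of_nat d)"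
  proof (intro sum.cong refl)
    fix m assume m: "m \<in> Poly_Mapping.keys p"
    have "(\<Sum>j\<le>n. Poly_Mapping.lookup m j) = (\<Sum>j\<in>Poly_Mapping.keys m. Poly_Mapping.lookup m j)"
    proof (rule sum.mono_neutral_right)
      have "Poly_Mapping.keys m \<subseteq> {..<Suc n}" using assms m by (auto simp: form_def mp_vars_def)
      then show "Poly_Mapping.keys m \<subseteq> {..n}" by (simp add: lessThan_Suc_atMost)
    qed (auto simp: in_keys_iff)
    also have "\<dots> = d" using assms m by (simp add: form_def mp_homogeneous_def)
    finally have "(\<Sum>j\<le>n. of_nat (Poly_Mapping.lookup m j)) = (of_nat d :: 'b)" by (metis of_nat_sum)
    then show "(\<Sum>j\<le>n. hom (Poly_Mapping.lookup p m) * mono_eval v m * of_nat (Poly_Mapping.lookup m j)) =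
        hom (Poly_Mapping.lookup p m) * mono_eval v m * of_nat d"
      by (simp flip: sum_distrib_left)
  qed
  also have "\<dots> = of_nat d * mp_eval hom p v"
    by (simp add: mp_eval_def mono_eval_def sum_distrib_left sum_distrib_right ac_simps)
  finally show ?thesis .
qed

lemma mp_eval_deriv_out_of_range:
  assumes "mp_vars N p" "N \<le> j"
  shows "mp_eval hom (mp_deriv j p) v = 0"
proof -
  have "mono_deriv j v m = 0" if "m \<in> Poly_Mapping.keys p" for m
  proof -
    have "j \<notin> Poly_Mapping.keys m" using assms that by (force simp: mp_vars_def)
    then show ?thesis by (simp add: mono_deriv_def in_keys_iff)
  qed
  then show ?thesis by (simp add: mp_eval_deriv_eq)
qed

end

lemmas id_mp_eval_mconst = comm_ring_hom.mp_eval_mconst[OF comm_ring_hom_id]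
lemmas id_mp_eval_mvar = comm_ring_hom.mp_eval_mvar[OF comm_ring_hom_id]
lemmas id_mp_eval_add = comm_ring_hom.mp_eval_add[OF comm_ring_hom_id]
lemmas id_mp_eval_mult = comm_ring_hom.mp_eval_mult[OF comm_ring_hom_id]
lemmas id_mp_eval_deriv_mconst = comm_ring_hom.mp_eval_deriv_mconst[OF comm_ring_hom_id]
lemmas id_mp_eval_deriv_mvar = comm_ring_hom.mp_eval_deriv_mvar[OF comm_ring_hom_id]
lemmas id_mp_eval_deriv_mult = comm_ring_hom.mp_eval_deriv_mult[OF comm_ring_hom_id]
lemmas id_euler_identity = comm_ring_hom.euler_identity[OF comm_ring_hom_id]
lemmas id_mp_eval_deriv_out_of_range = comm_ring_hom.mp_eval_deriv_out_of_range[OF comm_ring_hom_id]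

context local_map
begin

lemma e_mp_eval:
  assumes "\<And>i. e (g i) = Some (v i)"
  shows "e (mp_eval \<iota> p g) = Some (mp_eval (\<lambda>c. c) p v)"
proof -
  have "e (mono_eval g m) = Some (mono_eval v m)" for m
  proof -
    have "e (\<Prod>i\<in>I. g i ^ Poly_Mapping.lookup m i) = Some (\<Prod>i\<in>I. v i ^ Poly_Mapping.lookup m i)" for I
      by (induction I rule: infinite_finite_induct) (auto intro: e_mult e_power assms)
    then show ?thesis by (simp add: mono_eval_def)
  qed
  then show ?thesis
    unfolding mp_eval_def mono_eval_def[symmetric] by (intro e_sum e_mult e_const)
qed

text \<open>
  Linear combinations of the \<open>t j\<close> whose coefficients lie in the local ring and have residues in \<open>R\<close>.
  For generators \<open>t j\<close> of the maximal ideal \<open>M\<close>, the choice \<open>R = UNIV\<close> gives \<open>M\<close> and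
  \<open>R = {0}\<close> gives \<open>M\<^sup>2\<close>.
\<close>

definition combos :: "'k set \<Rightarrow> nat \<Rightarrow> (nat \<Rightarrow> 'K) \<Rightarrow> 'K set" where
  "combos R N t = {\<Sum>j<N. \<mu> j * t j | \<mu>. \<forall>j<N. e (\<mu> j) \<in> Some ` R}"

lemma combosI: "(\<And>j. j < N \<Longrightarrow> e (\<mu> j) \<in> Some ` R) \<Longrightarrow> z = (\<Sum>j<N. \<mu> j * t j) \<Longrightarrow> z \<in> combos R N t"
  by (auto simp: combos_def)

lemma combosE:
  assumes "z \<in> combos R N t"
  obtains \<mu> where "\<forall>j<N. e (\<mu> j) \<in> Some ` R" "z = (\<Sum>j<N. \<mu> j * t j)"
  using assms by (auto simp: combos_def)

lemma combos_add:
  assumes "z \<in> combos R N t" "w \<in> combos R' N t" "\<And>a b. a \<in> R \<Longrightarrow> b \<in> R' \<Longrightarrow> a + b \<in> R''"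
  shows "z + w \<in> combos R'' N t"
proof -
  obtain \<mu> where \<mu>: "\<forall>j<N. e (\<mu> j) \<in> Some ` R" "z = (\<Sum>j<N. \<mu> j * t j)"
    using assms(1) by (rule combosE)
  obtain \<nu> where \<nu>: "\<forall>j<N. e (\<nu> j) \<in> Some ` R'" "w = (\<Sum>j<N. \<nu> j * t j)"
    using assms(2) by (rule combosE)
  show ?thesis
  proof (rule combosI[of _ "\<lambda>j. \<mu> j + \<nu> j"])
    fix j assume "j < N"
    then obtain x y where "x \<in> R" "y \<in> R'" "e (\<mu> j) = Some x" "e (\<nu> j) = Some y"
      using \<mu>(1) \<nu>(1) by blast
    then show "e (\<mu> j + \<nu> j) \<in> Some ` R''" using assms(3) by (auto simp: e_add)
  qed (simp add: \<mu>(2) \<nu>(2) sum.distrib distrib_right)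
qed

lemma combos_scale:
  assumes "e c = Some \<gamma>" "z \<in> combos R N t" "\<And>a. a \<in> R \<Longrightarrow> \<gamma> * a \<in> R'"
  shows "c * z \<in> combos R' N t"
proof -
  obtain \<mu> where \<mu>: "\<forall>j<N. e (\<mu> j) \<in> Some ` R" "z = (\<Sum>j<N. \<mu> j * t j)"
    using assms(2) by (rule combosE)
  show ?thesis
  proof (rule combosI[of _ "\<lambda>j. c * \<mu> j"])
    fix j assume "j < N"
    then obtain x where "x \<in> R" "e (\<mu> j) = Some x" using \<mu>(1) by blast
    then show "e (c * \<mu> j) \<in> Some ` R'" using assms(1,3) by (auto simp: e_mult)
  qed (simp add: \<mu>(2) sum_distrib_left ac_simps)
qed

lemma combos_0: "0 \<in> R \<Longrightarrow> 0 \<in> combos R N t"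
  by (rule combosI[of _ "\<lambda>_. 0"]) auto

lemma combos_value:
  assumes "z \<in> combos R N t" "\<And>j. j < N \<Longrightarrow> e (t j) = Some 0"
  shows "e z = Some 0"
proof -
  obtain \<mu> where \<mu>: "\<forall>j<N. e (\<mu> j) \<in> Some ` R" "z = (\<Sum>j<N. \<mu> j * t j)"
    using assms(1) by (rule combosE)
  have "e (\<Sum>j<N. \<mu> j * t j) = Some (\<Sum>j<N. the (e (\<mu> j)) * 0)"
    by (intro e_sum e_mult assms(2)) (use \<mu>(1) in \<open>auto simp: image_iff\<close>)
  then show ?thesis by (simp add: \<mu>(2))
qed

abbreviation "msq \<equiv> combos {0}"

text \<open>
  Only a congruence modulo \<open>M\<^sup>2\<close> is claimed, so the expansion can be proved by induction over
  sums and products, in every characteristic. For a product of two polynomials, the product of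
  the two increments is the only new term, and it lies in \<open>M\<^sup>2\<close>.
\<close>

lemma taylor_second_order:
  assumes "mp_vars N p" and t: "\<And>j. j < N \<Longrightarrow> e (t j) = Some 0"
  shows "mp_eval \<iota> p (\<lambda>i. \<iota> (v i) + t i) - \<iota> (mp_eval (\<lambda>c. c) p v)
      - (\<Sum>j<N. \<iota> (mp_eval (\<lambda>c. c) (mp_deriv j p) v) * t j) \<in> msq N t"
  using assms(1)
proof (induction p rule: mp_vars_induct)
  case (const c)
  show ?case by (simp add: id_mp_eval_mconst id_mp_eval_deriv_mconst combos_0)
next
  case (var i)
  have "(\<Sum>j<N. \<iota> (if i = j then 1 else 0) * t j) = (\<Sum>j<N. if j = i then t j else 0)"
    by (intro sum.cong) auto
  then show ?case using var by (simp add: id_mp_eval_mvar id_mp_eval_deriv_mvar combos_0)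
next
  case (add p q)
  have "(mp_eval \<iota> p (\<lambda>i. \<iota> (v i) + t i) - \<iota> (mp_eval (\<lambda>c. c) p v)
      - (\<Sum>j<N. \<iota> (mp_eval (\<lambda>c. c) (mp_deriv j p) v) * t j)) +
      (mp_eval \<iota> q (\<lambda>i. \<iota> (v i) + t i) - \<iota> (mp_eval (\<lambda>c. c) q v)
      - (\<Sum>j<N. \<iota> (mp_eval (\<lambda>c. c) (mp_deriv j q) v) * t j)) \<in> msq N t"
    by (rule combos_add[OF add]) auto
  then show ?case
    by (simp add: mp_deriv_add mp_eval_add id_mp_eval_add hom_add sum.distrib algebra_simps)
next
  case (mult p q)
  define p' q' where "p' = mp_eval \<iota> p (\<lambda>i. \<iota> (v i) + t i)" and "q' = mp_eval \<iota> q (\<lambda>i. \<iota> (v i) + t i)"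
  define p0 q0 where "p0 = mp_eval (\<lambda>c. c) p v" and "q0 = mp_eval (\<lambda>c. c) q v"
  define dp dq where "dp j = mp_eval (\<lambda>c. c) (mp_deriv j p) v" and "dq j = mp_eval (\<lambda>c. c) (mp_deriv j q) v" for j
  define P Q where "P = (\<Sum>j<N. \<iota> (dp j) * t j)" and "Q = (\<Sum>j<N. \<iota> (dq j) * t j)"
  have IH: "p' - \<iota> p0 - P \<in> msq N t" "q' - \<iota> q0 - Q \<in> msq N t"
    using mult by (simp_all add: p'_def q'_def p0_def q0_def P_def Q_def dp_def dq_def)
  have PU: "P \<in> combos UNIV N t" and QU: "Q \<in> combos UNIV N t"
    unfolding P_def Q_def by (rule combosI; auto)+
  have "p' - \<iota> p0 - P + P \<in> combos UNIV N t" by (rule combos_add[OF IH(1) PU]) auto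
  then have pU: "p' - \<iota> p0 \<in> combos UNIV N t" by simp
  have "q' - \<iota> q0 - Q + Q \<in> combos UNIV N t" by (rule combos_add[OF IH(2) QU]) auto
  then have qU: "q' - \<iota> q0 \<in> combos UNIV N t" by simp
  have e0: "e (q' - \<iota> q0) = Some 0" by (rule combos_value[OF qU t])
  have 1: "(q' - \<iota> q0) * (p' - \<iota> p0) \<in> msq N t" by (rule combos_scale[OF e0 pU]) auto
  have 2: "\<iota> p0 * (q' - \<iota> q0 - Q) \<in> msq N t" by (rule combos_scale[OF e_const IH(2)]) auto
  have 3: "\<iota> q0 * (p' - \<iota> p0 - P) \<in> msq N t" by (rule combos_scale[OF e_const IH(1)]) auto
  have "(q' - \<iota> q0) * (p' - \<iota> p0) + \<iota> p0 * (q' - \<iota> q0 - Q) + \<iota> q0 * (p' - \<iota> p0 - P) \<in> msq N t"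
    by (rule combos_add[OF combos_add[OF 1 2, of "{0}"] 3]) auto
  also have "(q' - \<iota> q0) * (p' - \<iota> p0) + \<iota> p0 * (q' - \<iota> q0 - Q) + \<iota> q0 * (p' - \<iota> p0 - P) =
      p' * q' - \<iota> (p0 * q0) - (P * \<iota> q0 + \<iota> p0 * Q)"
    by (simp add: hom_mult algebra_simps)
  also have "P * \<iota> q0 + \<iota> p0 * Q = (\<Sum>j<N. \<iota> (dp j * q0 + p0 * dq j) * t j)"
    by (simp add: P_def Q_def sum_distrib_left sum_distrib_right hom_add hom_mult algebra_simps flip: sum.distrib)
  finally show ?case
    by (simp add: mp_eval_mult id_mp_eval_mult id_mp_eval_deriv_mult p'_def q'_def p0_def q0_def dp_def dq_def)
qed

end

section \<open>Linear algebra of the Jacobian\<close>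

definition unit_vec :: "nat \<Rightarrow> nat \<Rightarrow> 'a::field" where
  "unit_vec i = (\<lambda>j. if j = i then 1 else 0)"

interpretation vs: vector_space "vscale :: 'a::field \<Rightarrow> (nat \<Rightarrow> 'a) \<Rightarrow> nat \<Rightarrow> 'a"
  by (rule vector_space_vscale)

lemma sum_fun_apply: "(\<Sum>i\<in>I. f i) x = (\<Sum>i\<in>I. f i x)"
  by (induction I rule: infinite_finite_induct) auto

lemma vecs_span_unit_vecs:
  assumes "w \<in> vecs N"
  shows "w \<in> vs.span (unit_vec ` {..<N})"
proof -
  have "(\<Sum>j<N. vscale (w j) (unit_vec j)) \<in> vs.span (unit_vec ` {..<N})"
    by (intro vs.span_sum vs.span_scale vs.span_base) auto
  moreover have "(\<Sum>j<N. vscale (w j) (unit_vec j)) = w"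
    using assms by (intro ext) (auto simp: sum_fun_apply vscale_def unit_vec_def vecs_def if_distrib[of "(*) _"] cong: if_cong)
  ultimately show ?thesis by simp
qed

text \<open>
  Extension of scalars: this bounds the dimension of a span over the larger field by the
  number of basis vectors over the smaller field.
\<close>

lemma (in field_hom) image_span:
  assumes "w \<in> vs.span W"
  shows "(\<lambda>j. hom (w j)) \<in> vs.span ((\<lambda>w j. hom (w j)) ` W)"
  using assms
proof (induction rule: vs.span_induct_alt)
  case base
  have "(\<lambda>j. hom ((0 :: nat \<Rightarrow> 'a) j)) = 0" by auto
  then show ?case using vs.span_zero by metis
next
  case (step c x y)
  have "(\<lambda>j. hom ((vscale c x + y) j)) = vscale (hom c) (\<lambda>j. hom (x j)) + (\<lambda>j. hom (y j))"
    by (auto simp: vscale_def hom_add hom_mult)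
  then show ?case
    using step by (simp add: vs.span_add vs.span_scale vs.span_base)
qed

text \<open>
  In the application \<open>W\<close> consists of the gradients at a point \<open>v\<close> of \<open>(N - 1)\<close>-dimensional
  projective space. By Euler's identity they lie in the hyperplane orthogonal to \<open>v\<close>, and
  the Jacobian criterion says that they span a subspace of codimension one in it. Adding \<open>unit_vec i0\<close>, which is
  not in the hyperplane, leaves one direction. If two unit vectors \<open>a\<close>, \<open>i\<close> were needed, a basis
  of \<open>W\<close> over the small field would have at most \<open>N - 3\<close> elements.
\<close>

lemma (in field_hom) one_direction_beyond_span:
  fixes v :: "nat \<Rightarrow> 'a"
  assumes W: "W \<subseteq> vecs N" and v: "v i0 = 1" "i0 < N"
    and orth: "\<And>w. w \<in> W \<Longrightarrow> (\<Sum>j<N. w j * v j) = 0"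
    and dim: "vs.dim ((\<lambda>w j. hom (w j)) ` W) = N - 2"
  shows "\<exists>a<N. \<forall>i<N. unit_vec i \<in> vs.span (insert (unit_vec a) (insert (unit_vec i0) W))"
proof (rule ccontr)
  assume neg: "\<not> ?thesis"
  let ?e = "unit_vec :: nat \<Rightarrow> nat \<Rightarrow> 'a"
  obtain a where a: "a < N" "?e a \<notin> vs.span (insert (?e i0) W)"
    using neg v(2) by (metis insert_absorb2)
  obtain i where i: "i < N" "?e i \<notin> vs.span (insert (?e a) (insert (?e i0) W))"
    using neg a(1) by blast
  obtain B where B: "B \<subseteq> W" "vs.independent B" "W \<subseteq> vs.span B"
    by (rule vs.maximal_independent_subset)
  have sub: "vs.subspace {w :: nat \<Rightarrow> 'a. (\<Sum>j<N. w j * v j) = 0}"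
    by (rule vs.subspaceI)
      (auto simp: vscale_def distrib_right sum.distrib mult.assoc simp flip: sum_distrib_left)
  have "(\<Sum>j<N. ?e i0 j * v j) = 1"
    using v by (simp add: unit_vec_def if_distrib[of "\<lambda>x. x * _"] cong: if_cong)
  then have 0: "?e i0 \<notin> vs.span W"
  proof -
    have "vs.span W \<subseteq> {w. (\<Sum>j<N. w j * v j) = 0}"
      by (rule vs.span_minimal[OF _ sub]) (use orth in blast)
    then show ?thesis using \<open>(\<Sum>j<N. ?e i0 j * v j) = 1\<close> by auto
  qed
  have ins: "vs.span (insert x A) \<subseteq> vs.span (insert x A')" if "A \<subseteq> A'" for x :: "nat \<Rightarrow> 'a" and A A'
    using that by (intro vs.span_mono) auto
  have ind: "vs.independent (insert (?e i) (insert (?e a) (insert (?e i0) B)))"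
  proof (intro vs.independent_insertI B)
    show "?e i0 \<notin> vs.span B" using 0 vs.span_mono[OF B(1)] by auto
    show "?e a \<notin> vs.span (insert (?e i0) B)" using a(2) ins[OF B(1), of "?e i0"] by auto
    have "vs.span (insert (?e a) (insert (?e i0) B)) \<subseteq> vs.span (insert (?e a) (insert (?e i0) W))"
      using B(1) by (intro ins) auto
    then show "?e i \<notin> vs.span (insert (?e a) (insert (?e i0) B))" using i(2) by auto
  qed
  have "insert (?e i) (insert (?e a) (insert (?e i0) B)) \<subseteq> vs.span (?e ` {..<N})"
  proof (intro insert_subsetI)
    show "B \<subseteq> vs.span (?e ` {..<N})" using B(1) W vecs_span_unit_vecs by blast
  qed (use a i v(2) in \<open>auto intro!: vs.span_base\<close>)
  from vs.independent_span_bound[OF _ ind this]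
  have fin: "finite (insert (?e i) (insert (?e a) (insert (?e i0) B)))"
    and "card (insert (?e i) (insert (?e a) (insert (?e i0) B))) \<le> card (?e ` {..<N})" by auto
  then have le: "card (insert (?e i) (insert (?e a) (insert (?e i0) B))) \<le> N"
    using card_image_le[of "{..<N}" ?e] by simp
  have "?e i0 \<notin> B" using 0 B(1) vs.span_base by blast
  moreover have "?e a \<notin> insert (?e i0) B" 
    using a(2) B(1) vs.span_superset[of "insert (?e i0) W"] by auto
  moreover have "?e i \<notin> insert (?e a) (insert (?e i0) B)" 
    using i(2) B(1) vs.span_superset[of "insert (?e a) (insert (?e i0) W)"] by auto
  ultimately have cB: "card B + 3 \<le> N" using le fin by simp
  have "vs.dim ((\<lambda>w j. hom (w j)) ` W) \<le> card ((\<lambda>w j. hom (w j)) ` B)"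
    by (rule vs.dim_le_card) (use B(3) image_span fin in auto)
  also have "\<dots> \<le> card B" using fin by (intro card_image_le) auto
  finally show False using dim cB by simp
qed

section \<open>Rational points of a nonsingular projective curve\<close>

lemma field_hom_to_ac: "field_hom (to_ac :: 'a::field \<Rightarrow> 'a alg_closure)"
  by unfold_locales simp_all

interpretation to_ac: field_hom "to_ac :: 'a::field \<Rightarrow> 'a alg_closure"
  by (rule field_hom_to_ac)

lemma to_ac_mp_eval: "to_ac (mp_eval (\<lambda>c. c) p v) = mp_eval to_ac p (\<lambda>i. to_ac (v i))"
  using to_ac.hom_mp_eval[OF comm_ring_hom_id, of p v] by simp

lemma proj_point_self: "v \<in> proj_point v"
  unfolding proj_point_def by (rule CollectI, rule exI[of _ 1]) simp

lemma proj_pointE: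
  assumes "w \<in> proj_point v"
  obtains c where "c \<noteq> 0" "w = (\<lambda>i. c * v i)"
  using assms by (auto simp: proj_point_def)

lemma proj_point_scale:
  assumes "c \<noteq> 0"
  shows "proj_point (\<lambda>i. c * v i) = proj_point v"
proof
  show "proj_point (\<lambda>i. c * v i) \<subseteq> proj_point v"
    using assms by (auto simp: proj_point_def simp flip: mult.assoc)
  show "proj_point v \<subseteq> proj_point (\<lambda>i. c * v i)"
  proof
    fix w assume "w \<in> proj_point v"
    then obtain d where d: "d \<noteq> 0" "w = (\<lambda>i. d * v i)" by (rule proj_pointE)
    then have "w = (\<lambda>i. d / c * (c * v i))" using assms by simp
    moreover have "d / c \<noteq> 0" using d assms by simp
    ultimately show "w \<in> proj_point (\<lambda>i. c * v i)" unfolding proj_point_def by blast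
  qed
qed

lemma proj_zeros_iff:
  assumes "S \<subseteq> forms n" "v \<in> vecs (Suc n)" "v \<noteq> (\<lambda>i. 0)"
  shows "proj_point v \<in> proj_zeros h n S \<longleftrightarrow> (\<forall>F\<in>S. mp_eval h F v = 0)"
proof
  assume "proj_point v \<in> proj_zeros h n S"
  then show "\<forall>F\<in>S. mp_eval h F v = 0" using proj_point_self[of v] by (auto simp: proj_zeros_def)
next
  assume 0: "\<forall>F\<in>S. mp_eval h F v = 0"
  have "mp_eval h F w = 0" if F: "F \<in> S" "w \<in> proj_point v" for F w
  proof -
    obtain d where "form n d F" using assms(1) F(1) by (auto simp: forms_eq)
    moreover obtain c where "w = (\<lambda>i. c * v i)" using F(2) by (rule proj_pointE)
    ultimately show ?thesis using 0 F(1) by (simp add: form_eval_scale)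
  qed
  moreover have "proj_point v \<in> proj_space n" using assms by (auto simp: proj_space_def)
  ultimately show "proj_point v \<in> proj_zeros h n S" by (auto simp: proj_zeros_def)
qed

lemma proj_zerosE:
  assumes "P \<in> proj_zeros h n S"
  obtains v where "P = proj_point v" "v \<in> vecs (Suc n)" "v \<noteq> (\<lambda>i. 0)"
    "\<And>F. F \<in> S \<Longrightarrow> mp_eval h F v = 0"
proof -
  obtain v where v: "P = proj_point v" "v \<in> vecs (Suc n)" "v \<noteq> (\<lambda>i. 0)"
    using assms by (auto simp: proj_zeros_def proj_space_def)
  moreover have "mp_eval h F v = 0" if "F \<in> S" for F
    using assms that v(1) proj_point_self[of v] by (auto simp: proj_zeros_def)
  ultimately show ?thesis by (rule that)
qed

text \<open>
  \<open>\<Phi>\<close> is a generic point of the projective variety given by \<open>S\<close>: a point over an extension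
  field at which exactly those forms vanish that vanish on the whole variety. The set
  \<open>K\<close> below is then the function field of the variety.
\<close>

locale homogeneous_generic_point = field_hom \<iota> for \<iota> :: "'k::field \<Rightarrow> 'K::field" +
  fixes n :: nat and S :: "'k mpoly set" and \<Phi> :: "nat \<Rightarrow> 'K"
  assumes S_forms: "S \<subseteq> forms n"
    and vanish: "form n d A \<Longrightarrow> mp_eval \<iota> A \<Phi> = 0 \<longleftrightarrow>
      (\<forall>P\<in>geom_points n S. \<forall>w\<in>P. mp_eval to_ac A w = 0)"
    and \<Phi>_range: "i > n \<Longrightarrow> \<Phi> i = 0"
begin

definition K :: "'K set" where
  "K = {mp_eval \<iota> A \<Phi> / mp_eval \<iota> B \<Phi> | A B d. form n d A \<and> form n d B \<and> mp_eval \<iota> B \<Phi> \<noteq> 0}"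

lemma KI:
  "form n d A \<Longrightarrow> form n d B \<Longrightarrow> mp_eval \<iota> B \<Phi> \<noteq> 0 \<Longrightarrow> mp_eval \<iota> A \<Phi> / mp_eval \<iota> B \<Phi> \<in> K"
  unfolding K_def by blast

abbreviation val :: "(nat \<Rightarrow> 'k) \<Rightarrow> 'k mpoly \<Rightarrow> 'k" where "val v A \<equiv> mp_eval (\<lambda>c. c) A v"

definition rational :: "(nat \<Rightarrow> 'k) \<Rightarrow> bool" where
  "rational v \<longleftrightarrow> v \<in> vecs (Suc n) \<and> v \<noteq> (\<lambda>i. 0) \<and> (\<forall>F\<in>S. val v F = 0)"

lemma rational_points_eq: "rational_points n S = proj_point ` {v. rational v}"
proof
  show "rational_points n S \<subseteq> proj_point ` {v. rational v}"
    by (auto elim!: proj_zerosE simp: rational_def)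
  show "proj_point ` {v. rational v} \<subseteq> rational_points n S"
    using proj_zeros_iff[OF S_forms, of _ "\<lambda>c. c"] by (auto simp: rational_def)
qed

lemma rational_scale:
  assumes "rational v" "c \<noteq> 0"
  shows "rational (\<lambda>i. c * v i)"
proof -
  have "val (\<lambda>i. c * v i) F = 0" if F: "F \<in> S" for F
  proof -
    obtain d where "form n d F" using S_forms F by (auto simp: forms_eq)
    then show ?thesis using assms(1) F by (simp add: form_eval_scale rational_def)
  qed
  then show ?thesis using assms by (auto simp: rational_def vecs_def fun_eq_iff)
qed

lemma geom_point:
  assumes "rational v"
  shows "proj_point (\<lambda>i. to_ac (v i)) \<in> geom_points n S"
proof (subst proj_zeros_iff[OF S_forms])
  show "(\<lambda>i. to_ac (v i)) \<in> vecs (Suc n)" "(\<lambda>i. to_ac (v i)) \<noteq> (\<lambda>i. 0)"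
    using assms by (auto simp: rational_def vecs_def fun_eq_iff)
  show "\<forall>F\<in>S. mp_eval to_ac F (\<lambda>i. to_ac (v i)) = 0"
    using assms by (simp add: rational_def flip: to_ac_mp_eval)
qed

lemma rational_vanish:
  assumes "rational v" "form n d A" "mp_eval \<iota> A \<Phi> = 0"
  shows "val v A = 0"
proof -
  have "mp_eval to_ac A (\<lambda>i. to_ac (v i)) = 0"
    using vanish[OF assms(2)] assms(3) geom_point[OF assms(1)] proj_point_self by blast
  then show ?thesis by (simp flip: to_ac_mp_eval)
qed

text \<open>
  The graded ring of the variety, with values at a point \<open>v\<close> of it. The values are well
  defined because \<open>\<Phi>\<close> is generic.
\<close>

definition T :: "(nat \<Rightarrow> 'k) \<Rightarrow> nat \<Rightarrow> ('K \<times> 'k) set" where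
  "T v d = {(mp_eval \<iota> A \<Phi>, val v A) | A. form n d A}"

lemma graded_values_T:
  assumes "rational v"
  shows "graded_values \<iota> (T v)"
proof
  show "(\<iota> c, c) \<in> T v 0" for c
  proof -
    have "(mp_eval \<iota> (mconst c) \<Phi>, val v (mconst c)) \<in> T v 0"
      using form_mconst unfolding T_def by blast
    then show ?thesis unfolding id_mp_eval_mconst mp_eval_mconst .
  qed
  fix p r d q s d'
  show "(p + q, r + s) \<in> T v d" if "(p, r) \<in> T v d" "(q, s) \<in> T v d"
  proof -
    obtain A B where AB: "form n d A" "p = mp_eval \<iota> A \<Phi>" "r = val v A" "form n d B" "q = mp_eval \<iota> B \<Phi>" "s = val v B"
      using \<open>(p, r) \<in> T v d\<close> \<open>(q, s) \<in> T v d\<close> by (auto simp: T_def)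
    then have "p + q = mp_eval \<iota> (A + B) \<Phi>" "r + s = val v (A + B)"
      by (simp_all add: mp_eval_add id_mp_eval_add)
    then show ?thesis using form_add[OF AB(1,4)] by (auto simp: T_def)
  qed
  show "(p * q, r * s) \<in> T v (d + d')" if "(p, r) \<in> T v d" "(q, s) \<in> T v d'"
  proof -
    obtain A B where AB: "form n d A" "p = mp_eval \<iota> A \<Phi>" "r = val v A" "form n d' B" "q = mp_eval \<iota> B \<Phi>" "s = val v B"
      using \<open>(p, r) \<in> T v d\<close> \<open>(q, s) \<in> T v d'\<close> by (auto simp: T_def)
    then have "p * q = mp_eval \<iota> (A * B) \<Phi>" "r * s = val v (A * B)"
      by (simp_all add: mp_eval_mult id_mp_eval_mult)
    then show ?thesis using form_mult[OF AB(1,4)] by (auto simp: T_def)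
  qed
  show "r = 0" if "(0, r) \<in> T v d"
    using that rational_vanish[OF assms] by (auto simp: T_def)
qed

text \<open>
  The center of the place \<open>e\<close> is the point with homogeneous coordinates \<open>v\<close>, i.e. \<open>e\<close>
  dominates the local ring of that point.
\<close>

definition centered :: "(nat \<Rightarrow> 'k) \<Rightarrow> ('K \<Rightarrow> 'k option) \<Rightarrow> bool" where
  "centered v e \<longleftrightarrow> (\<forall>d A B. form n d A \<and> form n d B \<and> val v B \<noteq> 0 \<longrightarrow>
     e (mp_eval \<iota> A \<Phi> / mp_eval \<iota> B \<Phi>) = Some (val v A / val v B))"

lemma centered_scale:
  assumes "centered v e" "c \<noteq> 0"
  shows "centered (\<lambda>i. c * v i) e"
  using assms unfolding centered_def by (auto simp: form_eval_scale)

lemma centered_coordinates: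
  assumes "centered v e" "i \<le> n" "j \<le> n" "v j \<noteq> 0"
  shows "e (\<Phi> i / \<Phi> j) = Some (v i / v j)"
proof -
  have "val v (mvar i) = v i" "val v (mvar j) = v j" by (rule id_mp_eval_mvar)+
  then show ?thesis
    using assms(1)[unfolded centered_def, rule_format, of 1 "mvar i" "mvar j"] assms(2-4) by simp
qed

lemma \<Phi>_nonzero:
  assumes "rational v" "v j \<noteq> 0" "j \<le> n"
  shows "\<Phi> j \<noteq> 0"
proof
  assume "\<Phi> j = 0"
  then have "val v (mvar j) = 0" using assms by (intro rational_vanish[where d = 1]) simp_all
  then show False using assms(2) by (simp add: id_mp_eval_mvar)
qed

lemma rational_coordinate:
  assumes "rational v"
  obtains j where "j \<le> n" "v j \<noteq> 0"
proof -
  obtain j where "v j \<noteq> 0" using assms by (auto simp: rational_def)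
  moreover have "v j = 0" if "\<not> j \<le> n"
    using assms that by (auto simp: rational_def vecs_def)
  then have "j \<le> n" using \<open>v j \<noteq> 0\<close> by blast
  ultimately show ?thesis using that by blast
qed

end

text \<open>
  The assumption \<open>dep\<close> is that the function field has transcendence degree at most one.
\<close>

locale nonsingular_generic_point = homogeneous_generic_point \<iota> n S \<Phi>
  for \<iota> :: "'k::field \<Rightarrow> 'K::field" and n S \<Phi> +
  assumes nonsingular: "nonsingular_projective_curve n S"
    and dep: "z \<in> K \<Longrightarrow> w \<in> K \<Longrightarrow> algebraically_dependent \<iota> z w"
begin

lemma jacobian_rank:
  assumes v: "rational v"
  shows "vs.dim ((\<lambda>w j. to_ac (w j)) ` (\<lambda>F j. val v (mp_deriv j F)) ` vanishing_forms n S) = n - 1"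
proof -
  have "vs.dim ((\<lambda>F. gradient F (\<lambda>i. to_ac (v i))) ` vanishing_forms n S) = n - 1"
    using nonsingular geom_point[OF v] proj_point_self
    unfolding nonsingular_projective_curve_def by blast
  then show ?thesis
    by (simp add: gradient_def image_image to_ac_mp_eval)
qed

text \<open>
  In the affine coordinates \<open>g i = \<Phi> i / \<Phi> i0\<close>, put \<open>t i = g i - v i\<close>; the \<open>t i\<close> generate the
  maximal ideal \<open>M\<close>. A form \<open>F\<close> vanishing on the curve vanishes at \<open>g\<close> and at \<open>v\<close>, so by Taylor's
  formula its gradient \<open>w\<close> satisfies \<open>(\<Sum>j. w j * t j) \<in> M\<^sup>2\<close>. There are so many independent
  gradients that every \<open>t i\<close> is a multiple of a single \<open>t a\<close> modulo \<open>M\<^sup>2\<close>, and by Nakayama's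
  lemma \<open>t a\<close> generates \<open>M\<close>.
\<close>

lemma place_at_rational_point:
  assumes v: "rational v" and i0: "v i0 = 1" "i0 \<le> n"
  shows "place \<iota> K (graded_values.ratio_map (T v))"
proof -
  interpret graded_values \<iota> "T v" by (rule graded_values_T) fact
  interpret e: local_map \<iota> ratio_map by (rule local_map_ratio_map)
  define N where "N = Suc n"
  have dom: "dom ratio_map \<subseteq> K"
  proof
    fix z assume "z \<in> dom ratio_map"
    then obtain c where "ratio_map z = Some c" by auto
    then show "z \<in> K" by (elim ratio_mapE) (auto simp: T_def K_def)
  qed
  have nz: "\<Phi> i0 \<noteq> 0" using \<Phi>_nonzero[OF v, of i0] i0 by simp
  define g where "g i = \<Phi> i / \<Phi> i0" for i
  define t where "t i = g i - \<iota> (v i)" for i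
  have g_t: "g = (\<lambda>i. \<iota> (v i) + t i)" by (simp add: t_def)
  have vT: "(\<Phi> i, v i) \<in> T v (Suc 0)" if "i \<le> n" for i
  proof -
    have "(mp_eval \<iota> (mvar i) \<Phi>, val v (mvar i)) \<in> T v (Suc 0)"
      unfolding T_def using form_mvar[OF that] by blast
    then show ?thesis unfolding mp_eval_mvar id_mp_eval_mvar .
  qed
  have eg: "ratio_map (g i) = Some (v i)" for i
  proof (cases "i \<le> n")
    case True
    then show ?thesis using ratio_map_divide[OF vT[OF True] vT[OF i0(2)]] i0 by (simp add: g_def)
  next
    case False
    then show ?thesis using v by (simp add: g_def \<Phi>_range rational_def vecs_def)
  qed
  have et: "ratio_map (t i) = Some 0" for i
    using e.e_diff[OF eg e.e_const[of "v i"]] by (simp add: t_def)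
  have eA: "ratio_map (mp_eval \<iota> A g) = Some (val v A)" for A by (rule e.e_mp_eval) (rule eg)
  have Ag: "mp_eval \<iota> A g = mp_eval \<iota> A \<Phi> / \<Phi> i0 ^ d" if "form n d A" for A d
    unfolding g_def by (rule form_eval_divide[OF that])
  have K_eq: "\<exists>A B. z = mp_eval \<iota> A g / mp_eval \<iota> B g" if z: "z \<in> K" for z
  proof -
    obtain A B d where AB: "form n d A" "form n d B" "z = mp_eval \<iota> A \<Phi> / mp_eval \<iota> B \<Phi>"
      using z by (auto simp: K_def)
    then have "z = mp_eval \<iota> A g / mp_eval \<iota> B g" using nz by (simp add: Ag)
    then show ?thesis by blast
  qed
  define W where "W = (\<lambda>F j. val v (mp_deriv j F)) ` vanishing_forms n S"
  have W_form: "\<exists>d F. form n d F \<and> mp_eval \<iota> F \<Phi> = 0 \<and> w = (\<lambda>j. val v (mp_deriv j F))" if w: "w \<in> W" for w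
  proof -
    obtain F where F: "F \<in> vanishing_forms n S" "w = (\<lambda>j. val v (mp_deriv j F))" using w by (auto simp: W_def)
    then obtain d where "form n d F" by (auto simp: vanishing_forms_def forms_eq)
    moreover have "mp_eval \<iota> F \<Phi> = 0"
      using vanish[OF calculation] F(1) by (auto simp: vanishing_forms_def)
    ultimately show ?thesis using F(2) by blast
  qed
  have "\<exists>a<N. \<forall>i<N. unit_vec i \<in> vs.span (insert (unit_vec a) (insert (unit_vec i0) W))"
  proof (rule to_ac.one_direction_beyond_span)
    show "W \<subseteq> vecs N"
    proof
      fix w assume "w \<in> W"
      then obtain d F where "form n d F" "w = (\<lambda>j. val v (mp_deriv j F))" using W_form by blast
      then show "w \<in> vecs N"
        using id_mp_eval_deriv_out_of_range[OF form_vars] by (auto simp: vecs_def N_def)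
    qed
    show "v i0 = 1" "i0 < N" using i0 by (simp_all add: N_def)
    show "vs.dim ((\<lambda>w j. to_ac (w j)) ` W) = N - 2"
      using jacobian_rank[OF v] by (simp add: W_def N_def)
    fix w assume "w \<in> W"
    then obtain d F where F: "form n d F" "mp_eval \<iota> F \<Phi> = 0" "w = (\<lambda>j. val v (mp_deriv j F))" using W_form by blast
    have "(\<Sum>j<N. w j * v j) = (\<Sum>j\<le>n. v j * val v (mp_deriv j F))"
      unfolding N_def lessThan_Suc_atMost F(3) by (simp add: mult.commute)
    also have "\<dots> = of_nat d * val v F" by (rule id_euler_identity[OF F(1)])
    also have "val v F = 0" by (rule rational_vanish[OF v F(1,2)])
    finally show "(\<Sum>j<N. w j * v j) = 0" by simp
  qed
  then obtain a where a: "a < N" "\<And>i. i < N \<Longrightarrow> unit_vec i \<in> vs.span (insert (unit_vec a) (insert (unit_vec i0) W))"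
    by blast
  \<comment> \<open>\<open>\<tau>\<close> maps the gradients and \<open>unit_vec i0\<close> into \<open>M\<^sup>2\<close>, hence their span as well\<close>
  define \<tau> where "\<tau> w = (\<Sum>j<N. \<iota> (w j) * t j)" for w :: "nat \<Rightarrow> 'k"
  have \<tau>_unit: "\<tau> (unit_vec i) = t i" if "i < N" for i
  proof -
    have "\<tau> (unit_vec i) = (\<Sum>j<N. if j = i then t j else 0)"
      unfolding \<tau>_def by (intro sum.cong) (auto simp: unit_vec_def)
    then show ?thesis using that by simp
  qed
  have \<tau>_add: "\<tau> (vscale c x + y) = \<iota> c * \<tau> x + \<tau> y" for c x y
    by (simp add: \<tau>_def vscale_def hom_add hom_mult distrib_right sum.distrib sum_distrib_left mult.assoc)
  have ti0: "t i0 = 0" using nz i0 by (simp add: t_def g_def)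
  have \<tau>_W: "\<tau> w \<in> e.msq N t" if w: "w \<in> insert (unit_vec i0) W" for w
  proof (cases "w = unit_vec i0")
    case True
    then show ?thesis using i0 by (simp add: \<tau>_unit N_def ti0 e.combos_0)
  next
    case False
    then obtain d F where F: "form n d F" "mp_eval \<iota> F \<Phi> = 0" "w = (\<lambda>j. val v (mp_deriv j F))"
      using W_form w by blast
    have "mp_eval \<iota> F g = 0" using Ag[OF F(1)] F(2) by simp
    moreover have "val v F = 0" by (rule rational_vanish[OF v F(1,2)])
    moreover have "mp_eval \<iota> F g - \<iota> (val v F) - \<tau> w \<in> e.msq N t"
      unfolding \<tau>_def F(3) g_t by (rule e.taylor_second_order) (use F(1) et in \<open>auto simp: form_def N_def\<close>)
    ultimately have "- \<tau> w \<in> e.msq N t" by simp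
    from e.combos_scale[OF e.e_const this, of "- 1" "{0}"] show ?thesis by (simp add: hom_uminus)
  qed
  have \<tau>_span: "\<tau> w \<in> e.msq N t" if "w \<in> vs.span (insert (unit_vec i0) W)" for w
    using that
  proof (induction rule: vs.span_induct_alt)
    case base
    then show ?case by (simp add: \<tau>_def e.combos_0)
  next
    case (step c x y)
    have "\<iota> c * \<tau> x \<in> e.msq N t" by (rule e.combos_scale[OF e.e_const \<tau>_W[OF step(1)]]) auto
    then show ?case unfolding \<tau>_add by (rule e.combos_add[OF _ step(2)]) auto
  qed
  have t_mult: "\<exists>w. ratio_map w \<noteq> None \<and> t i = t a * w" if "i < N" for i
  proof (rule e.nakayama[of "{..<N}"])
    fix i assume "i \<in> {..<N}"
    then have i: "i < N" by simp
    obtain c where c: "unit_vec i - vscale c (unit_vec a) \<in> vs.span (insert (unit_vec i0) W)"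
      using a(2)[OF i] unfolding vs.span_breakdown_eq by blast
    have eq: "unit_vec i - vscale c (unit_vec a) = vscale (- c) (unit_vec a) + unit_vec i"
      by (auto simp: vscale_def)
    have "\<iota> (- c) * t a + t i \<in> e.msq N t"
      using \<tau>_span[OF c] unfolding eq \<tau>_add by (simp add: \<tau>_unit i a(1))
    then obtain \<mu> where \<mu>: "\<forall>j<N. ratio_map (\<mu> j) \<in> Some ` {0}" "\<iota> (- c) * t a + t i = (\<Sum>j<N. \<mu> j * t j)"
      by (rule e.combosE)
    have "t i = t a * \<iota> c + (\<Sum>j\<in>{..<N}. \<mu> j * t j)"
      using \<mu>(2) by (simp add: hom_uminus algebra_simps)
    moreover have "\<forall>j\<in>{..<N}. ratio_map (\<mu> j) = Some 0" using \<mu>(1) by auto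
    moreover have "ratio_map (\<iota> c) \<noteq> None" by simp
    ultimately show "\<exists>w \<mu>. ratio_map w \<noteq> None \<and> (\<forall>j\<in>{..<N}. ratio_map (\<mu> j) = Some 0) \<and>
        t i = t a * w + (\<Sum>j\<in>{..<N}. \<mu> j * t j)" by blast
  qed (use that in auto)
  then obtain \<omega> where \<omega>: "\<And>i. i < N \<Longrightarrow> ratio_map (\<omega> i) \<noteq> None" "\<And>i. i < N \<Longrightarrow> t i = t a * \<omega> i"
    by metis
  show ?thesis
  proof (rule e.place_if_kernel_principal[OF dom _ dep et[of a]])
    fix z assume "z \<in> K"
    then show "\<exists>a b. ratio_map a \<noteq> None \<and> ratio_map b \<noteq> None \<and> z = a / b"
      using K_eq eA by (metis option.distinct(1))
  next
    fix z assume "ratio_map z = Some 0"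
    then obtain d p q r s where z: "(p, r) \<in> T v d" "(q, s) \<in> T v d" "s \<noteq> 0" "q \<noteq> 0" "z = p / q" "0 = r / s"
      by (rule ratio_mapE)
    then obtain A B where AB: "form n d A" "p = mp_eval \<iota> A \<Phi>" "val v A = 0"
      "form n d B" "q = mp_eval \<iota> B \<Phi>" "s = val v B" by (auto simp: T_def)
    have z_eq: "z = mp_eval \<iota> A g / mp_eval \<iota> B g" using nz AB z(5) by (simp add: Ag)
    have "mp_eval \<iota> A g - \<iota> (val v A) - \<tau> (\<lambda>j. val v (mp_deriv j A)) \<in> e.msq N t"
      unfolding \<tau>_def g_t by (rule e.taylor_second_order) (use AB(1) et in \<open>auto simp: form_def N_def\<close>)
    moreover have "\<tau> (\<lambda>j. val v (mp_deriv j A)) \<in> e.combos UNIV N t"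
      unfolding \<tau>_def by (rule e.combosI[of _ "\<lambda>j. \<iota> (val v (mp_deriv j A))"]) auto
    ultimately have "mp_eval \<iota> A g - \<iota> (val v A) - \<tau> (\<lambda>j. val v (mp_deriv j A))
        + \<tau> (\<lambda>j. val v (mp_deriv j A)) \<in> e.combos UNIV N t"
      by (rule e.combos_add) auto
    then have "mp_eval \<iota> A g \<in> e.combos UNIV N t" using AB(3) by simp
    then obtain \<mu> where \<mu>: "\<forall>j<N. ratio_map (\<mu> j) \<in> Some ` UNIV" "mp_eval \<iota> A g = (\<Sum>j<N. \<mu> j * t j)"
      by (rule e.combosE)
    have "mp_eval \<iota> A g = t a * (\<Sum>j<N. \<mu> j * \<omega> j)"
      unfolding \<mu>(2) sum_distrib_left by (intro sum.cong refl) (subst \<omega>(2), auto)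
    then have "z = t a * ((\<Sum>j<N. \<mu> j * \<omega> j) / mp_eval \<iota> B g)" by (simp add: z_eq)
    moreover have "ratio_map ((\<Sum>j<N. \<mu> j * \<omega> j) / mp_eval \<iota> B g) =
        Some ((\<Sum>j<N. the (ratio_map (\<mu> j)) * the (ratio_map (\<omega> j))) / s)"
      unfolding AB(6) by (intro e.e_divide e.e_sum e.e_mult eA) (use \<mu>(1) \<omega>(1) z(3) AB(6) in auto)
    ultimately show "\<exists>w. ratio_map w \<noteq> None \<and> z = t a * w" by blast
  qed
qed

text \<open>
  This translates \<open>centered\<close> into the order of local maps, where \<open>place_maximal\<close> applies.
\<close>

lemma ratio_map_centered:
  assumes "rational v"
  shows "centered v e \<longleftrightarrow> graded_values.ratio_map (T v) \<subseteq>\<^sub>m e"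
proof -
  interpret graded_values \<iota> "T v" by (rule graded_values_T) fact
  show ?thesis
  proof
    assume c: "centered v e"
    show "ratio_map \<subseteq>\<^sub>m e"
      unfolding map_le_def
    proof
      fix z assume "z \<in> dom ratio_map"
      then obtain c where c: "ratio_map z = Some c" by auto
      then obtain d p q r s where "(p, r) \<in> T v d" "(q, s) \<in> T v d" "s \<noteq> 0" "z = p / q" "c = r / s"
        by (rule ratio_mapE)
      then have "e z = Some c" using \<open>centered v e\<close> by (auto simp: T_def centered_def)
      with c show "ratio_map z = e z" by simp
    qed
  next
    assume le: "ratio_map \<subseteq>\<^sub>m e"
    show "centered v e"
      unfolding centered_def
    proof (intro allI impI, elim conjE)
      fix d and A B :: "'k mpoly" assume "form n d A" "form n d B" "val v B \<noteq> 0"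
      then have r: "ratio_map (mp_eval \<iota> A \<Phi> / mp_eval \<iota> B \<Phi>) = Some (val v A / val v B)"
        by (intro ratio_map_divide) (auto simp: T_def)
      have "ratio_map (mp_eval \<iota> A \<Phi> / mp_eval \<iota> B \<Phi>) = e (mp_eval \<iota> A \<Phi> / mp_eval \<iota> B \<Phi>)"
        by (rule bspec[OF le[unfolded map_le_def] domI[where m = ratio_map, OF r]])
      then show "e (mp_eval \<iota> A \<Phi> / mp_eval \<iota> B \<Phi>) = Some (val v A / val v B)"
        unfolding r by (rule sym)
    qed
  qed
qed

lemma ex1_place_centered:
  assumes v: "rational v"
  shows "\<exists>!e. place \<iota> K e \<and> centered v e"
proof -
  obtain i0 where i0: "i0 \<le> n" "v i0 \<noteq> 0" using rational_coordinate[OF v] .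
  define v' where "v' = (\<lambda>i. (1 / v i0) * v i)"
  have v': "rational v'" "v' i0 = 1"
    unfolding v'_def using rational_scale[OF v, of "1 / v i0"] i0 by simp_all
  let ?r = "graded_values.ratio_map (T v')"
  have pl: "place \<iota> K ?r" by (rule place_at_rational_point[OF v' i0(1)])
  have cen: "centered v' e \<longleftrightarrow> centered v e" for e
  proof
    assume "centered v' e"
    from centered_scale[OF this i0(2)] show "centered v e" using i0 by (simp add: v'_def)
  next
    assume "centered v e"
    from centered_scale[OF this, of "1 / v i0"] show "centered v' e" using i0 by (simp add: v'_def)
  qed
  show ?thesis
  proof (rule ex1I[of _ ?r])
    show "place \<iota> K ?r \<and> centered v ?r"
      using pl cen ratio_map_centered[OF v'(1), of ?r] by simp
    fix e assume "place \<iota> K e \<and> centered v e"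
    then show "e = ?r"
      using place_maximal[OF pl, of e] cen[of e] ratio_map_centered[OF v'(1), of e] by (simp add: place_def)
  qed
qed

text \<open>
  Being a valuation ring, the domain of \<open>e\<close> compares any two nonzero coordinates: one of the quotients
  \<open>\<Phi> i / \<Phi> j\<close>, \<open>\<Phi> j / \<Phi> i\<close> has a value. So there is a coordinate \<open>\<Phi> i0\<close> by which all others can be
  divided, and the residues of these quotients are the coordinates of the center.
\<close>

lemma ex_center:
  assumes e: "place \<iota> K e"
  shows "\<exists>v. rational v \<and> centered v e"
proof -
  interpret e: local_map \<iota> e using e by (simp add: place_def)
  have nz: "\<exists>i\<le>n. \<Phi> i \<noteq> 0"
  proof (rule ccontr)
    assume neg: "\<not> ?thesis"
    have "geom_points n S \<noteq> {}"
      using nonsingular by (auto simp: nonsingular_projective_curve_def projective_curve_def irreducible_closed_def)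
    then obtain w where w: "proj_point w \<in> geom_points n S" "w \<in> vecs (Suc n)" "w \<noteq> (\<lambda>i. 0)"
      by (metis all_not_in_conv proj_zerosE)
    obtain i where "w i \<noteq> 0" using w(3) by auto
    then have i: "i \<le> n" using w(2) by (auto simp: vecs_def not_less_eq_eq intro: ccontr)
    have "mp_eval \<iota> (mvar i) \<Phi> = 0" using neg i by auto
    then have "mp_eval to_ac (mvar i) w = 0"
      using vanish[OF form_mvar[OF i]] w(1) proj_point_self by blast
    then show False using \<open>w i \<noteq> 0\<close> by simp
  qed
  have "\<exists>i0\<in>I. \<forall>i\<in>I. e (\<Phi> i / \<Phi> i0) \<noteq> None" if "finite I" "I \<noteq> {}" "I \<subseteq> {i. i \<le> n \<and> \<Phi> i \<noteq> 0}" for I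
    using that
  proof (induction I rule: finite_ne_induct)
    case (singleton i)
    then show ?case by auto
  next
    case (insert k I)
    then obtain i0 where i0: "i0 \<in> I" "\<And>i. i \<in> I \<Longrightarrow> e (\<Phi> i / \<Phi> i0) \<noteq> None" by auto
    have nz: "\<Phi> k \<noteq> 0" "\<Phi> i0 \<noteq> 0" "k \<le> n" "i0 \<le> n" using insert.prems i0(1) by auto
    show ?case
    proof (cases "e (\<Phi> k / \<Phi> i0)")
      case None
      have "mp_eval \<iota> (mvar k) \<Phi> / mp_eval \<iota> (mvar i0) \<Phi> \<in> K"
        using nz by (intro KI[where d = 1]) simp_all
      then have "\<Phi> k / \<Phi> i0 \<in> K" by simp
      then have "e (inverse (\<Phi> k / \<Phi> i0)) = Some 0" using e None unfolding place_def by blast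
      then have k: "e (\<Phi> i0 / \<Phi> k) = Some 0" by simp
      have "e (\<Phi> i / \<Phi> k) \<noteq> None" if i: "i \<in> insert k I" for i
      proof (cases "i = k")
        case True
        then show ?thesis using nz by simp
      next
        case False
        then obtain c where "e (\<Phi> i / \<Phi> i0) = Some c" using i0(2)[of i] i by auto
        from e.e_mult[OF this k] show ?thesis using nz by simp
      qed
      then show ?thesis by blast
    next
      case (Some c)
      then show ?thesis using i0 by (intro bexI[of _ i0]) auto
    qed
  qed
  from this[of "{i. i \<le> n \<and> \<Phi> i \<noteq> 0}"] nz obtain i0 where
    i0: "i0 \<le> n" "\<Phi> i0 \<noteq> 0" "\<And>i. i \<le> n \<Longrightarrow> \<Phi> i \<noteq> 0 \<Longrightarrow> e (\<Phi> i / \<Phi> i0) \<noteq> None" by auto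
  define g where "g i = \<Phi> i / \<Phi> i0" for i
  define v where "v i = the (e (g i))" for i
  have eg: "e (g i) = Some (v i)" for i
  proof (cases "\<Phi> i = 0")
    case True
    then show ?thesis by (simp add: v_def g_def)
  next
    case False
    then have "i \<le> n" using \<Phi>_range not_le by blast
    then show ?thesis using i0(3)[of i] False by (auto simp: v_def g_def)
  qed
  have eA: "e (mp_eval \<iota> A g) = Some (val v A)" for A by (rule e.e_mp_eval) (rule eg)
  have Ag: "mp_eval \<iota> A g = mp_eval \<iota> A \<Phi> / \<Phi> i0 ^ d" if "form n d A" for A d
    unfolding g_def by (rule form_eval_divide[OF that])
  have "rational v"
    unfolding rational_def
  proof (intro conjI ballI)
    show "v \<in> vecs (Suc n)" using eg \<Phi>_range by (auto simp: vecs_def v_def g_def)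
    have "v i0 = 1" using i0(2) by (simp add: v_def g_def)
    then show "v \<noteq> (\<lambda>i. 0)" by auto
    fix F assume F: "F \<in> S"
    then obtain d where d: "form n d F" using S_forms by (auto simp: forms_eq)
    have "mp_eval \<iota> F \<Phi> = 0"
      unfolding vanish[OF d] using F by (auto simp: proj_zeros_def)
    then show "val v F = 0" using eA[of F] Ag[OF d] by simp
  qed
  moreover have "centered v e"
    unfolding centered_def
  proof (intro allI impI, elim conjE)
    fix d and A B :: "'k mpoly" assume AB: "form n d A" "form n d B" "val v B \<noteq> 0"
    have "e (mp_eval \<iota> A g / mp_eval \<iota> B g) = Some (val v A / val v B)" by (intro e.e_divide eA AB)
    then show "e (mp_eval \<iota> A \<Phi> / mp_eval \<iota> B \<Phi>) = Some (val v A / val v B)"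
      using i0(2) by (simp add: Ag[OF AB(1)] Ag[OF AB(2)])
  qed
  ultimately show ?thesis by blast
qed

lemma center_unique:
  assumes v: "rational v" "rational w" and e: "place \<iota> K e" and c: "centered v e" "centered w e"
  shows "proj_point v = proj_point w"
proof -
  interpret e: local_map \<iota> e using e by (simp add: place_def)
  obtain i where i: "i \<le> n" "v i \<noteq> 0" using rational_coordinate[OF v(1)] .
  obtain j where j: "j \<le> n" "w j \<noteq> 0" using rational_coordinate[OF v(2)] .
  have "e (\<Phi> j / \<Phi> i * (\<Phi> i / \<Phi> j)) = Some (v j / v i * (w i / w j))"
    by (intro e.e_mult centered_coordinates c i j)
  then have "v j / v i * (w i / w j) = 1"
    using \<Phi>_nonzero[OF v(1) i(2,1)] \<Phi>_nonzero[OF v(2) j(2,1)] by simp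
  then have wi: "w i \<noteq> 0" by auto
  have "v l / v i = w l / w i" for l
  proof (cases "l \<le> n")
    case True
    then show ?thesis
      using centered_coordinates[OF c(1) True i] centered_coordinates[OF c(2) True i(1) wi] by simp
  next
    case False
    then show ?thesis using v by (simp add: rational_def vecs_def)
  qed
  then have "v = (\<lambda>l. (v i / w i) * w l)" using i(2) wi by (auto simp: field_simps fun_eq_iff)
  then show ?thesis using proj_point_scale[of "v i / w i" w] i(2) wi by simp
qed

text \<open>
  The center of a place is a well-defined rational point, and every rational point is the
  center of exactly one place.
\<close>

theorem card_rational_points: "card (rational_points n S) = card {e. place \<iota> K e}"
proof -
  define f where "f e = proj_point (SOME v. rational v \<and> centered v e)" for e
  have f: "\<exists>v. rational v \<and> centered v e \<and> f e = proj_point v" if "place \<iota> K e" for e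
    using someI_ex[OF ex_center[OF that]] unfolding f_def by blast
  have "bij_betw f {e. place \<iota> K e} (rational_points n S)"
  proof (rule bij_betwI')
    fix e e' assume e: "e \<in> {e. place \<iota> K e}" "e' \<in> {e. place \<iota> K e}"
    show "(f e = f e') = (e = e')"
    proof
      assume eq: "f e = f e'"
      obtain v w where v: "rational v" "centered v e" "f e = proj_point v"
        and w: "rational w" "centered w e'" "f e' = proj_point w" using f[of e] f[of e'] e by blast
      have "v \<in> proj_point w" using eq proj_point_self[of v] unfolding v(3) w(3) by simp
      then obtain c where "c \<noteq> 0" "v = (\<lambda>i. c * w i)" by (rule proj_pointE)
      then have "centered v e'" using centered_scale[OF w(2)] by simp
      then show "e = e'" using ex1_place_centered[OF v(1)] v(2) e by blast
    qed simp
  next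
    fix e assume "e \<in> {e. place \<iota> K e}"
    then show "f e \<in> rational_points n S" using f[of e] unfolding rational_points_eq by blast
  next
    fix P assume "P \<in> rational_points n S"
    then obtain v where v: "rational v" "P = proj_point v" unfolding rational_points_eq by blast
    then obtain e where e: "place \<iota> K e" "centered v e" using ex1_place_centered by blast
    then obtain w where "rational w" "centered w e" "f e = proj_point w" using f by blast
    then have "P = f e" using center_unique v e by metis
    then show "\<exists>e\<in>{e. place \<iota> K e}. P = f e" using e by blast
  qed
  then show ?thesis using bij_betw_same_card by metis
qed

end

section \<open>Birational maps and the generic point\<close>

inductive_set field_gen :: "('k \<Rightarrow> 'K::field) \<Rightarrow> 'K set \<Rightarrow> 'K set" for \<iota> A where
  field_gen_const: "\<iota> c \<in> field_gen \<iota> A"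
| field_gen_generator: "z \<in> A \<Longrightarrow> z \<in> field_gen \<iota> A"
| field_gen_add: "z \<in> field_gen \<iota> A \<Longrightarrow> w \<in> field_gen \<iota> A \<Longrightarrow> z + w \<in> field_gen \<iota> A"
| field_gen_mult: "z \<in> field_gen \<iota> A \<Longrightarrow> w \<in> field_gen \<iota> A \<Longrightarrow> z * w \<in> field_gen \<iota> A"
| field_gen_inverse: "z \<in> field_gen \<iota> A \<Longrightarrow> inverse z \<in> field_gen \<iota> A"

lemma (in field_hom) mp_eval_field_gen:
  assumes "\<And>i. g i \<in> field_gen hom A"
  shows "mp_eval hom p g \<in> field_gen hom A"
proof -
  have 0: "0 \<in> field_gen hom A" and 1: "1 \<in> field_gen hom A"
    using field_gen_const[of hom 0 A] field_gen_const[of hom 1 A] by simp_all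
  have pow: "g i ^ k \<in> field_gen hom A" for i k
    by (induction k) (auto intro: field_gen_mult assms 1)
  have "(\<Prod>i\<in>I. g i ^ Poly_Mapping.lookup m i) \<in> field_gen hom A" for I m
    by (induction I rule: infinite_finite_induct) (auto intro: field_gen_mult pow 1)
  then have mono: "mono_eval g m \<in> field_gen hom A" for m by (simp add: mono_eval_def)
  show ?thesis
    by (induction p rule: mpoly_sum_induct)
      (auto simp: mp_eval_add intro: field_gen_add field_gen_mult field_gen_const mono)
qed

text \<open>
  Homogenization: a polynomial in the affine coordinates \<open>G j / H\<close> becomes a form after
  multiplication by a power of \<open>H\<close>.
\<close>

lemma pullback_form:
  fixes G :: "nat \<Rightarrow> 'a::field mpoly"
  assumes G: "\<And>j. j < m \<Longrightarrow> form n d (G j)" and H: "form n d H" and p: "mp_vars m p"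
  shows "\<exists>r A. form n (r * d) A \<and> (\<forall>w. mp_eval to_ac H w \<noteq> 0 \<longrightarrow>
     mp_eval to_ac A w = mp_eval to_ac p (rat_to_affine m G H w) * mp_eval to_ac H w ^ r)"
  using p
proof (induction p rule: mp_vars_induct)
  case (const c)
  show ?case by (intro exI[of _ 0] exI[of _ "mconst c"]) simp
next
  case (var i)
  then show ?case using G[of i]
    by (intro exI[of _ 1] exI[of _ "G i"]) (simp add: rat_to_affine_def)
next
  case (add p q)
  then obtain r A s B where
    A: "form n (r * d) A" "\<And>w. mp_eval to_ac H w \<noteq> 0 \<Longrightarrow>
        mp_eval to_ac A w = mp_eval to_ac p (rat_to_affine m G H w) * mp_eval to_ac H w ^ r" and
    B: "form n (s * d) B" "\<And>w. mp_eval to_ac H w \<noteq> 0 \<Longrightarrow>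
        mp_eval to_ac B w = mp_eval to_ac q (rat_to_affine m G H w) * mp_eval to_ac H w ^ s" by blast
  have "form n (r * d + s * d) (A * H ^ s + B * H ^ r)"
    using form_mult[OF A(1) form_power[OF H, of s]] form_mult[OF B(1) form_power[OF H, of r]]
    by (auto intro: form_add simp: add.commute)
  then have "form n ((r + s) * d) (A * H ^ s + B * H ^ r)" by (simp add: distrib_right)
  then show ?case
    using A(2) B(2)
    by (intro exI[of _ "r + s"] exI[of _ "A * H ^ s + B * H ^ r"])
      (simp add: to_ac.mp_eval_add to_ac.mp_eval_mult to_ac.mp_eval_power power_add algebra_simps)
next
  case (mult p q)
  then obtain r A s B where
    A: "form n (r * d) A" "\<And>w. mp_eval to_ac H w \<noteq> 0 \<Longrightarrow>
        mp_eval to_ac A w = mp_eval to_ac p (rat_to_affine m G H w) * mp_eval to_ac H w ^ r" and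
    B: "form n (s * d) B" "\<And>w. mp_eval to_ac H w \<noteq> 0 \<Longrightarrow>
        mp_eval to_ac B w = mp_eval to_ac q (rat_to_affine m G H w) * mp_eval to_ac H w ^ s" by blast
  have "form n ((r + s) * d) (A * B)" using form_mult[OF A(1) B(1)] by (simp add: distrib_right)
  then show ?case
    using A(2) B(2)
    by (intro exI[of _ "r + s"] exI[of _ "A * B"]) (simp add: to_ac.mp_eval_mult power_add ac_simps)
qed

text \<open>
  The same notion of generic point for an affine variety.
\<close>

locale affine_generic_point = field_hom \<iota> for \<iota> :: "'k::field \<Rightarrow> 'K::field" +
  fixes m :: nat and Z :: "'k mpoly set" and \<xi> :: "nat \<Rightarrow> 'K"
  assumes generic: "mp_eval \<iota> q \<xi> = 0 \<longleftrightarrow> (\<forall>c\<in>affine_zeros to_ac m Z. mp_eval to_ac q c = 0)"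
begin

text \<open>
  The image \<open>\<Phi>\<close> of \<open>\<xi>\<close> under the birational map is generic. If a form vanishes on the projective
  variety, its pullback vanishes on the nonempty open set \<open>U\<close>, hence at \<open>\<xi>\<close>. If conversely a form
  vanishes at \<open>\<Phi>\<close>, it vanishes on the image \<open>V\<close> of \<open>U\<close>, and therefore everywhere, since the
  irreducible variety is the union of two closed sets: the zeros of the form and the complement of \<open>V\<close>.
  The inverse map expresses the coordinates of \<open>\<xi>\<close> as quotients of forms at \<open>\<Phi>\<close>, so both
  points generate the same field.
\<close>

lemma ex_homogeneous_generic_point:
  assumes bir: "birational m Z n S" and S: "S \<subseteq> forms n" and irr: "irreducible_closed n (geom_points n S)"
  shows "\<exists>\<Phi>. homogeneous_generic_point \<iota> n S \<Phi> \<and>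
    homogeneous_generic_point.K \<iota> n \<Phi> = field_gen \<iota> (range \<xi>)"
proof -
  obtain F0 G H d where
    F0: "\<forall>i\<le>n. mp_vars m (F0 i)" and
    GH: "\<forall>j<m. mp_vars (Suc n) (G j) \<and> mp_homogeneous d (G j)" "mp_vars (Suc n) H \<and> mp_homogeneous d H" and
    bir: "let \<phi> = rat_to_proj n F0;
             \<psi> = rat_to_affine m G H;
             U = {x \<in> affine_zeros to_ac m Z. \<phi> x \<noteq> (\<lambda>i. 0) \<and> mp_eval to_ac H (\<phi> x) \<noteq> 0};
             V = {P \<in> geom_points n S. \<forall>w\<in>P. mp_eval to_ac H w \<noteq> 0 \<and> \<phi> (\<psi> w) \<noteq> (\<lambda>i. 0)}
         in U \<noteq> {} \<and> V \<noteq> {} \<and>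
            (\<forall>x\<in>U. proj_point (\<phi> x) \<in> geom_points n S \<and> \<psi> (\<phi> x) = x) \<and>
            (\<forall>P\<in>V. \<forall>w\<in>P. \<psi> w \<in> affine_zeros to_ac m Z \<and> proj_point (\<phi> (\<psi> w)) = P)"
    using bir unfolding birational_def by blast
  define F where "F i = (if i \<le> n then F0 i else 0)" for i
  have F_vars: "mp_vars m (F i)" for i using F0 by (simp add: F_def)
  define \<phi> where "\<phi> x = (\<lambda>i. mp_eval to_ac (F i) x)" for x
  define \<psi> where "\<psi> = rat_to_affine m G H"
  have \<phi>_eq: "rat_to_proj n F0 = \<phi>" by (auto simp: rat_to_proj_def \<phi>_def F_def fun_eq_iff)
  define U where "U = {x \<in> affine_zeros to_ac m Z. \<phi> x \<noteq> (\<lambda>i. 0) \<and> mp_eval to_ac H (\<phi> x) \<noteq> 0}"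
  define V where "V = {P \<in> geom_points n S. \<forall>w\<in>P. mp_eval to_ac H w \<noteq> 0 \<and> \<phi> (\<psi> w) \<noteq> (\<lambda>i. 0)}"
  have "U \<noteq> {} \<and> V \<noteq> {} \<and>
            (\<forall>x\<in>U. proj_point (\<phi> x) \<in> geom_points n S \<and> \<psi> (\<phi> x) = x) \<and>
            (\<forall>P\<in>V. \<forall>w\<in>P. \<psi> w \<in> affine_zeros to_ac m Z \<and> proj_point (\<phi> (\<psi> w)) = P)"
    using bir unfolding \<phi>_eq Let_def U_def V_def \<psi>_def .
  then have U0: "U \<noteq> {}" and V0: "V \<noteq> {}"
    and U: "\<And>x. x \<in> U \<Longrightarrow> proj_point (\<phi> x) \<in> geom_points n S" "\<And>x. x \<in> U \<Longrightarrow> \<psi> (\<phi> x) = x"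
    and V: "\<And>P w. P \<in> V \<Longrightarrow> w \<in> P \<Longrightarrow> \<psi> w \<in> affine_zeros to_ac m Z"
      "\<And>P w. P \<in> V \<Longrightarrow> w \<in> P \<Longrightarrow> proj_point (\<phi> (\<psi> w)) = P" by blast+
  have G: "form n d (G j)" if "j < m" for j using GH(1) that by (simp add: form_def)
  have H: "form n d H" using GH(2) by (simp add: form_def)
  define \<Phi> where "\<Phi> i = mp_eval \<iota> (F i) \<xi>" for i
  define sub where "sub A = mp_eval mconst A F" for A
  have sub_ac: "mp_eval to_ac (sub A) x = mp_eval to_ac A (\<phi> x)" for A x
    by (simp add: sub_def to_ac.mp_eval_subst \<phi>_def)
  have sub_\<iota>: "mp_eval \<iota> (sub A) \<xi> = mp_eval \<iota> A \<Phi>" for A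
    unfolding sub_def \<Phi>_def by (rule mp_eval_subst)
  obtain c0 where c0: "c0 \<in> affine_zeros to_ac m Z" "\<phi> c0 \<noteq> (\<lambda>i. 0)" "mp_eval to_ac H (\<phi> c0) \<noteq> 0"
    using U0 by (auto simp: U_def)
  obtain i0 where i0: "mp_eval to_ac (F i0) c0 \<noteq> 0" using c0(2) by (auto simp: \<phi>_def)
  have \<Phi>i0: "\<Phi> i0 \<noteq> 0" unfolding \<Phi>_def generic using c0(1) i0 by blast
  have H\<Phi>: "mp_eval \<iota> H \<Phi> \<noteq> 0"
    unfolding sub_\<iota>[symmetric] generic using c0(1,3) sub_ac by metis
  have vanish_U: "mp_eval \<iota> q \<xi> = 0" if q: "\<And>x. x \<in> U \<Longrightarrow> mp_eval to_ac q x = 0" for q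
  proof -
    \<comment> \<open>the factor \<open>F i0 * sub H\<close> vanishes outside \<open>U\<close> but not at \<open>\<xi>\<close>\<close>
    have "mp_eval to_ac (q * (F i0 * sub H)) x = 0" if x: "x \<in> affine_zeros to_ac m Z" for x
    proof (cases "x \<in> U")
      case True
      then show ?thesis using q by (simp add: to_ac.mp_eval_mult)
    next
      case False
      then have "mp_eval to_ac (F i0) x = 0 \<or> mp_eval to_ac (sub H) x = 0"
        using x unfolding U_def sub_ac \<phi>_def by (auto simp: fun_eq_iff)
      then show ?thesis by (auto simp: to_ac.mp_eval_mult)
    qed
    then have "mp_eval \<iota> (q * (F i0 * sub H)) \<xi> = 0" unfolding generic by blast
    then show ?thesis using \<Phi>i0 H\<Phi> by (simp add: mp_eval_mult sub_\<iota> \<Phi>_def[symmetric])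
  qed
  have coord: "\<xi> j = mp_eval \<iota> (G j) \<Phi> / mp_eval \<iota> H \<Phi>" if j: "j < m" for j
  proof -
    have "mp_eval to_ac (sub (G j) - mvar j * sub H) x = 0" if x: "x \<in> U" for x
    proof -
      have "x j = mp_eval to_ac (G j) (\<phi> x) / mp_eval to_ac H (\<phi> x)"
        using arg_cong[OF U(2)[OF x], of "\<lambda>f. f j"] j by (simp add: \<psi>_def rat_to_affine_def)
      moreover have "mp_eval to_ac H (\<phi> x) \<noteq> 0" using x by (simp add: U_def)
      ultimately show ?thesis
        by (simp add: to_ac.mp_eval_diff to_ac.mp_eval_mult sub_ac)
    qed
    then have "mp_eval \<iota> (sub (G j) - mvar j * sub H) \<xi> = 0" by (rule vanish_U)
    then show ?thesis using H\<Phi> by (simp add: mp_eval_diff mp_eval_mult sub_\<iota> field_simps)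
  qed
  have coord0: "\<xi> j = 0" if "\<not> j < m" for j
  proof -
    have "mp_eval \<iota> (mvar j) \<xi> = 0"
      unfolding generic using that by (auto simp: affine_zeros_def vecs_def)
    then show ?thesis by simp
  qed
  have vanish_S: "mp_eval to_ac A w = 0"
    if A: "form n e A" "mp_eval \<iota> A \<Phi> = 0" and w: "P \<in> geom_points n S" "w \<in> P" for e A P w
  proof -
    have A\<phi>: "mp_eval to_ac A (\<phi> x) = 0" if "x \<in> affine_zeros to_ac m Z" for x
      using A(2) that unfolding sub_\<iota>[symmetric] generic sub_ac by blast
    have "\<exists>r B. form n (r * d) B \<and> (\<forall>w. mp_eval to_ac H w \<noteq> 0 \<longrightarrow>
        mp_eval to_ac B w = mp_eval to_ac (F i) (\<psi> w) * mp_eval to_ac H w ^ r)" for i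
      unfolding \<psi>_def by (rule pullback_form[OF G H F_vars])
    then obtain r B where B: "\<And>i. form n (r i * d) (B i)"
      "\<And>i w. mp_eval to_ac H w \<noteq> 0 \<Longrightarrow> mp_eval to_ac (B i) w = \<phi> (\<psi> w) i * mp_eval to_ac H w ^ r i"
      unfolding \<phi>_def by metis
    define S1 where "S1 = insert A S"
    \<comment> \<open>\<open>B i\<close> is the \<open>i\<close>-th coordinate of \<open>\<phi> \<circ> \<psi>\<close> made homogeneous, so \<open>S2\<close> defines a closed set containing the complement of \<open>V\<close>\<close>
    define S2 where "S2 = S \<union> range (\<lambda>i. H * B i)"
    have HB: "form n (d + r i * d) (H * B i)" for i by (rule form_mult[OF H B(1)])
    have S12: "S1 \<subseteq> forms n" "S2 \<subseteq> forms n"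
      using S A(1) HB by (auto simp: S1_def S2_def forms_eq)
    have "geom_points n S = geom_points n S1 \<union> geom_points n S2"
    proof (intro equalityI subsetI)
      fix P assume P: "P \<in> geom_points n S"
      then obtain w where w: "P = proj_point w" "w \<in> vecs (Suc n)" "w \<noteq> (\<lambda>i. 0)"
        "\<And>F. F \<in> S \<Longrightarrow> mp_eval to_ac F w = 0" by (rule proj_zerosE) blast
      show "P \<in> geom_points n S1 \<union> geom_points n S2"
      proof (cases "P \<in> V")
        case True
        have "w \<in> P" using w(1) proj_point_self by simp
        then have "w \<in> proj_point (\<phi> (\<psi> w))" using V(2)[OF True] by simp
        then obtain c where "w = (\<lambda>i. c * \<phi> (\<psi> w) i)" by (rule proj_pointE)
        then have "mp_eval to_ac A w = c ^ e * mp_eval to_ac A (\<phi> (\<psi> w))" by (metis form_eval_scale[OF A(1)])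
        then have "mp_eval to_ac A w = 0" using A\<phi> V(1)[OF True \<open>w \<in> P\<close>] by simp
        then have "P \<in> geom_points n S1"
          unfolding w(1) proj_zeros_iff[OF S12(1) w(2,3)] using w(4) by (auto simp: S1_def)
        then show ?thesis by simp
      next
        case False
        then obtain w' where w': "w' \<in> P" "mp_eval to_ac H w' = 0 \<or> \<phi> (\<psi> w') = (\<lambda>i. 0)"
          using P by (auto simp: V_def)
        then have *: "mp_eval to_ac (H * B i) w' = 0" for i
          using B(2)[of w' i] by (cases "mp_eval to_ac H w' = 0") (auto simp: to_ac.mp_eval_mult)
        obtain c where c: "c \<noteq> 0" "w' = (\<lambda>i. c * w i)" using w'(1) unfolding w(1) by (rule proj_pointE)
        have "mp_eval to_ac (H * B i) w = 0" for i
          using *[of i] c(1) unfolding c(2) form_eval_scale[OF HB] by simp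
        then have "P \<in> geom_points n S2"
          unfolding w(1) proj_zeros_iff[OF S12(2) w(2,3)] using w(4) by (auto simp: S2_def)
        then show ?thesis by simp
      qed
    next
      fix P assume "P \<in> geom_points n S1 \<union> geom_points n S2"
      then show "P \<in> geom_points n S" by (auto simp: proj_zeros_def S1_def S2_def)
    qed
    moreover have "zariski_closed n (geom_points n S1)" "zariski_closed n (geom_points n S2)"
      using S12 by (auto simp: zariski_closed_def)
    ultimately have "geom_points n S = geom_points n S1 \<or> geom_points n S = geom_points n S2"
      using irr unfolding irreducible_closed_def by blast
    moreover have "geom_points n S \<noteq> geom_points n S2"
    proof
      assume eq: "geom_points n S = geom_points n S2"
      obtain P where P: "P \<in> V" using V0 by blast
      then have PS: "P \<in> geom_points n S" by (simp add: V_def)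
      then obtain w where w: "P = proj_point w" by (rule proj_zerosE)
      have "w \<in> P" using w proj_point_self by simp
      then have "mp_eval to_ac H w \<noteq> 0" "\<phi> (\<psi> w) \<noteq> (\<lambda>i. 0)" using P by (auto simp: V_def)
      then obtain i where "mp_eval to_ac (H * B i) w \<noteq> 0"
        using B(2)[of w] by (auto simp: fun_eq_iff to_ac.mp_eval_mult)
      moreover have "P \<in> geom_points n S2" using PS eq by simp
      ultimately show False using \<open>w \<in> P\<close> by (auto simp: proj_zeros_def S2_def)
    qed
    ultimately have "P \<in> geom_points n S1" using w(1) by simp
    then show ?thesis using w(2) by (auto simp: proj_zeros_def S1_def)
  qed
  have hom: "homogeneous_generic_point \<iota> n S \<Phi>"
  proof
    show "S \<subseteq> forms n" by fact
    show "\<Phi> i = 0" if "n < i" for i using that by (simp add: \<Phi>_def F_def)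
    fix e and A :: "'k mpoly" assume A: "form n e A"
    show "mp_eval \<iota> A \<Phi> = 0 \<longleftrightarrow> (\<forall>P\<in>geom_points n S. \<forall>w\<in>P. mp_eval to_ac A w = 0)"
    proof
      assume "\<forall>P\<in>geom_points n S. \<forall>w\<in>P. mp_eval to_ac A w = 0"
      then have "mp_eval to_ac (sub A) x = 0" if "x \<in> U" for x
        unfolding sub_ac using U(1)[OF that] proj_point_self by blast
      then show "mp_eval \<iota> A \<Phi> = 0" unfolding sub_\<iota>[symmetric] by (rule vanish_U)
    qed (use vanish_S[OF A] in blast)
  qed
  then interpret h: homogeneous_generic_point \<iota> n S \<Phi> .
  have "h.K \<subseteq> field_gen \<iota> (range \<xi>)"
  proof
    fix z assume "z \<in> h.K"
    then obtain A B where z: "z = mp_eval \<iota> A \<Phi> / mp_eval \<iota> B \<Phi>" by (auto simp: h.K_def)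
    have "\<Phi> i \<in> field_gen \<iota> (range \<xi>)" for i
      unfolding \<Phi>_def by (rule mp_eval_field_gen) (auto intro: field_gen_generator)
    then show "z \<in> field_gen \<iota> (range \<xi>)"
      unfolding z divide_inverse by (intro field_gen_mult field_gen_inverse mp_eval_field_gen)
  qed
  moreover have "z \<in> h.K" if "z \<in> field_gen \<iota> (range \<xi>)" for z
    using that
  proof induction
    case (field_gen_const c)
    have "mp_eval \<iota> (mconst c) \<Phi> / mp_eval \<iota> 1 \<Phi> \<in> h.K" by (rule h.KI[where d = 0]) simp_all
    then show ?case by simp
  next
    case (field_gen_generator x)
    then obtain j where j: "x = \<xi> j" by auto
    show ?case
    proof (cases "j < m")
      case True
      then show ?thesis unfolding j coord[OF True] by (intro h.KI[OF G H H\<Phi>])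
    next
      case False
      have "mp_eval \<iota> (mconst 0) \<Phi> / mp_eval \<iota> 1 \<Phi> \<in> h.K" by (rule h.KI[where d = 0]) simp_all
      then show ?thesis using False by (simp add: j coord0)
    qed
  next
    case (field_gen_add x y)
    then obtain A B e A' B' e' where
      1: "form n e A" "form n e B" "mp_eval \<iota> B \<Phi> \<noteq> 0" "x = mp_eval \<iota> A \<Phi> / mp_eval \<iota> B \<Phi>" and
      2: "form n e' A'" "form n e' B'" "mp_eval \<iota> B' \<Phi> \<noteq> 0" "y = mp_eval \<iota> A' \<Phi> / mp_eval \<iota> B' \<Phi>"
      by (auto simp: h.K_def)
    have "form n (e + e') (A * B' + B * A')" by (intro form_add form_mult 1 2)
    moreover have "form n (e + e') (B * B')" by (intro form_mult 1 2)
    moreover have "mp_eval \<iota> (B * B') \<Phi> \<noteq> 0" using 1 2 by (simp add: mp_eval_mult)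
    ultimately have "mp_eval \<iota> (A * B' + B * A') \<Phi> / mp_eval \<iota> (B * B') \<Phi> \<in> h.K" by (rule h.KI)
    moreover have "x + y = mp_eval \<iota> (A * B' + B * A') \<Phi> / mp_eval \<iota> (B * B') \<Phi>"
      unfolding 1(4) 2(4) mp_eval_add mp_eval_mult add_frac_eq[OF 1(3) 2(3)] by (simp add: mult.commute)
    ultimately show ?case by simp
  next
    case (field_gen_mult x y)
    then obtain A B e A' B' e' where
      1: "form n e A" "form n e B" "mp_eval \<iota> B \<Phi> \<noteq> 0" "x = mp_eval \<iota> A \<Phi> / mp_eval \<iota> B \<Phi>" and
      2: "form n e' A'" "form n e' B'" "mp_eval \<iota> B' \<Phi> \<noteq> 0" "y = mp_eval \<iota> A' \<Phi> / mp_eval \<iota> B' \<Phi>"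
      by (auto simp: h.K_def)
    have "form n (e + e') (A * A')" by (intro form_mult 1 2)
    moreover have "form n (e + e') (B * B')" by (intro form_mult 1 2)
    moreover have "mp_eval \<iota> (B * B') \<Phi> \<noteq> 0" using 1 2 by (simp add: mp_eval_mult)
    ultimately have "mp_eval \<iota> (A * A') \<Phi> / mp_eval \<iota> (B * B') \<Phi> \<in> h.K" by (rule h.KI)
    then show ?case unfolding 1(4) 2(4) by (simp add: mp_eval_mult)
  next
    case (field_gen_inverse x)
    then obtain A B e where
      1: "form n e A" "form n e B" "mp_eval \<iota> B \<Phi> \<noteq> 0" "x = mp_eval \<iota> A \<Phi> / mp_eval \<iota> B \<Phi>"
      by (auto simp: h.K_def)
    show ?case
    proof (cases "mp_eval \<iota> A \<Phi> = 0")
      case True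
      then show ?thesis using field_gen_inverse by (simp add: 1(4))
    next
      case False
      then show ?thesis unfolding 1(4) using h.KI[OF 1(2,1)] by simp
    qed
  qed
  ultimately have "h.K = field_gen \<iota> (range \<xi>)" by blast
  then show ?thesis using hom by blast
qed

end

section \<open>The quartic curve\<close>

lemma ex_mp_vars: "\<exists>N. mp_vars N p"
proof -
  have "finite (\<Union>m\<in>Poly_Mapping.keys p. Poly_Mapping.keys m)" by simp
  then obtain N where "(\<Union>m\<in>Poly_Mapping.keys p. Poly_Mapping.keys m) \<subseteq> {..<N}"
    using finite_nat_iff_bounded by blast
  then show ?thesis by (auto simp: mp_vars_def)
qed

text \<open>
  If \<open>p\<close> is not constant, then \<open>p + 1\<close> has a zero, at which \<open>p\<close> takes the value \<open>- 1\<close>.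
\<close>

lemma poly_zero_everywhere:
  fixes p :: "'a::alg_closed_field poly"
  assumes "\<And>s. poly p s = 0"
  shows "p = 0"
proof (rule ccontr)
  assume p: "p \<noteq> 0"
  show False
  proof (cases "degree p = 0")
    case True
    then obtain c where "p = [:c:]" by (rule degree_eq_zeroE)
    then show False using p assms[of 0] by simp
  next
    case False
    then have "degree (p + 1) > 0" by (simp add: degree_add_eq_left)
    then obtain s where "poly (p + 1) s = 0" using alg_closed_imp_poly_has_root by blast
    then show False using assms[of s] by simp
  qed
qed

definition quartic_poly :: "'a::field \<Rightarrow> 'a poly" where
  "quartic_poly g = [:g, 0, - (1 + g), 0, 1:]"

lemma poly_quartic: "poly (quartic_poly g) x = (x ^ 2 - 1) * (x ^ 2 - g)"
  by (simp add: quartic_poly_def power2_eq_square algebra_simps)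

lemma (in field_hom) poly_map_quartic:
  "poly (map_poly hom (quartic_poly g)) x = (x ^ 2 - 1) * (x ^ 2 - hom g)"
  by (simp add: quartic_poly_def map_poly_pCons_hom hom_distribs power2_eq_square algebra_simps)

lemma (in field_hom) mp_eval_quartic:
  "mp_eval hom (quartic g) v = v 1 ^ 2 - poly (map_poly hom (quartic_poly g)) (v 0)"
  by (simp add: quartic_def mp_eval_diff mp_eval_mult mp_eval_power poly_map_quartic)

lemma quartic_separable:
  assumes "(2 :: 'a::field) \<noteq> 0" "g \<noteq> 0" "g \<noteq> 1" "poly (quartic_poly g) \<alpha> = 0"
  shows "poly (pderiv (quartic_poly g)) \<alpha> \<noteq> (0 :: 'a)"
proof -
  have d: "poly (pderiv (quartic_poly g)) \<alpha> = 2 * \<alpha> * ((\<alpha> ^ 2 - 1) + (\<alpha> ^ 2 - g))"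
    by (simp add: quartic_poly_def pderiv_pCons power2_eq_square algebra_simps)
  from assms(4) consider "\<alpha> ^ 2 = 1" | "\<alpha> ^ 2 = g" by (auto simp: poly_quartic)
  then show ?thesis
  proof cases
    case 1
    then have "\<alpha> \<noteq> 0" by auto
    then show ?thesis using assms(1,3) by (simp add: d 1)
  next
    case 2
    then have "\<alpha> \<noteq> 0" using assms(2) by auto
    then show ?thesis using assms(1,3) by (simp add: d 2)
  qed
qed

text \<open>
  The function field of the quartic is realized inside the algebraic closure of the rational
  function field, which provides a square root of \<open>quartic_poly g\<close> without a new type for each \<open>g\<close>.
\<close>

definition const_fun :: "'k::field \<Rightarrow> 'k poly fract alg_closure" where
  "const_fun c = to_ac (to_fract [:c:])"

definition coord_x :: "'k::field poly fract alg_closure" where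
  "coord_x = to_ac (to_fract [:0, 1:])"

lemma field_hom_const_fun: "field_hom (const_fun :: 'k::field \<Rightarrow> _)"
  by unfold_locales
    (simp_all add: const_fun_def pCons_one flip: to_ac_add to_ac_mult to_fract_add to_fract_mult)

interpretation const_fun: field_hom "const_fun :: 'k::field \<Rightarrow> _"
  by (rule field_hom_const_fun)

lemma poly_const_fun_coord_x: "poly (map_poly const_fun p) coord_x = to_ac (to_fract p)"
proof (induction p)
  case (pCons c p)
  have "to_ac (to_fract (pCons c p)) = to_ac (to_fract ([:c:] + [:0, 1:] * p))" by simp
  also have "\<dots> = const_fun c + coord_x * to_ac (to_fract p)"
    unfolding const_fun_def coord_x_def by (simp del: mult_pCons_left)
  finally show ?case by (simp add: const_fun.map_poly_pCons_hom pCons.IH)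
qed simp

text \<open>
  Since \<open>1\<close> is a simple zero of the quartic, its order in \<open>B\<^sup>2\<close> times the quartic is odd, while its order in
  \<open>A\<^sup>2\<close> is even.
\<close>

lemma quartic_not_square_ratio:
  fixes A B :: "'k::field poly"
  assumes g: "(2 :: 'k) \<noteq> 0" "g \<noteq> 1" and eq: "A ^ 2 = B ^ 2 * quartic_poly g"
  shows "B = 0"
proof (rule ccontr)
  assume B: "B \<noteq> 0"
  let ?r = "[:1, 1:] * [:- g, 0, 1:] :: 'k poly"
  have q: "quartic_poly g = [:- 1, 1:] ^ 1 * ?r"
    by (simp add: quartic_poly_def)
  have r1: "poly ?r 1 \<noteq> 0" using g by simp
  then have r0: "?r \<noteq> 0" by auto
  then have q0: "quartic_poly g \<noteq> 0" by (simp add: quartic_poly_def)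
  then have "A ^ 2 \<noteq> 0" using B eq by simp
  then have A0: "A * A \<noteq> 0" by (simp add: power2_eq_square)
  have "order 1 (quartic_poly g) = order 1 ([:- 1, 1:] ^ 1 :: 'k poly) + order 1 ?r"
    unfolding q by (rule order_mult) (use q q0 in metis)
  also have "\<dots> = 1" unfolding order_power_n_n using order_0I[OF r1] by simp
  finally have o: "order 1 (quartic_poly g) = 1" .
  have "order 1 A + order 1 A = order 1 (A * A)" by (rule order_mult[symmetric]) fact
  also have "A * A = B * B * quartic_poly g" using eq by (simp add: power2_eq_square)
  also have "order 1 (B * B * quartic_poly g) = order 1 B + order 1 B + 1"
    using B q0 by (simp add: order_mult o)
  finally show False by presburger
qed

lemma ex_coord_y: "\<exists>y. y ^ 2 = poly (map_poly const_fun (quartic_poly g)) coord_x"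
  using nth_root_exists[of 2] by simp

definition coord_y :: "'k::field \<Rightarrow> 'k poly fract alg_closure" where
  "coord_y g = (SOME y. y ^ 2 = poly (map_poly const_fun (quartic_poly g)) coord_x)"

lemma quartic_function_field:
  fixes g :: "'k::{field,finite}"
  assumes g: "(2 :: 'k) \<noteq> 0" "g \<noteq> 1"
  shows "quartic_function_field const_fun coord_x (coord_y g) (quartic_poly g)"
proof
  show sq: "coord_y g ^ 2 = poly (map_poly const_fun (quartic_poly g)) coord_x"
    unfolding coord_y_def by (rule someI_ex[OF ex_coord_y])
  show "(2 :: 'k) \<noteq> 0" by fact
  show "degree (quartic_poly g) = 4" "coeff (quartic_poly g) 4 = 1"
    by (simp_all add: quartic_poly_def numeral_eq_Suc)
  fix A B :: "'k poly"
  assume "poly (map_poly const_fun A) coord_x + poly (map_poly const_fun B) coord_x * coord_y g = 0"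
  then have eq: "to_ac (to_fract A) = - (to_ac (to_fract B) * coord_y g)"
    unfolding poly_const_fun_coord_x by (simp add: eq_neg_iff_add_eq_0)
  then have "to_ac (to_fract A) ^ 2 = to_ac (to_fract B) ^ 2 * to_ac (to_fract (quartic_poly g))"
    by (simp add: power_mult_distrib sq poly_const_fun_coord_x)
  then have "to_ac (to_fract (A ^ 2)) = to_ac (to_fract (B ^ 2 * quartic_poly g))"
    by (simp add: power2_eq_square)
  then have "A ^ 2 = B ^ 2 * quartic_poly g" by (simp only: to_ac_eq_iff to_fract_eq_iff)
  then have B: "B = 0" by (rule quartic_not_square_ratio[OF g])
  then show "A = 0 \<and> B = 0" using eq by simp
qed

definition plane_point :: "'b::zero \<Rightarrow> 'b \<Rightarrow> nat \<Rightarrow> 'b" where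
  "plane_point s t = (\<lambda>i. if i = 0 then s else if i = 1 then t else 0)"

text \<open>
  On the curve every polynomial equals \<open>A(x) + B(x) y\<close>. If it vanishes at all points \<open>(s, t)\<close> over the
  algebraic closure, then also at \<open>(s, - t)\<close>, so that \<open>A(s) = 0\<close> and \<open>B(s) t = 0\<close> for all \<open>s\<close>,
  which forces \<open>A = B = 0\<close>.
\<close>

lemma quartic_generic_point:
  fixes g :: "'k::{field,finite}"
  assumes g: "(2 :: 'k) \<noteq> 0" "g \<noteq> 1"
  shows "affine_generic_point const_fun 2 {quartic g} (plane_point coord_x (coord_y g))"
proof
  fix q :: "'k mpoly"
  interpret quartic_function_field const_fun coord_x "coord_y g" "quartic_poly g"
    by (rule quartic_function_field[OF g])
  let ?Q = "poly (map_poly to_ac (quartic_poly g)) :: 'k alg_closure \<Rightarrow> _"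
  have zeros: "affine_zeros to_ac 2 {quartic g} = {plane_point s t | s t. t ^ 2 = ?Q s}"
  proof
    show "affine_zeros to_ac 2 {quartic g} \<subseteq> {plane_point s t | s t. t ^ 2 = ?Q s}"
    proof
      fix c :: "nat \<Rightarrow> 'k alg_closure" assume c: "c \<in> affine_zeros to_ac 2 {quartic g}"
      then have "c = plane_point (c 0) (c 1)"
        by (auto simp: affine_zeros_def vecs_def plane_point_def fun_eq_iff)
      moreover have "c 1 ^ 2 = ?Q (c 0)"
        using c by (simp add: affine_zeros_def to_ac.mp_eval_quartic)
      ultimately show "c \<in> {plane_point s t | s t. t ^ 2 = ?Q s}" by blast
    qed
  qed (auto simp: affine_zeros_def vecs_def plane_point_def to_ac.mp_eval_quartic)
  have "\<exists>A B. mp_eval const_fun q (plane_point coord_x (coord_y g)) = el A B \<and>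
      (\<forall>s t. t ^ 2 = ?Q s \<longrightarrow>
        mp_eval to_ac q (plane_point s t) = poly (map_poly to_ac A) s + poly (map_poly to_ac B) s * t)"
    (is "\<exists>A B. ?R q A B")
  proof -
    interpret evs: comm_ring_hom "\<lambda>p. poly (map_poly to_ac p) s" for s :: "'k alg_closure"
      by (rule to_ac.comm_ring_hom_poly_map)
    obtain N where "mp_vars N q" using ex_mp_vars by blast
    then show ?thesis
    proof (induction q rule: mp_vars_induct)
      case (const c)
      have "?R (mconst c) [:c:] 0" by (simp add: to_ac.map_poly_pCons_hom flip: el_const)
      then show ?case by blast
    next
      case (var i)
      consider "i = 0" | "i = 1" | "i \<ge> 2" by linarith
      then show ?case
      proof cases
        case 1
        have "?R (mvar i) [:0, 1:] 0"
          using el_a by (simp add: 1 plane_point_def to_ac.map_poly_pCons_hom)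
        then show ?thesis by blast
      next
        case 2
        have "?R (mvar i) 0 1" using el_b by (simp add: 2 plane_point_def)
        then show ?thesis by blast
      next
        case 3
        have "?R (mvar i) 0 0" using 3 by (simp add: plane_point_def el_def)
        then show ?thesis by blast
      qed
    next
      case (add p q)
      then obtain A B C D where AB: "?R p A B" and CD: "?R q C D" by blast
      have "?R (p + q) (A + C) (B + D)"
        using AB CD by (simp add: const_fun.mp_eval_add to_ac.mp_eval_add el_add evs.hom_add algebra_simps)
      then show ?case by blast
    next
      case (mult p q)
      then obtain A B C D where AB: "?R p A B" and CD: "?R q C D" by blast
      have "mp_eval to_ac (p * q) (plane_point s t) =
          poly (map_poly to_ac (A * C + B * D * quartic_poly g)) s + poly (map_poly to_ac (A * D + B * C)) s * t"
        if t: "t ^ 2 = ?Q s" for s t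
      proof -
        have "mp_eval to_ac (p * q) (plane_point s t) =
            (poly (map_poly to_ac A) s + poly (map_poly to_ac B) s * t) *
            (poly (map_poly to_ac C) s + poly (map_poly to_ac D) s * t)"
          using AB CD t by (simp add: to_ac.mp_eval_mult)
        also have "\<dots> = poly (map_poly to_ac A) s * poly (map_poly to_ac C) s
            + poly (map_poly to_ac B) s * poly (map_poly to_ac D) s * t ^ 2
            + (poly (map_poly to_ac A) s * poly (map_poly to_ac D) s
              + poly (map_poly to_ac B) s * poly (map_poly to_ac C) s) * t"
          by (simp add: power2_eq_square algebra_simps)
        finally show ?thesis by (simp add: t evs.hom_add evs.hom_mult)
      qed
      moreover have "mp_eval const_fun (p * q) (plane_point coord_x (coord_y g)) =
          el (A * C + B * D * quartic_poly g) (A * D + B * C)"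
        using AB CD by (simp add: const_fun.mp_eval_mult el_mult)
      ultimately have "?R (p * q) (A * C + B * D * quartic_poly g) (A * D + B * C)" by blast
      then show ?case by blast
    qed
  qed
  then obtain A B where q: "mp_eval const_fun q (plane_point coord_x (coord_y g)) = el A B"
    and q_ac: "\<And>s t. t ^ 2 = ?Q s \<Longrightarrow>
        mp_eval to_ac q (plane_point s t) = poly (map_poly to_ac A) s + poly (map_poly to_ac B) s * t" by blast
  show "mp_eval const_fun q (plane_point coord_x (coord_y g)) = 0 \<longleftrightarrow>
      (\<forall>c\<in>affine_zeros to_ac 2 {quartic g}. mp_eval to_ac q c = 0)"
  proof
    assume "mp_eval const_fun q (plane_point coord_x (coord_y g)) = 0"
    then have "A = 0" "B = 0" unfolding q el_eq_0_iff by auto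
    then show "\<forall>c\<in>affine_zeros to_ac 2 {quartic g}. mp_eval to_ac q c = 0"
      unfolding zeros using q_ac by auto
  next
    assume vanish: "\<forall>c\<in>affine_zeros to_ac 2 {quartic g}. mp_eval to_ac q c = 0"
    have 0: "poly (map_poly to_ac A) s + poly (map_poly to_ac B) s * t = 0" if "t ^ 2 = ?Q s" for s t
    proof -
      have "plane_point s t \<in> affine_zeros to_ac 2 {quartic g}" unfolding zeros using that by blast
      then show ?thesis using vanish q_ac[OF that] by simp
    qed
    have two': "(2 :: 'k alg_closure) \<noteq> 0"
      using g(1) to_ac_eq_0_iff[of "2 :: 'k"] by (simp del: to_ac_eq_0_iff)
    have AB: "poly (map_poly to_ac A) s = 0 \<and> poly (map_poly to_ac (B ^ 2 * quartic_poly g)) s = 0" for s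
    proof -
      interpret evs: comm_ring_hom "\<lambda>p. poly (map_poly to_ac p) s"
        by (rule to_ac.comm_ring_hom_poly_map)
      obtain t where t: "t ^ 2 = ?Q s" using nth_root_exists[of 2 "?Q s"] by auto
      have 1: "poly (map_poly to_ac A) s + poly (map_poly to_ac B) s * t = 0"
        and 2: "poly (map_poly to_ac A) s + poly (map_poly to_ac B) s * (- t) = 0"
        using 0[of t s] 0[of "- t" s] t by simp_all
      from 1 2 have "2 * poly (map_poly to_ac A) s = 0" by (simp add: algebra_simps)
      then have A: "poly (map_poly to_ac A) s = 0" using two' by simp
      then have "(poly (map_poly to_ac B) s * t) ^ 2 = 0" using 1 by simp
      then have "poly (map_poly to_ac (B ^ 2 * quartic_poly g)) s = 0"
        by (simp add: power_mult_distrib t evs.hom_mult evs.hom_power)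
      with A show ?thesis by blast
    qed
    have inj: "p = 0" if "map_poly to_ac p = 0" for p :: "'k poly"
    proof (rule poly_eqI)
      fix i
      have "to_ac (coeff p i) = 0" using arg_cong[OF that, of "\<lambda>p. coeff p i"] by simp
      then show "coeff p i = coeff 0 i" by simp
    qed
    have A: "A = 0" using inj[OF poly_zero_everywhere] AB by blast
    have "B ^ 2 * quartic_poly g = 0" using inj[OF poly_zero_everywhere] AB by blast
    moreover have "quartic_poly g \<noteq> 0" by (simp add: quartic_poly_def)
    ultimately have "B = 0" by simp
    with A show "mp_eval const_fun q (plane_point coord_x (coord_y g)) = 0"
      unfolding q el_eq_0_iff by simp
  qed
qed

theorem card_rational_points_quartic_model:
  fixes g :: "'k::{field,finite}"
  assumes g: "(2 :: 'k) \<noteq> 0" "g \<noteq> 0" "g \<noteq> 1" and model: "smooth_projective_model 2 {quartic g} n S"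
  shows "card (rational_points n S) = card {(\<alpha>, \<beta>). \<beta> ^ 2 = (\<alpha> ^ 2 - 1) * (\<alpha> ^ 2 - g)} + 2"
proof -
  interpret q: quartic_function_field const_fun coord_x "coord_y g" "quartic_poly g"
    by (rule quartic_function_field[OF g(1,3)])
  interpret a: affine_generic_point const_fun 2 "{quartic g}" "plane_point coord_x (coord_y g)"
    by (rule quartic_generic_point[OF g(1,3)])
  have ns: "nonsingular_projective_curve n S" and bir: "birational 2 {quartic g} n S"
    using model by (auto simp: smooth_projective_model_def)
  then have S: "S \<subseteq> forms n" "irreducible_closed n (geom_points n S)"
    by (auto simp: nonsingular_projective_curve_def projective_curve_def)
  obtain \<Phi> where \<Phi>: "homogeneous_generic_point const_fun n S \<Phi>"
    "homogeneous_generic_point.K const_fun n \<Phi> = field_gen const_fun (range (plane_point coord_x (coord_y g)))"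
    using a.ex_homogeneous_generic_point[OF bir S] by blast
  interpret h: homogeneous_generic_point const_fun n S \<Phi> by fact
  let ?L = "field_gen const_fun (range (plane_point coord_x (coord_y g)))"
  have "q.fld = ?L"
  proof
    have "plane_point coord_x (coord_y g) 0 \<in> ?L" "plane_point coord_x (coord_y g) 1 \<in> ?L"
      by (intro field_gen_generator rangeI)+
    then have "coord_x \<in> ?L" "coord_y g \<in> ?L" by (simp_all add: plane_point_def)
    then show "q.fld \<subseteq> ?L"
      by (rule q.fld_least[rotated]) (intro field_gen_const field_gen_add field_gen_mult field_gen_inverse; assumption)+
    show "?L \<subseteq> q.fld"
    proof
      fix z assume "z \<in> ?L"
      then show "z \<in> q.fld"
      proof induction
        case (field_gen_generator z)
        then show ?case
          using q.fld_a q.fld_b q.fld_const[of 0] by (auto simp: plane_point_def split: if_splits)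
      qed (auto intro: q.fld_const q.fld_add q.fld_mult q.fld_inverse)
    qed
  qed
  then have K: "h.K = q.fld" using \<Phi>(2) by simp
  interpret ns: nonsingular_generic_point const_fun n S \<Phi>
    by unfold_locales (use ns q.fld_algebraically_dependent K in auto)
  have "card (rational_points n S) = card {e. place const_fun q.fld e}"
    using ns.card_rational_points K by simp
  also have "\<dots> = card {(\<alpha>, \<beta>). \<beta> ^ 2 = poly (quartic_poly g) \<alpha>} + 2"
    by (rule q.card_places) (rule quartic_separable[OF g])
  finally show ?thesis by (simp add: poly_quartic)
qed

section \<open>Quadratic characters and the size of the union\<close>

lemma QuadRes_iff_square:
  fixes x :: "'p::prime_card mod_ring"
  shows "QuadRes (int CARD('p)) (to_int_mod_ring x) \<longleftrightarrow> (\<exists>y. y ^ 2 = x)"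
proof -
  have x: "of_int (to_int_mod_ring x) = x" by (simp add: of_int_of_int_mod_ring)
  have cong: "[y ^ 2 = to_int_mod_ring x] (mod int CARD('p)) \<longleftrightarrow> (of_int y :: 'p mod_ring) ^ 2 = x" for y
    using of_int_eq_iff_cong_CHAR[of "y ^ 2" "to_int_mod_ring x", where 'a = "'p mod_ring"] by (simp add: x)
  show ?thesis
    unfolding QuadRes_def cong by (metis of_int_mod_ring_to_int_mod_ring of_int_of_int_mod_ring)
qed

lemma chi_eq: "chi x = (if x = 0 then 0 else if \<exists>y. y ^ 2 = x then 1 else - 1)"
  for x :: "'p::prime_card mod_ring"
proof -
  have "[to_int_mod_ring x = 0] (mod int CARD('p)) \<longleftrightarrow> x = 0"
    using of_int_eq_iff_cong_CHAR[of "to_int_mod_ring x" 0, where 'a = "'p mod_ring"]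
    by (simp add: of_int_of_int_mod_ring)
  then show ?thesis unfolding chi_def Legendre_def by (simp add: QuadRes_iff_square)
qed

lemma chi_0 [simp]: "chi 0 = 0"
  by (simp add: chi_eq)

lemma chi_square: "x \<noteq> 0 \<Longrightarrow> chi (x ^ 2) = 1"
  by (auto simp: chi_eq)

lemma chi_1 [simp]: "chi 1 = 1"
  using chi_square[of 1] by simp

lemma chi_eq_0_iff [simp]: "chi x = 0 \<longleftrightarrow> x = 0"
  by (simp add: chi_eq)

lemma chi_cases: "x \<noteq> 0 \<Longrightarrow> chi x = 1 \<or> chi x = - 1"
  by (simp add: chi_eq)

lemma chi_squareD: "chi x = 1 \<Longrightarrow> \<exists>y. y \<noteq> 0 \<and> y ^ 2 = x"
  by (auto simp: chi_eq split: if_splits)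

locale odd_primitive_root =
  fixes \<gamma> :: "'p::prime_card mod_ring"
  assumes odd: "CARD('p) > 2" and prim: "primitive_root \<gamma>"
begin

lemma two: "(2 :: 'p mod_ring) \<noteq> 0"
proof
  assume "(2 :: 'p mod_ring) = 0"
  then have "CARD('p) dvd 2" by (intro of_nat_0_mod_ring_dvd) simp
  then show False using odd dvd_imp_le[of "CARD('p)" 2] by simp
qed

lemma four: "(4 :: 'p mod_ring) \<noteq> 0"
proof -
  have "(4 :: 'p mod_ring) = 2 * 2" by simp
  then show ?thesis using two by (metis mult_eq_0_iff)
qed

lemma one_neq_minus_one: "(1 :: 'p mod_ring) \<noteq> - 1"
  using two by (simp add: eq_neg_iff_add_eq_0)

lemma power_surj: "x \<noteq> 0 \<Longrightarrow> \<exists>k::int. x = \<gamma> powi k"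
  using prim unfolding primitive_root_def by auto

lemma \<gamma>_nonzero: "\<gamma> \<noteq> 0"
proof -
  have "\<gamma> powi 1 \<in> range (\<lambda>k::int. \<gamma> powi k)" by blast
  then show ?thesis using prim unfolding primitive_root_def by simp
qed

lemma square_or: "x \<noteq> 0 \<Longrightarrow> \<exists>y. y \<noteq> 0 \<and> (x = y ^ 2 \<or> x = \<gamma> * y ^ 2)"
proof -
  assume "x \<noteq> 0"
  then obtain k :: int where k: "x = \<gamma> powi k" using power_surj by blast
  obtain j where "k = j + j \<or> k = 1 + (j + j)" by (metis add.commute evenE mult_2 oddE)
  moreover have "\<gamma> powi (j + j) = (\<gamma> powi j) ^ 2"
    unfolding power2_eq_square by (rule power_int_add) (simp add: \<gamma>_nonzero)
  moreover have "\<gamma> powi (1 + (j + j)) = \<gamma> powi 1 * \<gamma> powi (j + j)"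
    by (rule power_int_add) (simp add: \<gamma>_nonzero)
  ultimately have "x = (\<gamma> powi j) ^ 2 \<or> x = \<gamma> * (\<gamma> powi j) ^ 2"
    unfolding k by (metis power_int_1_right)
  moreover have "\<gamma> powi j \<noteq> 0" using \<gamma>_nonzero by simp
  ultimately show ?thesis by blast
qed

lemma chi_\<gamma>: "chi \<gamma> = - 1"
proof -
  have False if d: "d ^ 2 = \<gamma>" for d
  proof -
    have "d \<noteq> 0" using d \<gamma>_nonzero by auto
    have "- {0} \<subseteq> (\<lambda>x :: 'p mod_ring. x ^ 2) ` (- {0})"
    proof
      fix x :: "'p mod_ring" assume "x \<in> - {0}"
      then obtain y where "y \<noteq> 0" "x = y ^ 2 \<or> x = (d * y) ^ 2"
        using square_or[of x] d by (auto simp: power_mult_distrib)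
      then show "x \<in> (\<lambda>x. x ^ 2) ` (- {0})" using \<open>d \<noteq> 0\<close> by auto
    qed
    moreover have "(\<lambda>x :: 'p mod_ring. x ^ 2) ` (- {0}) \<subseteq> - {0}" by auto
    ultimately have "inj_on (\<lambda>x :: 'p mod_ring. x ^ 2) (- {0})"
      by (intro finite_surj_inj) auto
    from inj_onD[OF this, of 1 "- 1"] show False using one_neq_minus_one by simp
  qed
  then show ?thesis using \<gamma>_nonzero by (auto simp: chi_eq)
qed

lemma chi_square_mult:
  fixes x :: "'p mod_ring"
  assumes "y \<noteq> 0"
  shows "chi (y ^ 2 * x) = chi x"
proof -
  have "(\<exists>z. z ^ 2 = y ^ 2 * x) \<longleftrightarrow> (\<exists>z. z ^ 2 = x)"
  proof
    assume "\<exists>z. z ^ 2 = y ^ 2 * x"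
    then obtain z where "z ^ 2 = y ^ 2 * x" by blast
    then have "(z / y) ^ 2 = x" using assms by (simp add: power_divide)
    then show "\<exists>z. z ^ 2 = x" by blast
  next
    assume "\<exists>z. z ^ 2 = x"
    then obtain z where "z ^ 2 = x" by blast
    then have "(y * z) ^ 2 = y ^ 2 * x" by (simp add: power_mult_distrib)
    then show "\<exists>z. z ^ 2 = y ^ 2 * x" by blast
  qed
  then show ?thesis using assms by (simp add: chi_eq)
qed

lemma chi_\<gamma>_mult: "chi (\<gamma> * x) = - chi x"
proof (cases "x = 0")
  case False
  then obtain y where y: "y \<noteq> 0" "x = y ^ 2 \<or> x = \<gamma> * y ^ 2" using square_or by blast
  then show ?thesis
  proof (elim disjE)
    assume x: "x = y ^ 2"
    then have "\<gamma> * x = y ^ 2 * \<gamma>" by simp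
    then show ?thesis using chi_square_mult[OF y(1), of \<gamma>] chi_square[OF y(1)] x chi_\<gamma> by metis
  next
    assume x: "x = \<gamma> * y ^ 2"
    then have "\<gamma> * x = (\<gamma> * y) ^ 2" "x = y ^ 2 * \<gamma>" by (simp_all add: power2_eq_square)
    then show ?thesis
      using chi_square[of "\<gamma> * y"] chi_square_mult[OF y(1), of \<gamma>] y(1) \<gamma>_nonzero chi_\<gamma> by simp
  qed
qed simp

lemma chi_mult: "chi (x * y) = chi x * chi (y :: 'p mod_ring)"
proof (cases "x = 0")
  case False
  then obtain z where z: "z \<noteq> 0" "x = z ^ 2 \<or> x = \<gamma> * z ^ 2" using square_or by blast
  then show ?thesis
    using chi_square_mult[OF z(1), of y] chi_\<gamma>_mult[of "z ^ 2 * y"] chi_\<gamma>_mult[of "z ^ 2"] chi_square[OF z(1)]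
    by (auto simp: mult.assoc)
qed simp

lemma card_square_roots: "int (card {z. z ^ 2 = x}) = 1 + chi (x :: 'p mod_ring)"
proof (cases "\<exists>y. y ^ 2 = x")
  case True
  then obtain y where y: "x = y ^ 2" by blast
  have roots: "{z. z ^ 2 = x} = {y, - y}" by (auto simp: y power2_eq_iff)
  show ?thesis
  proof (cases "y = 0")
    case False
    then have "y \<noteq> - y" using two by (simp add: eq_neg_iff_add_eq_0 flip: mult_2)
    then show ?thesis unfolding roots using False by (simp add: y chi_square)
  qed (use roots y in simp)
next
  case False
  then have "x \<noteq> 0" by (metis zero_power2)
  with False have "chi x = - 1" by (simp add: chi_eq)
  moreover have "{z. z ^ 2 = x} = {}" using False by blast
  ultimately show ?thesis by simp
qed

lemma card_double_cover:
  fixes h :: "'p mod_ring \<Rightarrow> 'p mod_ring"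
  shows "int (card {(x, y). y ^ 2 = h x}) = int CARD('p) + (\<Sum>x\<in>UNIV. chi (h x))"
proof -
  have "{(x, y). y ^ 2 = h x} = (SIGMA x:UNIV. {y. y ^ 2 = h x})" by auto
  then have "int (card {(x, y). y ^ 2 = h x}) = (\<Sum>x\<in>UNIV. int (card {y. y ^ 2 = h x}))" by simp
  then show ?thesis by (simp add: card_square_roots sum.distrib)
qed

text \<open>
  The sum counts the points of the hyperbola \<open>(x - y) (x + y) = c\<close>, which is parametrized by
  \<open>u = x - y \<noteq> 0\<close>.
\<close>

lemma sum_chi_square_minus:
  assumes "c \<noteq> (0 :: 'p mod_ring)"
  shows "(\<Sum>y\<in>UNIV. chi (y ^ 2 - c)) = - 1"
proof -
  have "bij_betw (\<lambda>u. ((u + c / u) / 2, (c / u - u) / 2)) (- {0}) {(x, y). y ^ 2 = x ^ 2 - c}"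
  proof (rule bij_betwI[where g = "\<lambda>(x, y). x - y"])
    show "(\<lambda>u. ((u + c / u) / 2, (c / u - u) / 2)) \<in> - {0} \<rightarrow> {(x, y). y ^ 2 = x ^ 2 - c}"
    proof
      fix u :: "'p mod_ring" assume u: "u \<in> - {0}"
      define v where "v = c / u"
      have uv: "u * v = c" using u by (simp add: v_def)
      have "(u + v) ^ 2 - 4 * (u * v) = (v - u) ^ 2" by (simp add: power2_eq_square algebra_simps)
      then have "(u + v) ^ 2 - 4 * c = (v - u) ^ 2" unfolding uv .
      then have "((v - u) / 2) ^ 2 = ((u + v) ^ 2 - 4 * c) / 4" by (simp add: power_divide)
      also have "\<dots> = (u + v) ^ 2 / 4 - c" using four by (simp add: diff_divide_distrib)
      also have "\<dots> = ((u + v) / 2) ^ 2 - c" by (simp add: power_divide)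
      finally have "((v - u) / 2) ^ 2 = ((u + v) / 2) ^ 2 - c" .
      then show "((u + c / u) / 2, (c / u - u) / 2) \<in> {(x, y). y ^ 2 = x ^ 2 - c}"
        unfolding v_def by blast
    qed
    show "(\<lambda>(x, y). x - y) \<in> {(x, y). y ^ 2 = x ^ 2 - c} \<rightarrow> - {0}" using assms by auto
    fix u :: "'p mod_ring" assume "u \<in> - {0}"
    show "(case ((u + c / u) / 2, (c / u - u) / 2) of (x, y) \<Rightarrow> x - y) = u"
      using two by (simp flip: diff_divide_distrib mult_2)
  next
    fix p assume "p \<in> {(x, y). y ^ 2 = x ^ 2 - c}"
    then obtain x y where p: "p = (x, y)" "y ^ 2 = x ^ 2 - c" by auto
    have c: "c = (x - y) * (x + y)" using p(2) by (simp add: power2_eq_square algebra_simps)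
    then have "x - y \<noteq> 0" using assms by auto
    then have "c / (x - y) = x + y" by (simp add: c)
    moreover have "(x - y + (x + y)) / 2 = x" "(x + y - (x - y)) / 2 = y"
      using two by (simp_all flip: mult_2)
    ultimately show "((\<lambda>u. ((u + c / u) / 2, (c / u - u) / 2)) (case p of (x, y) \<Rightarrow> x - y)) = p"
      by (simp add: p(1))
  qed
  then have "card {(x, y). y ^ 2 = x ^ 2 - c} = card (- {0 :: 'p mod_ring})"
    using bij_betw_same_card by force
  also have "\<dots> = CARD('p) - 1" by (simp add: Compl_eq_Diff_UNIV)
  finally show ?thesis using card_double_cover[of "\<lambda>x. x ^ 2 - c"] odd by simp
qed

text \<open>
  \<open>y\<^sup>2 - 4 a N\<close> is the discriminant of \<open>a x\<^sup>2 - y x + N\<close>, whose zeros \<open>x\<close> are the solutions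
  of \<open>y = a x + N / x\<close>.
\<close>

lemma H_set_eq:
  assumes "a \<noteq> 0" "N \<noteq> (0 :: 'p mod_ring)"
  shows "H_set a N = {y. chi (y ^ 2 - 4 * a * N) \<noteq> - 1}"
proof
  show "H_set a N \<subseteq> {y. chi (y ^ 2 - 4 * a * N) \<noteq> - 1}"
  proof
    fix y assume "y \<in> H_set a N"
    then obtain x where x: "x \<noteq> 0" "y = a * x + N * inverse x" by (auto simp: H_set_def)
    have "y ^ 2 - 4 * a * N = (a * x - N * inverse x) ^ 2"
      using x(1) by (simp add: x(2) power2_eq_square algebra_simps)
    then show "y \<in> {y. chi (y ^ 2 - 4 * a * N) \<noteq> - 1}" by (auto simp: chi_eq)
  qed
  show "{y. chi (y ^ 2 - 4 * a * N) \<noteq> - 1} \<subseteq> H_set a N"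
  proof
    fix y assume "y \<in> {y. chi (y ^ 2 - 4 * a * N) \<noteq> - 1}"
    then obtain s where s: "s ^ 2 = y ^ 2 - 4 * a * N" by (auto simp: chi_eq split: if_splits)
    define x where "x = (y + s) / (2 * a)"
    have eq: "(y + s) * (y - s) = 4 * a * N" using s by (simp add: power2_eq_square algebra_simps)
    have nz: "y + s \<noteq> 0" using eq assms four by auto
    then have x0: "x \<noteq> 0" using assms two by (simp add: x_def)
    have ax: "a * x = (y + s) / 2" using assms by (simp add: x_def)
    have "N * inverse x = (y - s) / 2"
    proof -
      have "N * inverse x = N * (2 * a) / (y + s)" by (simp add: x_def)
      also have "\<dots> = (y - s) / 2" using eq nz two by (simp add: field_simps)
      finally show ?thesis .
    qed
    moreover have "(y + s) / 2 + (y - s) / 2 = y"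
      using two by (simp flip: add_divide_distrib mult_2)
    ultimately have "y = a * x + N * inverse x" by (metis ax)
    then show "y \<in> H_set a N" using x0 by (auto simp: H_set_def)
  qed
qed

definition char_sum :: int where
  "char_sum = (\<Sum>x\<in>UNIV. chi ((x ^ 2 - 1) * (x ^ 2 - \<gamma>)))"

lemma \<gamma>_neq_1: "\<gamma> \<noteq> 1"
  using chi_\<gamma> by auto

lemma chi_4_mult: "chi (4 * x) = chi (x :: 'p mod_ring)"
proof -
  have "4 * x = 2 ^ 2 * x" by simp
  then show ?thesis using chi_square_mult[OF two, of x] by metis
qed

lemma sum_over_square_roots:
  fixes f :: "'p mod_ring \<Rightarrow> int"
  shows "(\<Sum>y\<in>UNIV. if y ^ 2 = c then f (y ^ 2) else 0) = (1 + chi c) * f c"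
proof -
  have "(\<Sum>y\<in>UNIV. if y ^ 2 = c then f (y ^ 2) else 0) = (\<Sum>y\<in>{y. y ^ 2 = c}. f c)"
    by (rule sum.mono_neutral_cong_right) auto
  then show ?thesis by (simp add: card_square_roots)
qed

text \<open>
  For \<open>p = y\<^sup>2 - c\<close> and \<open>q = y\<^sup>2 - d\<close> the product \<open>(1 - \<chi> p) (1 - \<chi> q)\<close> is \<open>4\<close> on the
  complement of the union and \<open>0\<close> elsewhere, except at the zeros of \<open>p\<close> or \<open>q\<close>. There \<open>y\<^sup>2\<close> is
  \<open>c\<close> or \<open>d\<close>, which gives the two correction terms.
\<close>

lemma four_card_complement:
  assumes N: "N \<noteq> (0 :: 'p mod_ring)"
  shows "4 * int (card (- U_set \<gamma> (\<gamma>\<^sup>2) N)) =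
    int CARD('p) + 2 + (\<Sum>y\<in>UNIV. chi ((y ^ 2 - 4 * \<gamma> * N) * (y ^ 2 - 4 * \<gamma> ^ 2 * N)))
      - (1 - chi N) * (1 + chi N * chi (1 - \<gamma>)) - (1 + chi N) * (1 + chi N * chi (\<gamma> - 1))"
proof -
  define c d where "c = 4 * \<gamma> * N" and "d = 4 * \<gamma> ^ 2 * N"
  have c0: "c \<noteq> 0" and d0: "d \<noteq> 0" using N \<gamma>_nonzero four by (simp_all add: c_def d_def)
  have cd: "c \<noteq> d" using N \<gamma>_nonzero four \<gamma>_neq_1 by (simp add: c_def d_def power2_eq_square)
  have chi_c: "chi c = - chi N" by (simp add: c_def mult.assoc chi_4_mult chi_\<gamma>_mult)
  have chi_d: "chi d = chi N" by (simp add: d_def mult.assoc chi_4_mult chi_square_mult[OF \<gamma>_nonzero])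
  have "c - d = 4 * (\<gamma> * (N * (1 - \<gamma>)))" by (simp add: c_def d_def power2_eq_square algebra_simps)
  then have chi_cd: "chi (c - d) = - (chi N * chi (1 - \<gamma>))"
    by (simp only: chi_4_mult chi_\<gamma>_mult) (simp add: chi_mult)
  have "d - c = 4 * (\<gamma> * (N * (\<gamma> - 1)))" by (simp add: c_def d_def power2_eq_square algebra_simps)
  then have chi_dc: "chi (d - c) = - (chi N * chi (\<gamma> - 1))"
    by (simp only: chi_4_mult chi_\<gamma>_mult) (simp add: chi_mult)
  have compl: "- U_set \<gamma> (\<gamma>\<^sup>2) N = {y. chi (y ^ 2 - c) = - 1 \<and> chi (y ^ 2 - d) = - 1}"
    using N \<gamma>_nonzero by (auto simp: U_set_def H_set_eq c_def d_def)
  have ind: "4 * (if chi (y ^ 2 - c) = - 1 \<and> chi (y ^ 2 - d) = - 1 then 1 else 0) =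
      (1 - chi (y ^ 2 - c)) * (1 - chi (y ^ 2 - d))
      - (if y ^ 2 = c then 1 - chi (y ^ 2 - d) else 0) - (if y ^ 2 = d then 1 - chi (y ^ 2 - c) else 0)" for y
  proof -
    consider "y ^ 2 = c" | "y ^ 2 = d" | "y ^ 2 - c \<noteq> 0" "y ^ 2 - d \<noteq> 0" by fastforce
    then show ?thesis
    proof cases
      case 1
      then show ?thesis using cd by simp
    next
      case 2
      then show ?thesis using cd by simp
    next
      case 3
      then show ?thesis using chi_cases[OF 3(1)] chi_cases[OF 3(2)] by auto
    qed
  qed
  have "int (card (- U_set \<gamma> (\<gamma>\<^sup>2) N)) = (\<Sum>y\<in>UNIV. if chi (y ^ 2 - c) = - 1 \<and> chi (y ^ 2 - d) = - 1 then 1 else 0)"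
    unfolding compl by (simp add: sum.If_cases)
  then have "4 * int (card (- U_set \<gamma> (\<gamma>\<^sup>2) N)) =
      (\<Sum>y\<in>UNIV. (1 - chi (y ^ 2 - c)) * (1 - chi (y ^ 2 - d))
      - (if y ^ 2 = c then 1 - chi (y ^ 2 - d) else 0) - (if y ^ 2 = d then 1 - chi (y ^ 2 - c) else 0))"
    by (simp only: sum_distrib_left ind)
  also have "\<dots> = (\<Sum>y\<in>UNIV. (1 - chi (y ^ 2 - c)) * (1 - chi (y ^ 2 - d)))
      - (1 + chi c) * (1 - chi (c - d)) - (1 + chi d) * (1 - chi (d - c))"
    unfolding sum_subtractf
    using sum_over_square_roots[of c "\<lambda>z. 1 - chi (z - d)"] sum_over_square_roots[of d "\<lambda>z. 1 - chi (z - c)"]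
    by simp
  also have "(\<Sum>y\<in>UNIV. (1 - chi (y ^ 2 - c)) * (1 - chi (y ^ 2 - d))) =
      (\<Sum>y\<in>UNIV. 1 - chi (y ^ 2 - c) - chi (y ^ 2 - d) + chi ((y ^ 2 - c) * (y ^ 2 - d)))"
    by (intro sum.cong refl) (simp only: chi_mult, simp add: algebra_simps)
  also have "\<dots> = int CARD('p) + 2 + (\<Sum>y\<in>UNIV. chi ((y ^ 2 - c) * (y ^ 2 - d)))"
    by (simp add: sum.distrib sum_subtractf sum_chi_square_minus[OF c0] sum_chi_square_minus[OF d0])
  finally show ?thesis unfolding chi_c chi_d chi_cd chi_dc by (simp add: c_def d_def)
qed

lemma sum_scale:
  fixes f :: "'p mod_ring \<Rightarrow> int"
  assumes "k \<noteq> 0"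
  shows "(\<Sum>y\<in>UNIV. f y) = (\<Sum>z\<in>UNIV. f (k * z))"
proof (rule sum.reindex_bij_betw[symmetric])
  show "bij_betw ((*) k) UNIV UNIV"
    by (rule bij_betwI[where g = "\<lambda>y. y / k"]) (use assms in auto)
qed

lemma chi_squares_mult:
  fixes x y :: "'p mod_ring"
  assumes "u \<noteq> 0" "v \<noteq> 0"
  shows "chi ((u ^ 2 * x) * (v ^ 2 * y)) = chi (x * y)"
proof -
  have "(u ^ 2 * x) * (v ^ 2 * y) = (u * v) ^ 2 * (x * y)" by (simp add: power_mult_distrib ac_simps)
  moreover have "u * v \<noteq> 0" using assms by simp
  ultimately show ?thesis using chi_square_mult by metis
qed

text \<open>
  Here \<open>\<gamma> N = m\<^sup>2\<close>, and \<open>y = 2 m z\<close> turns the two factors into square multiples of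
  \<open>z\<^sup>2 - 1\<close> and \<open>z\<^sup>2 - \<gamma>\<close>.
\<close>

lemma char_sum_nonsquare:
  assumes "chi N = - 1"
  shows "(\<Sum>y\<in>UNIV. chi ((y ^ 2 - 4 * \<gamma> * N) * (y ^ 2 - 4 * \<gamma> ^ 2 * N))) = char_sum"
proof -
  have "chi (\<gamma> * N) = 1" using assms by (simp add: chi_\<gamma>_mult)
  then obtain m where m: "m \<noteq> 0" "m ^ 2 = \<gamma> * N" using chi_squareD by blast
  have "chi (((2 * m * z) ^ 2 - 4 * \<gamma> * N) * ((2 * m * z) ^ 2 - 4 * \<gamma> ^ 2 * N)) =
      chi ((z ^ 2 - 1) * (z ^ 2 - \<gamma>))" for z
  proof -
    have 1: "(2 * m * z) ^ 2 - 4 * \<gamma> * N = (2 * m) ^ 2 * (z ^ 2 - 1)"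
      by (simp add: power_mult_distrib m(2) algebra_simps)
    have 2: "(2 * m * z) ^ 2 - 4 * \<gamma> ^ 2 * N = (2 * m) ^ 2 * (z ^ 2 - \<gamma>)"
      by (simp add: power_mult_distrib m(2) power2_eq_square[of \<gamma>] algebra_simps)
    have "2 * m \<noteq> 0" using two m(1) by simp
    then show ?thesis unfolding 1 2 by (intro chi_squares_mult)
  qed
  then show ?thesis
    using sum_scale[of "2 * m" "\<lambda>y. chi ((y ^ 2 - 4 * \<gamma> * N) * (y ^ 2 - 4 * \<gamma> ^ 2 * N))"] two m(1)
    by (simp add: char_sum_def)
qed

text \<open>
  Substituting \<open>z = 1 / w\<close> multiplies the reciprocal quartic by the square of \<open>w\<^sup>2\<close>. The terms at zero
  have to be treated apart: \<open>1\<close> on the left and \<open>\<chi> \<gamma> = - 1\<close> on the right.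
\<close>

lemma char_sum_reciprocal:
  "(\<Sum>z\<in>UNIV. chi ((\<gamma> * z ^ 2 - 1) * (z ^ 2 - 1))) = char_sum + 2"
proof -
  have "chi ((\<gamma> * inverse w ^ 2 - 1) * (inverse w ^ 2 - 1)) = chi ((w ^ 2 - 1) * (w ^ 2 - \<gamma>))"
    if w: "w \<in> - {0}" for w
  proof -
    have "(\<gamma> * inverse w ^ 2 - 1) * (inverse w ^ 2 - 1) = (inverse w ^ 2) ^ 2 * ((w ^ 2 - 1) * (w ^ 2 - \<gamma>))"
      using w by (simp add: field_simps power2_eq_square)
    then show ?thesis using chi_square_mult[of "inverse w ^ 2"] w by simp
  qed
  moreover have "bij_betw inverse (- {0}) (- {0 :: 'p mod_ring})"
    by (rule bij_betwI[where g = inverse]) auto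
  ultimately have "(\<Sum>z\<in>- {0}. chi ((\<gamma> * z ^ 2 - 1) * (z ^ 2 - 1))) =
      (\<Sum>w\<in>- {0}. chi ((w ^ 2 - 1) * (w ^ 2 - \<gamma>)))"
    using sum.reindex_bij_betw[of inverse "- {0}" "- {0}" "\<lambda>z. chi ((\<gamma> * z ^ 2 - 1) * (z ^ 2 - 1))"] by simp
  moreover have split: "sum f UNIV = f 0 + sum f (- {0})" for f :: "'p mod_ring \<Rightarrow> int"
    using sum.remove[of UNIV 0 f] by (simp add: Compl_eq_Diff_UNIV)
  ultimately show ?thesis by (simp add: char_sum_def split chi_\<gamma>)
qed

text \<open>
  Here \<open>N = m\<^sup>2\<close>, and \<open>y = 2 \<gamma> m z\<close> turns the product of the two factors into \<open>\<gamma>\<close> times a square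
  multiple of the reciprocal quartic.
\<close>

lemma char_sum_square:
  assumes "chi N = 1"
  shows "(\<Sum>y\<in>UNIV. chi ((y ^ 2 - 4 * \<gamma> * N) * (y ^ 2 - 4 * \<gamma> ^ 2 * N))) = - char_sum - 2"
proof -
  obtain m where m: "m \<noteq> 0" "m ^ 2 = N" using chi_squareD assms by blast
  have "chi (((2 * \<gamma> * m * z) ^ 2 - 4 * \<gamma> * N) * ((2 * \<gamma> * m * z) ^ 2 - 4 * \<gamma> ^ 2 * N)) =
      - chi ((\<gamma> * z ^ 2 - 1) * (z ^ 2 - 1))" for z
  proof -
    have 1: "(2 * \<gamma> * m * z) ^ 2 - 4 * \<gamma> * N = (2 * m) ^ 2 * (\<gamma> * (\<gamma> * z ^ 2 - 1))"
      by (simp add: power_mult_distrib m(2) power2_eq_square[of \<gamma>] algebra_simps)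
    have 2: "(2 * \<gamma> * m * z) ^ 2 - 4 * \<gamma> ^ 2 * N = (2 * \<gamma> * m) ^ 2 * (z ^ 2 - 1)"
      by (simp add: power_mult_distrib m(2) algebra_simps)
    have "2 * m \<noteq> 0" "2 * \<gamma> * m \<noteq> 0" using two m(1) \<gamma>_nonzero by simp_all
    then have "chi (((2 * m) ^ 2 * (\<gamma> * (\<gamma> * z ^ 2 - 1))) * ((2 * \<gamma> * m) ^ 2 * (z ^ 2 - 1))) =
        chi (\<gamma> * (\<gamma> * z ^ 2 - 1) * (z ^ 2 - 1))" by (rule chi_squares_mult)
    then show ?thesis unfolding 1 2 mult.assoc[of \<gamma> "_ - _"] chi_\<gamma>_mult .
  qed
  then have "(\<Sum>y\<in>UNIV. chi ((y ^ 2 - 4 * \<gamma> * N) * (y ^ 2 - 4 * \<gamma> ^ 2 * N))) =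
      - (\<Sum>z\<in>UNIV. chi ((\<gamma> * z ^ 2 - 1) * (z ^ 2 - 1)))"
    using sum_scale[of "2 * \<gamma> * m" "\<lambda>y. chi ((y ^ 2 - 4 * \<gamma> * N) * (y ^ 2 - 4 * \<gamma> ^ 2 * N))"] two m(1) \<gamma>_nonzero
    by (simp add: sum_negf)
  then show ?thesis by (simp add: char_sum_reciprocal)
qed

lemma U_bound_iff:
  "real (card (U_set \<gamma> (\<gamma>\<^sup>2) N)) \<le> 3 * real CARD('p) / 4 + 1 \<longleftrightarrow>
     int CARD('p) \<le> 4 * int (card (- U_set \<gamma> (\<gamma>\<^sup>2) N)) + 4"
proof -
  let ?U = "U_set \<gamma> (\<gamma>\<^sup>2) N"
  have "card (?U \<union> - ?U) = card ?U + card (- ?U)" by (rule card_Un_disjoint) auto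
  then have "card ?U + card (- ?U) = CARD('p)" by simp
  then show ?thesis by linarith
qed

text \<open>
  The lower bound on the trace comes from the squares \<open>N\<close>, the upper bound from the
  nonsquares. Both classes are nonempty, as \<open>1\<close> and \<open>\<gamma>\<close> show.
\<close>

lemma U_bound_iff_char_sum:
  "(\<forall>N::'p mod_ring. N \<noteq> 0 \<longrightarrow> real (card (U_set \<gamma> (\<gamma>\<^sup>2) N)) \<le> 3 * real CARD('p) / 4 + 1) \<longleftrightarrow>
    (- 3 + 2 * chi (\<gamma> - 1) \<le> - 1 - char_sum \<and> - 1 - char_sum \<le> 3 + 2 * chi (1 - \<gamma>))"
    (is "?L \<longleftrightarrow> ?R")
proof -
  have square: "int CARD('p) \<le> 4 * int (card (- U_set \<gamma> (\<gamma>\<^sup>2) N)) + 4 \<longleftrightarrow>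
      - 3 + 2 * chi (\<gamma> - 1) \<le> - 1 - char_sum" if N: "chi N = 1" for N
  proof -
    have "N \<noteq> 0" using N by auto
    then show ?thesis using N by (simp add: four_card_complement char_sum_square) linarith
  qed
  have nonsquare: "int CARD('p) \<le> 4 * int (card (- U_set \<gamma> (\<gamma>\<^sup>2) N)) + 4 \<longleftrightarrow>
      - 1 - char_sum \<le> 3 + 2 * chi (1 - \<gamma>)" if N: "chi N = - 1" for N
  proof -
    have "N \<noteq> 0" using N by auto
    then show ?thesis using N by (simp add: four_card_complement char_sum_nonsquare) linarith
  qed
  show ?thesis
    unfolding U_bound_iff
  proof
    assume "\<forall>N. N \<noteq> 0 \<longrightarrow> int CARD('p) \<le> 4 * int (card (- U_set \<gamma> (\<gamma>\<^sup>2) N)) + 4"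
    then show ?R using square[of 1] nonsquare[of \<gamma>] chi_\<gamma> \<gamma>_nonzero by simp
  next
    assume ?R
    then show "\<forall>N. N \<noteq> 0 \<longrightarrow> int CARD('p) \<le> 4 * int (card (- U_set \<gamma> (\<gamma>\<^sup>2) N)) + 4"
      using square nonsquare chi_cases by blast
  qed
qed

lemma frobenius_trace_eq:
  assumes "smooth_projective_model 2 {quartic \<gamma>} n E"
  shows "frobenius_trace n E = - 1 - char_sum"
proof -
  have "int (card (rational_points n E)) = int CARD('p) + char_sum + 2"
    unfolding card_rational_points_quartic_model[OF two \<gamma>_nonzero \<gamma>_neq_1 assms] char_sum_def
    using card_double_cover[of "\<lambda>x. (x ^ 2 - 1) * (x ^ 2 - \<gamma>)"] by simp
  then show ?thesis by (simp add: frobenius_trace_def)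
qed

end

theorem corollary6p4:
  fixes \<gamma> :: "'p::prime_card mod_ring"
    and l n :: nat
    and E :: "'p mod_ring mpoly set"
    and t :: int
  assumes "l = CARD('p)" and "l > 2"
    and "primitive_root \<gamma>"
    and "smooth_projective_model 2 {quartic \<gamma>} n E"
    and "t = frobenius_trace n E"
  shows "(\<forall>N::'p mod_ring. N \<noteq> 0 \<longrightarrow> real (card (U_set \<gamma> (\<gamma>\<^sup>2) N)) \<le> 3 * real l / 4 + 1) \<longleftrightarrow>
    (- 3 + 2 * chi (\<gamma> - 1) \<le> t \<and> t \<le> 3 + 2 * chi (1 - \<gamma>))"
proof -
  interpret odd_primitive_root \<gamma>
    using assms(1-3) by unfold_locales simp_all
  show ?thesis
    unfolding assms(1,5) frobenius_trace_eq[OF assms(4)] by (rule U_bound_iff_char_sum)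
qed

end
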